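(* Let $\mathfrak{M}=(M,\mathcal{X})$ be a countable model of $\mathsf{RCA}_0^*$ and let $A\in\mathcal{X}$. Then there exists a collection $\mathcal{Y}$ of subsets of $M$ such that $(M,\mathcal{Y})\models\mathsf{WKL}_0^*$ and for every $Y\in\mathcal{Y}$: $Y$ is second-order definable over $(M,\mathcal{X})$ if and only if $Y\in\Delta^0_1(A)$.
   Context: $\mathsf{RCA}_0^*$ is the subsystem of second-order arithmetic consisting of the basic axioms $P^-$, $\Delta^0_0$-induction, totality of exponentiation, and $\Delta^0_1$-comprehension. $\mathsf{WKL}_0^*$ is $\mathsf{RCA}_0^*$ plus weak König's lemma (every unbounded binary tree has an unbounded path). A set $Y\subseteq M$ is second-order definable over $(M,\mathcal{X})$ if it is definable over $(M,\mathcal{X})$ by a formula of second-order arithmetic with parameters from $M$ and $\mathcal{X}$. $Y\in\Delta^0_1(A)$ means $Y$ is definable over $M$ both by a $\Sigma^0_1$ and by a $\Pi^0_1$ formula with number parameters and with $A$ as the only set parameter. *)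

theory Defs
  imports "HOL-Library.Countable_Set"
begin

text \<open>
  Non-negative parts of discretely ordered rings, i.e. models of \<open>P\<^sup>-\<close>. The first-order part \<open>M\<close>
  of a structure for second-order arithmetic is a type of this class; the second-order part is a
  set of type \<open>'m set set\<close>.
\<close>

class peano_minus = comm_semiring_1 + linorder +
  assumes add_less_mono_right: "a < b \<Longrightarrow> a + c < b + c"
    and mult_less_mono_right: "0 < c \<Longrightarrow> a < b \<Longrightarrow> a * c < b * c"
    and less_imp_add: "a < b \<Longrightarrow> \<exists>c. a + c = b"
    and discrete_one: "0 < a \<Longrightarrow> 1 \<le> a"
    and nonneg: "0 \<le> a"

text \<open>
  Formulas of second-order arithmetic. Variables of both sorts are de Bruijn indices; the two
  sorts have separate index spaces. Bounded quantifiers are primitive, and the bounding term lies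
  outside the scope of the variable it bounds.
\<close>

datatype tm = Var nat | Zero | One | Plus tm tm | Times tm tm

datatype fm =
    Eq tm tm | Lt tm tm | Mem tm nat
  | Neg fm | Conj fm fm | Disj fm fm
  | BForall tm fm | BExists tm fm
  | Forall fm | Exists fm
  | ForallSet fm | ExistsSet fm

primrec val :: "(nat \<Rightarrow> 'm::peano_minus) \<Rightarrow> tm \<Rightarrow> 'm" where
  "val e (Var n) = e n"
| "val e Zero = 0"
| "val e One = 1"
| "val e (Plus s t) = val e s + val e t"
| "val e (Times s t) = val e s * val e t"

primrec sat :: "'m::peano_minus set set \<Rightarrow> (nat \<Rightarrow> 'm) \<Rightarrow> (nat \<Rightarrow> 'm set) \<Rightarrow> fm \<Rightarrow> bool" where
  "sat \<X> e E (Eq s t) \<longleftrightarrow> val e s = val e t"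
| "sat \<X> e E (Lt s t) \<longleftrightarrow> val e s < val e t"
| "sat \<X> e E (Mem t n) \<longleftrightarrow> val e t \<in> E n"
| "sat \<X> e E (Neg \<phi>) \<longleftrightarrow> \<not> sat \<X> e E \<phi>"
| "sat \<X> e E (Conj \<phi> \<psi>) \<longleftrightarrow> sat \<X> e E \<phi> \<and> sat \<X> e E \<psi>"
| "sat \<X> e E (Disj \<phi> \<psi>) \<longleftrightarrow> sat \<X> e E \<phi> \<or> sat \<X> e E \<psi>"
| "sat \<X> e E (BForall t \<phi>) \<longleftrightarrow> (\<forall>x. x < val e t \<longrightarrow> sat \<X> (case_nat x e) E \<phi>)"
| "sat \<X> e E (BExists t \<phi>) \<longleftrightarrow> (\<exists>x. x < val e t \<and> sat \<X> (case_nat x e) E \<phi>)"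
| "sat \<X> e E (Forall \<phi>) \<longleftrightarrow> (\<forall>x. sat \<X> (case_nat x e) E \<phi>)"
| "sat \<X> e E (Exists \<phi>) \<longleftrightarrow> (\<exists>x. sat \<X> (case_nat x e) E \<phi>)"
| "sat \<X> e E (ForallSet \<phi>) \<longleftrightarrow> (\<forall>S\<in>\<X>. sat \<X> e (case_nat S E) \<phi>)"
| "sat \<X> e E (ExistsSet \<phi>) \<longleftrightarrow> (\<exists>S\<in>\<X>. sat \<X> e (case_nat S E) \<phi>)"

text \<open>
  The set defined by \<open>\<phi>\<close>: variable \<open>0\<close> is the argument, and the environments \<open>e\<close> and \<open>E\<close>
  supply the number and set parameters.
\<close>

definition defset :: "'m::peano_minus set set \<Rightarrow> (nat \<Rightarrow> 'm) \<Rightarrow> (nat \<Rightarrow> 'm set) \<Rightarrow> fm \<Rightarrow> 'm set" where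
  "defset \<X> e E \<phi> = {x. sat \<X> (case_nat x e) E \<phi>}"

primrec delta00 :: "fm \<Rightarrow> bool" where
  "delta00 (Eq s t) \<longleftrightarrow> True"
| "delta00 (Lt s t) \<longleftrightarrow> True"
| "delta00 (Mem t n) \<longleftrightarrow> True"
| "delta00 (Neg \<phi>) \<longleftrightarrow> delta00 \<phi>"
| "delta00 (Conj \<phi> \<psi>) \<longleftrightarrow> delta00 \<phi> \<and> delta00 \<psi>"
| "delta00 (Disj \<phi> \<psi>) \<longleftrightarrow> delta00 \<phi> \<and> delta00 \<psi>"
| "delta00 (BForall t \<phi>) \<longleftrightarrow> delta00 \<phi>"
| "delta00 (BExists t \<phi>) \<longleftrightarrow> delta00 \<phi>"
| "delta00 (Forall \<phi>) \<longleftrightarrow> False"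
| "delta00 (Exists \<phi>) \<longleftrightarrow> False"
| "delta00 (ForallSet \<phi>) \<longleftrightarrow> False"
| "delta00 (ExistsSet \<phi>) \<longleftrightarrow> False"

definition sigma01 :: "fm \<Rightarrow> bool" where
  "sigma01 \<phi> \<longleftrightarrow> (\<exists>\<theta>. delta00 \<theta> \<and> \<phi> = Exists \<theta>)"

definition pi01 :: "fm \<Rightarrow> bool" where
  "pi01 \<phi> \<longleftrightarrow> (\<exists>\<theta>. delta00 \<theta> \<and> \<phi> = Forall \<theta>)"

definition so_definable :: "'m::peano_minus set set \<Rightarrow> 'm set \<Rightarrow> bool" where
  "so_definable \<X> Y \<longleftrightarrow> (\<exists>\<phi> e E. range E \<subseteq> \<X> \<and> Y = defset \<X> e E \<phi>)"

text \<open>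
  All set variables are interpreted as \<open>A\<close>, the only set parameter. The second-order part \<open>{A}\<close>
  is irrelevant here because the formulas contain no set quantifiers.
\<close>

definition delta01_in :: "'m::peano_minus set \<Rightarrow> 'm set set" where
  "delta01_in A = {Y.
     (\<exists>\<phi> e. sigma01 \<phi> \<and> Y = defset {A} e (\<lambda>_. A) \<phi>) \<and>
     (\<exists>\<psi> e. pi01 \<psi> \<and> Y = defset {A} e (\<lambda>_. A) \<psi>)}"

definition delta00_induction :: "'m::peano_minus set set \<Rightarrow> bool" where
  "delta00_induction \<X> \<longleftrightarrow>
     (\<forall>\<phi> e E. delta00 \<phi> \<longrightarrow> range E \<subseteq> \<X> \<longrightarrow>
        sat \<X> (case_nat 0 e) E \<phi> \<longrightarrow>
        (\<forall>x. sat \<X> (case_nat x e) E \<phi> \<longrightarrow> sat \<X> (case_nat (x + 1) e) E \<phi>) \<longrightarrow>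
        (\<forall>x. sat \<X> (case_nat x e) E \<phi>))"

definition delta01_comprehension :: "'m::peano_minus set set \<Rightarrow> bool" where
  "delta01_comprehension \<X> \<longleftrightarrow>
     (\<forall>\<phi> \<psi> e E. sigma01 \<phi> \<longrightarrow> pi01 \<psi> \<longrightarrow> range E \<subseteq> \<X> \<longrightarrow>
        (\<forall>x. sat \<X> (case_nat x e) E \<phi> \<longleftrightarrow> sat \<X> (case_nat x e) E \<psi>) \<longrightarrow>
        (\<exists>S\<in>\<X>. \<forall>x. x \<in> S \<longleftrightarrow> sat \<X> (case_nat x e) E \<phi>))"

text \<open>
  Exponentiation is not in the language. Its graph is defined through a computation sequence
  \<open>1, x, x\<^sup>2, \<dots>, x\<^sup>y\<close> coded by Goedel's beta function: \<open>beta a b i u\<close> says that \<open>u\<close> is the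
  remainder of \<open>a\<close> modulo \<open>1 + (i + 1) b\<close>. Over \<open>\<Delta>\<^sub>0\<close>-induction, totality of this graph is
  equivalent to totality of the usual bounded-formula graph.
\<close>

definition beta :: "'m::peano_minus \<Rightarrow> 'm \<Rightarrow> 'm \<Rightarrow> 'm \<Rightarrow> bool" where
  "beta a b i u \<longleftrightarrow> u < 1 + (i + 1) * b \<and> (\<exists>q. a = q * (1 + (i + 1) * b) + u)"

definition exp_graph :: "'m::peano_minus \<Rightarrow> 'm \<Rightarrow> 'm \<Rightarrow> bool" where
  "exp_graph x y z \<longleftrightarrow>
     (\<exists>a b. beta a b 0 1 \<and>
            (\<forall>i<y. \<exists>u. beta a b i u \<and> beta a b (i + 1) (x * u)) \<and>
            beta a b y z)"

definition exp_total :: "'m::peano_minus itself \<Rightarrow> bool" where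
  "exp_total _ \<longleftrightarrow> (\<forall>x y :: 'm. \<exists>z. exp_graph x y z)"

text \<open>
  \<open>P\<^sup>-\<close> is built into the type class. Without \<open>\<X> \<noteq> {}\<close> the schemes would hold vacuously for
  the empty collection, since set environments are total functions into \<open>\<X>\<close>; comprehension for
  formulas without set parameters forces \<open>\<X>\<close> to be nonempty.
\<close>

definition RCA0_star :: "'m::peano_minus set set \<Rightarrow> bool" where
  "RCA0_star \<X> \<longleftrightarrow>
     \<X> \<noteq> {} \<and> delta00_induction \<X> \<and> exp_total TYPE('m) \<and> delta01_comprehension \<X>"

text \<open>
  The binary string \<open>b\<^sub>1\<dots>b\<^sub>n\<close> is coded by the number with binary expansion \<open>1b\<^sub>1\<dots>b\<^sub>n\<close>, so the
  codes are exactly the positive numbers, and \<open>\<sigma>\<close> is an initial segment of \<open>\<tau>\<close> iff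
  \<open>\<tau> = \<sigma> 2\<^sup>k + r\<close> for some \<open>k\<close> and \<open>r < 2\<^sup>k\<close>.
\<close>

definition initial_segment :: "'m::peano_minus \<Rightarrow> 'm \<Rightarrow> bool" where
  "initial_segment \<sigma> \<tau> \<longleftrightarrow>
     0 < \<sigma> \<and> (\<exists>k p r. exp_graph 2 k p \<and> r < p \<and> \<tau> = \<sigma> * p + r)"

definition binary_tree :: "'m::peano_minus set \<Rightarrow> bool" where
  "binary_tree T \<longleftrightarrow>
     (\<forall>\<sigma>\<in>T. 0 < \<sigma>) \<and> (\<forall>\<tau>\<in>T. \<forall>\<sigma>. initial_segment \<sigma> \<tau> \<longrightarrow> \<sigma> \<in> T)"

text \<open>A path is given by the set of its finite initial segments.\<close>

definition path_of :: "'m::peano_minus set \<Rightarrow> 'm set \<Rightarrow> bool" where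
  "path_of T P \<longleftrightarrow>
     P \<subseteq> T \<and> binary_tree P \<and>
     (\<forall>\<sigma>\<in>P. \<forall>\<tau>\<in>P. initial_segment \<sigma> \<tau> \<or> initial_segment \<tau> \<sigma>)"

definition weak_Koenig :: "'m::peano_minus set set \<Rightarrow> bool" where
  "weak_Koenig \<X> \<longleftrightarrow>
     (\<forall>T\<in>\<X>. binary_tree T \<longrightarrow> \<not> bdd_above T \<longrightarrow>
        (\<exists>P\<in>\<X>. path_of T P \<and> \<not> bdd_above P))"

definition WKL0_star :: "'m::peano_minus set set \<Rightarrow> bool" where
  "WKL0_star \<X> \<longleftrightarrow> RCA0_star \<X> \<and> weak_Koenig \<X>"

end

theory Submission
  imports Defs "HOL-Library.Countable"
begin

text \<open>
  Weak Koenig's lemma is forced over a countable model \<open>\<Z>\<close> of \<open>RCA\<^sub>0\<^sup>*\<close>, starting from the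
  \<open>\<Delta>\<^sup>0\<^sub>1(A)\<close> sets, while avoiding the countably many sets \<open>C\<close> that are second-order definable over
  \<open>(M, \<X>)\<close> but not \<open>\<Delta>\<^sup>0\<^sub>1(A)\<close>. Given an unbounded tree \<open>T \<in> \<Z>\<close>, force with its unbounded subtrees in
  \<open>\<Z>\<close>. For a \<open>\<Sigma>\<^sup>0\<^sub>1\<close> formula \<open>\<phi>(x, G)\<close>, the nodes that do not yet witness \<open>\<phi>(x)\<close> form a subtree
  \<open>T\<^sub>x\<close>, and since a tree is bounded iff it omits one level, boundedness of \<open>T\<^sub>x\<close> is a \<open>\<Sigma>\<^sup>0\<^sub>1\<close> property of
  \<open>x\<close>. Either some \<open>T\<^sub>x\<close> with \<open>x < b\<close> is unbounded, and passing to it refutes \<open>\<phi>(x, G)\<close>, or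
  \<open>\<Sigma>\<^sub>1\<close>-collection in \<open>\<Z>\<close> gives one level at which all \<open>x < b\<close> have witnesses: hence generic paths \<open>G\<close>
  preserve collection. If \<open>\<phi>, \<phi>'\<close> are meant to define \<open>C\<close> and its complement and no condition can
  spoil this, then \<open>C = {x. T\<^sub>x bounded}\<close> and \<open>- C = {x. T'\<^sub>x bounded}\<close>, so \<open>C \<in> \<Z>\<close>: hence generic
  paths keep every \<open>C \<notin> \<Z>\<close> out of the \<open>\<Delta>\<^sup>0\<^sub>1\<close> closure of \<open>\<Z> \<union> {G}\<close>.
\<close>

subsection \<open>Arithmetic\<close>

text \<open>Every set of \<X> is definable over (M, \<X>) with itself as parameter, so a set of \<X>
  outside \<Delta>1(A) must itself be avoided; this forces the start from \<open>Delta1 {A}\<close>.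
  Bounded induction and \<Sigma>1-collection for a set of parameters, together with exponentiation,
  make its \<Delta>1 closure a model, so these are what the addition of a path has to preserve.
  Bounded induction survives for every unbounded path: a bounded formula inspects G only up to a
  term, and a single node of G, a number, codes that part. Genericity is needed for collection,
  which the ground model has by exponentiation: finite sets are coded in binary. Levels of the
  binary tree are replaced by the codes strictly between m and 2 m + 2, which every longer string
  meets, so lengths are never computed. That the requirements are countably many rests on formulas
  reading only finitely many parameters. Since a new path creates new trees, two nested
  \<omega>-iterations are used, and finite support carries the schemes over to the unions.\<close>

instance peano_minus \<subseteq> canonically_ordered_monoid_add
proof
  fix a b :: 'a
  show "a \<le> b \<longleftrightarrow> (\<exists>c. b = a + c)"
  proof
    assume "a \<le> b"
    then show "\<exists>c. b = a + c"
      using less_imp_add[of a b] by (metis add.right_neutral order_le_less)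
  next
    assume "\<exists>c. b = a + c"
    then obtain c where c: "b = a + c" by blast
    show "a \<le> b"
    proof (cases "c = 0")
      case False
      then have "0 < c" using nonneg[of c] by simp
      then have "0 + a < c + a" by (rule add_less_mono_right)
      then show ?thesis by (simp add: c add.commute)
    qed (simp add: c)
  qed
qed

instance peano_minus \<subseteq> strict_ordered_comm_monoid_add
proof
  fix a b c d :: 'a
  assume "a < b" "c < d"
  then show "a + c < b + d"
    by (metis add.commute add_less_mono_right order_less_trans)
qed

instance peano_minus \<subseteq> ordered_comm_semiring
proof
  fix a b c :: 'a
  assume "a \<le> b" "0 \<le> c"
  then show "c * a \<le> c * b"
    by (metis distrib_left le_iff_add)
qed

lemma pm_add_less_cancel [simp]:
  fixes a b c :: "'m::peano_minus"
  shows "a + c < b + c \<longleftrightarrow> a < b" "c + a < c + b \<longleftrightarrow> a < b"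
  by (metis add_less_mono_right not_less_iff_gr_or_eq add.commute)+

lemma pm_add_le_cancel [simp]:
  fixes a b c :: "'m::peano_minus"
  shows "a + c \<le> b + c \<longleftrightarrow> a \<le> b" "c + a \<le> c + b \<longleftrightarrow> a \<le> b"
  by (metis linorder_not_less pm_add_less_cancel(1)) (metis linorder_not_less pm_add_less_cancel(2))

lemma pm_add_cancel [simp]:
  fixes a b c :: "'m::peano_minus"
  shows "a + c = b + c \<longleftrightarrow> a = b" "c + a = c + b \<longleftrightarrow> a = b"
  by (simp_all add: order_eq_iff)

lemma pm_zero_less_one [simp]: "(0::'m::peano_minus) < 1"
  using nonneg[of 1] by (simp add: order_le_less)

lemma pm_less_iff: "(a::'m::peano_minus) < b \<longleftrightarrow> a + 1 \<le> b"
proof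
  assume "a < b"
  then obtain c where c: "a + c = b" using less_imp_add by blast
  then have "c \<noteq> 0" using \<open>a < b\<close> by auto
  then have "1 \<le> c" by (intro discrete_one) (simp add: zero_less_iff_neq_zero)
  then show "a + 1 \<le> b" by (simp flip: c)
next
  assume "a + 1 \<le> b"
  moreover have "a + 0 < a + 1" unfolding pm_add_less_cancel by simp
  ultimately show "a < b" by simp
qed

lemma pm_less_add_one [simp]: "(a::'m::peano_minus) < b + 1 \<longleftrightarrow> a \<le> b"
  by (simp add: pm_less_iff)

lemma pm_not_less_zero [simp]: "\<not> (a::'m::peano_minus) < 0"
  by (simp add: not_less)

lemma pm_le_add [simp]: "(a::'m::peano_minus) \<le> a + b" "a \<le> b + a"
  by (simp_all add: add_increasing add_increasing2)

lemma pm_mult_less_cancel: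
  fixes a b c :: "'m::peano_minus"
  assumes "0 < c"
  shows "a * c < b * c \<longleftrightarrow> a < b"
  by (metis assms mult_less_mono_right not_less_iff_gr_or_eq)

lemma pm_mult_le_cancel:
  fixes a b c :: "'m::peano_minus"
  assumes "0 < c"
  shows "a * c \<le> b * c \<longleftrightarrow> a \<le> b"
  using pm_mult_less_cancel[OF assms] by (metis linorder_not_less)

lemma pm_le_mult:
  fixes a b :: "'m::peano_minus"
  assumes "0 < b"
  shows "a \<le> a * b" "a \<le> b * a"
proof -
  have "a * 1 \<le> a * b" by (rule mult_left_mono) (use assms discrete_one nonneg in auto)
  then show "a \<le> a * b" by simp
  then show "a \<le> b * a" by (simp add: mult.commute)
qed

lemma pm_division_unique:
  fixes d q q' u u' :: "'m::peano_minus"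
  assumes "q * d + u = q' * d + u'" "u < d" "u' < d"
  shows "q = q' \<and> u = u'"
proof -
  have *: "q \<le> q'" if "q * d + u = q' * d + u'" "u' < d" for q q' u u' :: 'm
  proof (rule ccontr)
    assume "\<not> q \<le> q'"
    then have "q' + 1 \<le> q" by (simp add: not_le pm_less_iff)
    then have "(q' + 1) * d \<le> q * d" by (rule mult_right_mono) (rule nonneg)
    then have "q' * d + d \<le> q * d" by (simp add: distrib_right)
    also have "\<dots> \<le> q * d + u" by simp
    finally show False using that by simp
  qed
  have "q = q'" using *[OF assms(1,3)] *[OF assms(1)[symmetric] assms(2)] by simp
  then show ?thesis using assms(1) by simp
qed

text \<open>The squared sum replaces Cantor's triangular number, so that no halving occurs and
  pairing is a term of the language. It is not onto: numbers that are not pairs must be dealt with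
  when complements are described.\<close>

definition pair :: "'m::peano_minus \<Rightarrow> 'm \<Rightarrow> 'm" where
  "pair x y = (x + y) * (x + y) + x"

text \<open>These bounds turn unpairing into a bounded search.\<close>

lemma le_pair: "x \<le> pair x y" "y \<le> pair x y" for x y :: "'m::peano_minus"
proof -
  show "x \<le> pair x y" by (simp add: pair_def)
  have "x + y \<le> (x + y) * (x + y)"
  proof (cases "x + y = 0")
    case False
    then have "0 < x + y" by (simp add: zero_less_iff_neq_zero)
    then show ?thesis by (rule pm_le_mult)
  qed simp
  moreover have "y \<le> x + y" by (simp add: add_increasing)
  ultimately show "y \<le> pair x y"
    unfolding pair_def by (meson add_increasing2 nonneg order_trans)
qed

text \<open>With s = x + y, the value lies between s * s and (s + 1) * (s + 1), the latter excluded;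
  hence s is determined, and then x.\<close>

lemma pair_inject: "pair x y = pair x' y' \<longleftrightarrow> x = x' \<and> y = y'"
  for x y :: "'m::peano_minus"
proof
  have *: "\<not> x + y < x' + y'" if "pair x y = pair x' y'" for x y x' y' :: 'm
  proof
    assume "x + y < x' + y'"
    then have "x + y + 1 \<le> x' + y'" by (simp add: pm_less_iff)
    then have "(x + y + 1) * (x + y + 1) \<le> (x' + y') * (x' + y')"
      by (intro mult_mono) (simp_all add: nonneg)
    also have "\<dots> \<le> pair x' y'" by (simp add: pair_def)
    also have "\<dots> = pair x y" by (simp add: that)
    also have "\<dots> < (x + y) * (x + y) + x + (x + y + y) + 1" by (simp add: pair_def)
    also have "\<dots> = (x + y + 1) * (x + y + 1)" by (simp add: algebra_simps)
    finally show False by simp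
  qed
  assume eq: "pair x y = pair x' y'"
  have "x + y = x' + y'" using *[OF eq] *[OF eq[symmetric]] by simp
  moreover from this have "x = x'" using eq by (simp add: pair_def)
  ultimately show "x = x' \<and> y = y'" by simp
qed simp

subsection \<open>Bounded and \<open>\<Sigma>\<^sub>1\<close> predicates\<close>

text \<open>
  \<open>bdef \<S>\<close> consists of the predicates on number environments given by \<open>\<Delta>\<^sup>0\<^sub>0\<close> formulas with number
  parameters and set parameters from \<open>\<S>\<close>; it lets closure properties be proved by rule
  application instead of by writing down de Bruijn formulas.
\<close>

inductive trm :: "((nat \<Rightarrow> 'm::peano_minus) \<Rightarrow> 'm) \<Rightarrow> bool" where
  trm_var: "trm (\<lambda>e. e n)"
| trm_const: "trm (\<lambda>e. c)"
| trm_plus: "trm f \<Longrightarrow> trm g \<Longrightarrow> trm (\<lambda>e. f e + g e)"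
| trm_times: "trm f \<Longrightarrow> trm g \<Longrightarrow> trm (\<lambda>e. f e * g e)"

inductive bdef :: "'m::peano_minus set set \<Rightarrow> ((nat \<Rightarrow> 'm) \<Rightarrow> bool) \<Rightarrow> bool" for \<S> where
  bdef_eq: "trm f \<Longrightarrow> trm g \<Longrightarrow> bdef \<S> (\<lambda>e. f e = g e)"
| bdef_less: "trm f \<Longrightarrow> trm g \<Longrightarrow> bdef \<S> (\<lambda>e. f e < g e)"
| bdef_mem: "X \<in> \<S> \<Longrightarrow> trm f \<Longrightarrow> bdef \<S> (\<lambda>e. f e \<in> X)"
| bdef_not: "bdef \<S> P \<Longrightarrow> bdef \<S> (\<lambda>e. \<not> P e)"
| bdef_conj: "bdef \<S> P \<Longrightarrow> bdef \<S> Q \<Longrightarrow> bdef \<S> (\<lambda>e. P e \<and> Q e)"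
| bdef_bex': "trm f \<Longrightarrow> bdef \<S> P \<Longrightarrow> bdef \<S> (\<lambda>e. \<exists>x. x < f e \<and> P (case_nat x e))"

lemma case_nat_tl [simp]: "case_nat (e 0) (\<lambda>n. e (Suc n)) = e"
  by (auto split: nat.split)

lemma trm_subst:
  assumes "trm f" "\<And>n. trm (s n)"
  shows "trm (\<lambda>e. f (\<lambda>n. s n e))"
  using assms by induction (auto intro: trm.intros)

text \<open>There is no subtraction in the language, so terms grow with their variables. This is
  what later bounds the use of an oracle uniformly under bounded quantifiers.\<close>

lemma trm_mono:
  assumes "trm f" "\<And>n. e n \<le> e' n"
  shows "f e \<le> f e'"
  using assms by induction (auto intro: add_mono mult_mono nonneg)

lemma trm_val: "trm (\<lambda>e. val e t)"
  by (induction t) (auto intro: trm.intros)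

lemma bdef_subst:
  assumes "bdef \<S> P" "\<And>n. trm (s n)"
  shows "bdef \<S> (\<lambda>e. P (\<lambda>n. s n e))"
  using assms
proof (induction arbitrary: s)
  case (bdef_bex' f P)
  \<comment> \<open>Substitution under a binder: the bound variable stays, the others are
    substituted in the shifted environment.\<close>
  define s' where "s' n = (\<lambda>e. case n of 0 \<Rightarrow> e 0 | Suc m \<Rightarrow> s m (\<lambda>k. e (Suc k)))" for n
  have "trm (s' n)" for n
    using trm_subst[OF bdef_bex'.prems trm_var]
    by (cases n) (auto simp: s'_def intro: trm_var)
  then have "bdef \<S> (\<lambda>e. P (\<lambda>n. s' n e))" by (rule bdef_bex'.IH)
  moreover have "trm (\<lambda>e. f (\<lambda>n. s n e))" by (rule trm_subst) fact+
  ultimately have "bdef \<S> (\<lambda>e. \<exists>x. x < f (\<lambda>n. s n e) \<and> P (\<lambda>n. s' n (case_nat x e)))"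
    by (intro bdef.bdef_bex')
  moreover have "(\<lambda>n. s' n (case_nat x e)) = case_nat x (\<lambda>n. s n e)" for x e
    by (auto simp: s'_def split: nat.split)
  ultimately show ?case by simp
next
  case (bdef_eq f g)
  then show ?case using trm_subst[of f s] trm_subst[of g s] by (simp add: bdef.intros)
next
  case (bdef_less f g)
  then show ?case using trm_subst[of f s] trm_subst[of g s] by (simp add: bdef.intros)
next
  case (bdef_mem X f)
  then show ?case using trm_subst[of f s] by (simp add: bdef.intros)
qed (auto intro: bdef.intros)

lemma bdef_mono: "bdef \<S> P \<Longrightarrow> \<S> \<subseteq> \<T> \<Longrightarrow> bdef \<T> P"
  by (induction rule: bdef.induct) (auto intro: bdef.intros)

lemma bdef_subst1:
  assumes "bdef \<S> (\<lambda>e. P (e 0))" "trm f"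
  shows "bdef \<S> (\<lambda>e. P (f e))"
  using bdef_subst[OF assms(1), of "\<lambda>_. f"] assms(2) by simp

lemma bdef_subst2:
  assumes "bdef \<S> (\<lambda>e. P (e 0) (e 1))" "trm f" "trm g"
  shows "bdef \<S> (\<lambda>e. P (f e) (g e))"
  using bdef_subst[OF assms(1), of "\<lambda>n. if n = 0 then f else g"] assms(2,3) by simp

lemma bdef_subst3:
  assumes "bdef \<S> (\<lambda>e. P (e 0) (e 1) (e 2))" "trm f" "trm g" "trm h"
  shows "bdef \<S> (\<lambda>e. P (f e) (g e) (h e))"
  using bdef_subst[OF assms(1), of "\<lambda>n. if n = 0 then f else if n = 1 then g else h"] assms(2-)
  by simp

text \<open>Freezing all variables but the first two at \<open>e0\<close> turns them into number
  parameters, since constants are terms. Principles stated for binary predicates thus apply with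
  arbitrary side parameters.\<close>

lemma bdef_subst_env:
  assumes "bdef \<S> P" "trm f" "trm g"
  shows "bdef \<S> (\<lambda>e. P (case_nat (f e) (case_nat (g e) e0)))"
proof -
  define s where "s n = (case n of 0 \<Rightarrow> f | Suc k \<Rightarrow> (case k of 0 \<Rightarrow> g | Suc m \<Rightarrow> (\<lambda>e. e0 m)))" for n
  have "trm (s n)" for n
    using assms(2,3) by (auto simp: s_def intro: trm.intros split: nat.split)
  then have "bdef \<S> (\<lambda>e. P (\<lambda>n. s n e))" by (rule bdef_subst[OF assms(1)])
  moreover have "(\<lambda>n. s n e) = case_nat (f e) (case_nat (g e) e0)" for e
    by (auto simp: s_def split: nat.split)
  ultimately show ?thesis by simp
qed

lemma bdef_bex:
  assumes "bdef \<S> (\<lambda>e. P (e 0) (\<lambda>n. e (Suc n)))" "trm f"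
  shows "bdef \<S> (\<lambda>e. \<exists>x<f e. P x e)"
  using bdef_bex'[OF assms(2,1)] by simp

lemma bdef_ball:
  assumes "bdef \<S> (\<lambda>e. P (e 0) (\<lambda>n. e (Suc n)))" "trm f"
  shows "bdef \<S> (\<lambda>e. \<forall>x<f e. P x e)"
proof -
  have "bdef \<S> (\<lambda>e. \<not> (\<exists>x<f e. \<not> P x e))"
    by (intro bdef_bex bdef_not assms)
  then show ?thesis by simp
qed

lemma bdef_disj:
  assumes "bdef \<S> P" "bdef \<S> Q" shows "bdef \<S> (\<lambda>e. P e \<or> Q e)"
proof -
  have "bdef \<S> (\<lambda>e. \<not> (\<not> P e \<and> \<not> Q e))" by (intro bdef.intros assms)
  then show ?thesis by simp
qed

lemma bdef_imp:
  assumes "bdef \<S> P" "bdef \<S> Q" shows "bdef \<S> (\<lambda>e. P e \<longrightarrow> Q e)"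
proof -
  have "bdef \<S> (\<lambda>e. \<not> (P e \<and> \<not> Q e))" by (intro bdef.intros assms)
  then show ?thesis by simp
qed

lemma bdef_iff:
  assumes "bdef \<S> P" "bdef \<S> Q" shows "bdef \<S> (\<lambda>e. P e \<longleftrightarrow> Q e)"
proof -
  have "bdef \<S> (\<lambda>e. (P e \<longrightarrow> Q e) \<and> (Q e \<longrightarrow> P e))" by (intro bdef_conj bdef_imp assms)
  then show ?thesis by (simp add: iff_conv_conj_imp)
qed

lemma bdef_le:
  assumes "trm f" "trm g" shows "bdef \<S> (\<lambda>e. f e \<le> g e)"
proof -
  have "bdef \<S> (\<lambda>e. \<not> (g e < f e))" by (intro bdef.intros assms)
  then show ?thesis by (simp add: not_less)
qed

lemma bdef_const: "bdef \<S> (\<lambda>e :: nat \<Rightarrow> 'm::peano_minus. b)"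
proof -
  have "bdef \<S> (\<lambda>e :: nat \<Rightarrow> 'm. 0 = (if b then 0 else 1 :: 'm))" by (intro bdef.intros trm.intros)
  then show ?thesis by (cases b) simp_all
qed

lemmas bdef_rules = bdef_const bdef_ball bdef_bex bdef_imp bdef_iff bdef_disj bdef_le bdef_conj bdef_not bdef_eq bdef_less
  trm_const trm_var trm_plus trm_times

definition sig :: "'m::peano_minus set set \<Rightarrow> ((nat \<Rightarrow> 'm) \<Rightarrow> bool) \<Rightarrow> bool" where
  "sig \<S> P \<longleftrightarrow> (\<exists>Q. bdef \<S> Q \<and> (\<forall>e. P e \<longleftrightarrow> (\<exists>x. Q (case_nat x e))))"

lemma sigI:
  assumes "bdef \<S> (\<lambda>e. Q (e 0) (\<lambda>n. e (Suc n)))"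
  shows "sig \<S> (\<lambda>e. \<exists>x. Q x e)"
  unfolding sig_def using assms by (intro exI conjI) auto

lemma bdef_sig:
  assumes "bdef \<S> P" shows "sig \<S> P"
  using sigI[of \<S> "\<lambda>x. P"] bdef_subst[OF assms, of "\<lambda>n e. e (Suc n)"] by (simp add: trm_var)

lemma sig_subst:
  assumes "sig \<S> P" "\<And>n. trm (s n)"
  shows "sig \<S> (\<lambda>e. P (\<lambda>n. s n e))"
proof -
  obtain Q where Q: "bdef \<S> Q" "\<And>e. P e \<longleftrightarrow> (\<exists>x. Q (case_nat x e))"
    using assms(1) unfolding sig_def by blast
  define s' where "s' n = (\<lambda>e. case n of 0 \<Rightarrow> e 0 | Suc m \<Rightarrow> s m (\<lambda>k. e (Suc k)))" for n
  have "trm (s' n)" for n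
    using trm_subst[OF assms(2) trm_var] by (cases n) (auto simp: s'_def intro: trm_var)
  then have "bdef \<S> (\<lambda>e. Q (\<lambda>n. s' n e))" by (rule bdef_subst[OF Q(1)])
  moreover have "(\<lambda>n. s' n (case_nat x e)) = case_nat x (\<lambda>n. s n e)" for x e
    by (auto simp: s'_def split: nat.split)
  ultimately show ?thesis
    unfolding sig_def by (intro exI[of _ "\<lambda>e. Q (\<lambda>n. s' n e)"]) (simp add: Q(2))
qed

lemma sig_subst_env:
  assumes "sig \<S> P" "trm f"
  shows "sig \<S> (\<lambda>e. P (case_nat (f e) e0))"
proof -
  define s where "s n = (case n of 0 \<Rightarrow> f | Suc m \<Rightarrow> (\<lambda>e. e0 m))" for n
  have "trm (s n)" for n
    using assms(2) by (auto simp: s_def intro: trm.intros split: nat.split)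
  then have "sig \<S> (\<lambda>e. P (\<lambda>n. s n e))" by (rule sig_subst[OF assms(1)])
  moreover have "(\<lambda>n. s n e) = case_nat (f e) e0" for e
    by (auto simp: s_def split: nat.split)
  ultimately show ?thesis by simp
qed

text \<open>Two witnesses are merged into one common strict upper bound, x + y + 1, below which both
  are searched.\<close>

lemma sig_ex':
  assumes "sig \<S> P"
  shows "sig \<S> (\<lambda>e. \<exists>x. P (case_nat x e))"
proof -
  obtain Q where Q: "bdef \<S> Q" "\<And>e. P e \<longleftrightarrow> (\<exists>x. Q (case_nat x e))"
    using assms(1) unfolding sig_def by blast
  have "bdef \<S> (\<lambda>e. Q (case_nat (e 1) (case_nat (e 0) (\<lambda>n. e (n + 3)))))"
  proof -
    have "bdef \<S> (\<lambda>e. Q (\<lambda>n. (if n = 0 then (\<lambda>e. e 1) else if n = 1 then (\<lambda>e. e 0) else (\<lambda>e. e (n + 1))) e))"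
      by (rule bdef_subst[OF Q(1)]) (auto intro: trm_var)
    moreover have "(\<lambda>n. (if n = 0 then (\<lambda>e. e 1) else if n = 1 then (\<lambda>e. e 0) else (\<lambda>e. e (n + 1))) e)
       = case_nat (e 1) (case_nat (e 0) (\<lambda>n. e (n + 3)))" for e :: "nat \<Rightarrow> 'a"
      by (auto split: nat.split simp: numeral_3_eq_3)
    ultimately show ?thesis by simp
  qed
  then have "sig \<S> (\<lambda>e. \<exists>z. \<exists>y<z. \<exists>x<z. Q (case_nat y (case_nat x e)))"
    by (intro sigI bdef_bex trm_var) (simp add: numeral_3_eq_3)
  moreover have "(\<exists>z. \<exists>y<z. \<exists>x<z. Q (case_nat y (case_nat x e))) \<longleftrightarrow> (\<exists>x. P (case_nat x e))" for e
  proof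
    assume "\<exists>x. P (case_nat x e)"
    then obtain x y where "Q (case_nat y (case_nat x e))" using Q(2) by blast
    moreover have "y < x + y + 1" "x < x + y + 1" by simp_all
    ultimately show "\<exists>z. \<exists>y<z. \<exists>x<z. Q (case_nat y (case_nat x e))" by blast
  qed (use Q(2) in blast)
  ultimately show ?thesis by simp
qed

lemma sig_ex:
  assumes "sig \<S> (\<lambda>e. P (e 0) (\<lambda>n. e (Suc n)))"
  shows "sig \<S> (\<lambda>e. \<exists>x. P x e)"
  using sig_ex'[OF assms] by simp

lemma sig_conj:
  assumes "sig \<S> P" "sig \<S> P'"
  shows "sig \<S> (\<lambda>e. P e \<and> P' e)"
proof -
  obtain Q where Q: "bdef \<S> Q" "\<And>e. P e \<longleftrightarrow> (\<exists>x. Q (case_nat x e))"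
    using assms(1) unfolding sig_def by blast
  obtain Q' where Q': "bdef \<S> Q'" "\<And>e. P' e \<longleftrightarrow> (\<exists>x. Q' (case_nat x e))"
    using assms(2) unfolding sig_def by blast
  have *: "bdef \<S> (\<lambda>e. R (case_nat (e a) (\<lambda>n. e (n + 2))))" if "bdef \<S> R" for R a
  proof -
    have "bdef \<S> (\<lambda>e. R (\<lambda>n. (if n = 0 then (\<lambda>e. e a) else (\<lambda>e. e (n + 1))) e))"
      by (rule bdef_subst[OF that]) (auto intro: trm_var)
    moreover have "(\<lambda>n. (if n = 0 then (\<lambda>e. e a) else (\<lambda>e. e (n + 1))) e)
       = case_nat (e a) (\<lambda>n. e (n + 2))" for e :: "nat \<Rightarrow> 'a"
      by (auto split: nat.split)
    ultimately show ?thesis by simp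
  qed
  have "sig \<S> (\<lambda>e. \<exists>x y. Q (case_nat x e) \<and> Q' (case_nat y e))"
    by (intro sig_ex bdef_sig bdef_conj) (use *[OF Q(1), of 1] *[OF Q'(1), of 0] in simp_all)
  then show ?thesis by (simp add: Q(2) Q'(2))
qed

lemma sig_disj:
  assumes "sig \<S> P" "sig \<S> P'"
  shows "sig \<S> (\<lambda>e. P e \<or> P' e)"
proof -
  obtain Q where Q: "bdef \<S> Q" "\<And>e. P e \<longleftrightarrow> (\<exists>x. Q (case_nat x e))"
    using assms(1) unfolding sig_def by blast
  obtain Q' where Q': "bdef \<S> Q'" "\<And>e. P' e \<longleftrightarrow> (\<exists>x. Q' (case_nat x e))"
    using assms(2) unfolding sig_def by blast
  have "sig \<S> (\<lambda>e. \<exists>x. Q (case_nat x e) \<or> Q' (case_nat x e))"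
    by (intro sigI bdef_disj) (use Q Q' in \<open>simp_all\<close>)
  then show ?thesis by (simp add: Q(2) Q'(2) ex_disj_distrib)
qed

lemma sig_bex:
  assumes "sig \<S> (\<lambda>e. P (e 0) (\<lambda>n. e (Suc n)))" "trm f"
  shows "sig \<S> (\<lambda>e. \<exists>x<f e. P x e)"
  by (intro sig_ex sig_conj bdef_sig bdef_less trm_var assms(1) trm_subst[OF assms(2)])

subsection \<open>Induction and collection\<close>

definition ind :: "'m::peano_minus set set \<Rightarrow> bool" where
  "ind \<S> \<longleftrightarrow> (\<forall>P. bdef \<S> (\<lambda>e. P (e 0)) \<longrightarrow> P 0 \<longrightarrow> (\<forall>x. P x \<longrightarrow> P (x + 1)) \<longrightarrow> (\<forall>x. P x))"

text \<open>A bounded matrix suffices for \<Sigma>1-collection, because a further existential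
  quantifier can be absorbed into y. Further parameters enter as constant terms.\<close>

definition coll :: "'m::peano_minus set set \<Rightarrow> bool" where
  "coll \<S> \<longleftrightarrow> (\<forall>Q b. bdef \<S> (\<lambda>e. Q (e 0) (e 1)) \<longrightarrow> (\<forall>x<b. \<exists>y. Q y x) \<longrightarrow>
     (\<exists>c. \<forall>x<b. \<exists>y<c. Q y x))"

text \<open>Collection supplies one z bounding the witnesses for all x below the bound, so the
  universal quantifier can move inside the existential one.\<close>

lemma sig_ball:
  assumes "coll \<S>" "sig \<S> (\<lambda>e. P (e 0) (\<lambda>n. e (Suc n)))" "trm f"
  shows "sig \<S> (\<lambda>e. \<forall>x<f e. P x e)"
proof -
  obtain Q where Q: "bdef \<S> Q" "\<And>e. P (e 0) (\<lambda>n. e (Suc n)) \<longleftrightarrow> (\<exists>x. Q (case_nat x e))"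
    using assms(2) unfolding sig_def by blast
  have Q2: "P x e \<longleftrightarrow> (\<exists>y. Q (case_nat y (case_nat x e)))" for x e
    using Q(2)[of "case_nat x e"] by simp
  have "bdef \<S> (\<lambda>e. Q (case_nat (e 0) (case_nat (e 1) (\<lambda>n. e (n + 3)))))"
  proof -
    have "bdef \<S> (\<lambda>e. Q (\<lambda>n. (if n = 0 then (\<lambda>e. e 0) else if n = 1 then (\<lambda>e. e 1) else (\<lambda>e. e (n + 1))) e))"
      by (rule bdef_subst[OF Q(1)]) (auto intro: trm_var)
    moreover have "(\<lambda>n. (if n = 0 then (\<lambda>e. e 0) else if n = 1 then (\<lambda>e. e 1) else (\<lambda>e. e (n + 1))) e)
       = case_nat (e 0) (case_nat (e 1) (\<lambda>n. e (n + 3)))" for e :: "nat \<Rightarrow> 'a"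
      by (auto split: nat.split simp: numeral_3_eq_3)
    ultimately show ?thesis by simp
  qed
  then have "sig \<S> (\<lambda>e. \<exists>z. \<forall>x<f e. \<exists>y<z. Q (case_nat y (case_nat x e)))"
    by (intro sigI bdef_bex bdef_ball trm_var trm_subst[OF assms(3)])
      (simp add: numeral_3_eq_3)
  moreover have "(\<exists>z. \<forall>x<f e. \<exists>y<z. Q (case_nat y (case_nat x e))) \<longleftrightarrow> (\<forall>x<f e. P x e)" for e
  proof
    assume "\<forall>x<f e. P x e"
    then have "\<forall>x<f e. \<exists>y. Q (case_nat y (case_nat x e))" by (simp add: Q2)
    \<comment> \<open>The environment is frozen so that only the witness and x vary, as
      \<open>coll\<close> requires.\<close>
    moreover have "bdef \<S> (\<lambda>e'. Q (case_nat (e' 0) (case_nat (e' 1) e)))"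
      by (intro bdef_subst_env Q trm_var)
    ultimately show "\<exists>z. \<forall>x<f e. \<exists>y<z. Q (case_nat y (case_nat x e))"
      using assms(1)[unfolded coll_def, rule_format, of "\<lambda>y x. Q (case_nat y (case_nat x e))"] by blast
  qed (use Q2 in blast)
  ultimately show ?thesis by simp
qed

subsection \<open>Formulas for bounded predicates\<close>

primrec ren_tm :: "(nat \<Rightarrow> nat) \<Rightarrow> tm \<Rightarrow> tm" where
  "ren_tm r (Var n) = Var (r n)"
| "ren_tm r Zero = Zero"
| "ren_tm r One = One"
| "ren_tm r (Plus s t) = Plus (ren_tm r s) (ren_tm r t)"
| "ren_tm r (Times s t) = Times (ren_tm r s) (ren_tm r t)"

definition lift_ren :: "(nat \<Rightarrow> nat) \<Rightarrow> nat \<Rightarrow> nat" where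
  "lift_ren r = case_nat 0 (\<lambda>m. Suc (r m))"

primrec ren :: "(nat \<Rightarrow> nat) \<Rightarrow> (nat \<Rightarrow> nat) \<Rightarrow> fm \<Rightarrow> fm" where
  "ren r s (Eq t u) = Eq (ren_tm r t) (ren_tm r u)"
| "ren r s (Lt t u) = Lt (ren_tm r t) (ren_tm r u)"
| "ren r s (Mem t n) = Mem (ren_tm r t) (s n)"
| "ren r s (Neg \<phi>) = Neg (ren r s \<phi>)"
| "ren r s (Conj \<phi> \<psi>) = Conj (ren r s \<phi>) (ren r s \<psi>)"
| "ren r s (Disj \<phi> \<psi>) = Disj (ren r s \<phi>) (ren r s \<psi>)"
| "ren r s (BForall t \<phi>) = BForall (ren_tm r t) (ren (lift_ren r) s \<phi>)"
| "ren r s (BExists t \<phi>) = BExists (ren_tm r t) (ren (lift_ren r) s \<phi>)"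
| "ren r s (Forall \<phi>) = Forall (ren (lift_ren r) s \<phi>)"
| "ren r s (Exists \<phi>) = Exists (ren (lift_ren r) s \<phi>)"
| "ren r s (ForallSet \<phi>) = ForallSet (ren r (lift_ren s) \<phi>)"
| "ren r s (ExistsSet \<phi>) = ExistsSet (ren r (lift_ren s) \<phi>)"

lemma val_ren_tm [simp]: "val e (ren_tm r t) = val (\<lambda>n. e (r n)) t"
  by (induction t) simp_all

lemma case_nat_lift_ren [simp]: "(\<lambda>n. case_nat x e (lift_ren r n)) = case_nat x (\<lambda>n. e (r n))"
  by (auto simp: lift_ren_def split: nat.split)

lemma sat_ren [simp]: "sat \<X> e E (ren r s \<phi>) \<longleftrightarrow> sat \<X> (\<lambda>n. e (r n)) (\<lambda>n. E (s n)) \<phi>"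
  by (induction \<phi> arbitrary: r s e E) simp_all

lemma delta00_ren [simp]: "delta00 (ren r s \<phi>) = delta00 \<phi>"
  by (induction \<phi> arbitrary: r s) simp_all

lemma sat_delta00_indep: "delta00 \<phi> \<Longrightarrow> sat \<X> e E \<phi> = sat \<Y> e E \<phi>"
  by (induction \<phi> arbitrary: e) simp_all

text \<open>
  Even indices carry the free variables and odd indices the parameters, so that combining two formulas
  only needs renamings.
\<close>

definition mix :: "(nat \<Rightarrow> 'a) \<Rightarrow> (nat \<Rightarrow> 'a) \<Rightarrow> nat \<Rightarrow> 'a" where
  "mix e p n = (if even n then e (n div 2) else p (n div 2))"

lemma mix_simps [simp]: "mix e p (2 * n) = e n" "mix e p (Suc (2 * n)) = p n"
  by (simp_all add: mix_def)

lemma range_mix: "range (mix e p) = range e \<union> range p"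
proof -
  have "e n \<in> range (mix e p)" "p n \<in> range (mix e p)" for n
    using rangeI[of "mix e p" "2 * n"] rangeI[of "mix e p" "Suc (2 * n)"] by simp_all
  then show ?thesis by (auto simp: mix_def)
qed

text \<open>Merging the parameter lists as \<open>mix p q\<close> puts p on even and q on odd
  places; accordingly the parameter index 2 m + 1 of a formula moves to 2 (2 m) + 1 here and to 2 (2
  m + 1) + 1 in \<open>ren_right\<close>. Free variables, at even indices, stay.\<close>

definition ren_left :: "nat \<Rightarrow> nat" where
  "ren_left n = (if even n then n else Suc (2 * (2 * (n div 2))))"

definition ren_right :: "nat \<Rightarrow> nat" where
  "ren_right n = (if even n then n else Suc (2 * Suc (2 * (n div 2))))"

lemma mix_ren [simp]:
  "mix e (mix p q) (ren_left n) = mix e p n" "mix e (mix p q) (ren_right n) = mix e q n"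
proof -
  have L: "ren_left (2 * m) = 2 * m" "ren_left (Suc (2 * m)) = Suc (2 * (2 * m))" for m
    by (simp_all add: ren_left_def)
  have R: "ren_right (2 * m) = 2 * m" "ren_right (Suc (2 * m)) = Suc (2 * Suc (2 * m))" for m
    by (simp_all add: ren_right_def)
  consider m where "n = 2 * m" | m where "n = Suc (2 * m)"
    by (metis evenE oddE Suc_eq_plus1)
  then show "mix e (mix p q) (ren_left n) = mix e p n" "mix e (mix p q) (ren_right n) = mix e q n"
    by (cases; simp only: L R mix_simps)+
qed

text \<open>A quantifier pushes its value in front of the whole interleaved environment, whereas
  \<open>mix\<close> expects it in front of the free variables only. This renaming reconciles the
  two layouts.\<close>

definition ren_cons :: "nat \<Rightarrow> nat" where
  "ren_cons n = (if n = 0 then 0 else if even n then Suc (n - 2) else Suc n)"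

lemma mix_ren_cons [simp]: "case_nat x (mix e p) (ren_cons n) = mix (case_nat x e) p n"
proof -
  show ?thesis
  proof (cases "even n")
    case True
    then obtain m where "n = 2 * m" by blast
    then show ?thesis by (cases m) (simp_all add: mix_def ren_cons_def)
  next
    case False
    then show ?thesis by (auto simp: mix_def ren_cons_def elim: oddE)
  qed
qed

definition represents :: "'m::peano_minus set set \<Rightarrow> ((nat \<Rightarrow> 'm) \<Rightarrow> bool) \<Rightarrow>
    (nat \<Rightarrow> 'm) \<Rightarrow> (nat \<Rightarrow> 'm set) \<Rightarrow> fm \<Rightarrow> bool" where
  "represents \<S> P p E \<theta> \<longleftrightarrow>
     delta00 \<theta> \<and> range E \<subseteq> \<S> \<and> (\<forall>\<X> e. P e \<longleftrightarrow> sat \<X> (mix e p) E \<theta>)"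

lemma represents_mix:
  assumes "represents \<S> P p E \<theta>" "range E' \<subseteq> \<S>"
  shows "represents \<S> P (mix p p') (mix E E') (ren ren_left (\<lambda>n. 2 * n) \<theta>)"
    and "represents \<S> P (mix p' p) (mix E' E) (ren ren_right (\<lambda>n. Suc (2 * n)) \<theta>)"
  using assms by (simp_all add: represents_def range_mix)

lemma represents_join:
  assumes "\<exists>p E \<theta>. represents \<S> P p E \<theta>" "\<exists>p E \<theta>. represents \<S> Q p E \<theta>"
  shows "\<exists>p E \<theta> \<theta>'. represents \<S> P p E \<theta> \<and> represents \<S> Q p E \<theta>'"
proof -
  obtain p E \<theta> p' E' \<theta>' where "represents \<S> P p E \<theta>" "represents \<S> Q p' E' \<theta>'"
    using assms by blast
  moreover from this have "range E \<subseteq> \<S>" "range E' \<subseteq> \<S>" by (simp_all add: represents_def)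
  ultimately have "represents \<S> P (mix p p') (mix E E') (ren ren_left (\<lambda>n. 2 * n) \<theta>)"
    "represents \<S> Q (mix p p') (mix E E') (ren ren_right (\<lambda>n. Suc (2 * n)) \<theta>')"
    by (simp_all add: represents_mix)
  then show ?thesis by blast
qed

lemma trm_syntactic:
  assumes "trm f" shows "\<exists>p t. \<forall>e. f e = val (mix e p) t"
  using assms
proof induction
  case (trm_var n)
  have "e n = val (mix e p) (Var (2 * n))" for e p :: "nat \<Rightarrow> 'a" by simp
  then show ?case by blast
next
  case (trm_const c)
  have "c = val (mix e (\<lambda>_. c)) (Var (Suc (2 * 0)))" for e by (simp only: val.simps mix_simps)
  then show ?case by blast
next
  case (trm_plus f g)
  then obtain t p u q where *: "\<And>e. f e = val (mix e p) t" "\<And>e. g e = val (mix e q) u" by blast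
  have "f e + g e = val (mix e (mix p q)) (Plus (ren_tm ren_left t) (ren_tm ren_right u))" for e
    by (simp add: *)
  then show ?case by blast
next
  case (trm_times f g)
  then obtain t p u q where *: "\<And>e. f e = val (mix e p) t" "\<And>e. g e = val (mix e q) u" by blast
  have "f e * g e = val (mix e (mix p q)) (Times (ren_tm ren_left t) (ren_tm ren_right u))" for e
    by (simp add: *)
  then show ?case by blast
qed

lemma trm_syntactic2:
  assumes "trm f" "trm g" shows "\<exists>p t u. \<forall>e. f e = val (mix e p) t \<and> g e = val (mix e p) u"
proof -
  obtain t p u q where *: "\<And>e. f e = val (mix e p) t" "\<And>e. g e = val (mix e q) u"
    using trm_syntactic[OF assms(1)] trm_syntactic[OF assms(2)] by blast
  have "f e = val (mix e (mix p q)) (ren_tm ren_left t)"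
       "g e = val (mix e (mix p q)) (ren_tm ren_right u)" for e
    by (simp_all add: *)
  then show ?thesis by blast
qed

lemma bdef_syntactic:
  assumes "bdef \<S> P" "\<S> \<noteq> {}"
  shows "\<exists>p E \<theta>. represents \<S> P p E \<theta>"
  using assms(1)
proof induction
  case (bdef_eq f g)
  then obtain p t u where *: "\<And>e. f e = val (mix e p) t \<and> g e = val (mix e p) u"
    using trm_syntactic2[of f g] by blast
  \<comment> \<open>Set environments are total, so even a formula without set variables needs some
    member of \<S> to fill them.\<close>
  obtain X where "X \<in> \<S>" using assms(2) by blast
  then have "represents \<S> (\<lambda>e. f e = g e) p (\<lambda>_. X) (Eq t u)"
    using * by (auto simp: represents_def)
  then show ?case by blast
next
  case (bdef_less f g)
  then obtain p t u where *: "\<And>e. f e = val (mix e p) t \<and> g e = val (mix e p) u"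
    using trm_syntactic2[of f g] by blast
  obtain X where "X \<in> \<S>" using assms(2) by blast
  then have "represents \<S> (\<lambda>e. f e < g e) p (\<lambda>_. X) (Lt t u)"
    using * by (auto simp: represents_def)
  then show ?case by blast
next
  case (bdef_mem X f)
  then obtain p t where *: "\<And>e. f e = val (mix e p) t" using trm_syntactic[of f] by blast
  then have "represents \<S> (\<lambda>e. f e \<in> X) p (\<lambda>_. X) (Mem t 0)"
    using bdef_mem by (auto simp: represents_def)
  then show ?case by blast
next
  case (bdef_not P)
  then obtain p E \<theta> where "represents \<S> P p E \<theta>" by blast
  then have "represents \<S> (\<lambda>e. \<not> P e) p E (Neg \<theta>)" by (auto simp: represents_def)
  then show ?case by blast
next
  case (bdef_conj P Q)
  then obtain p E \<theta> \<theta>' where "represents \<S> P p E \<theta>" "represents \<S> Q p E \<theta>'"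
    using represents_join[of \<S> P Q] by blast
  then have "represents \<S> (\<lambda>e. P e \<and> Q e) p E (Conj \<theta> \<theta>')" by (auto simp: represents_def)
  then show ?case by blast
next
  case (bdef_bex' f P)
  then obtain p E \<theta> q t where *: "represents \<S> P p E \<theta>" "\<And>e. f e = val (mix e q) t"
    using trm_syntactic[of f] by blast
  then have "represents \<S> P (mix q p) (mix E E) (ren ren_right (\<lambda>n. Suc (2 * n)) \<theta>)"
    by (intro represents_mix) (auto simp: represents_def)
  then have "represents \<S> (\<lambda>e. \<exists>x<f e. P (case_nat x e)) (mix q p) (mix E E)
      (BExists (ren_tm ren_left t) (ren ren_cons id (ren ren_right (\<lambda>n. Suc (2 * n)) \<theta>)))"
    using *(2) by (simp add: represents_def)
  then show ?case by blast
qed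

text \<open>Passage from the interleaved layout, with arguments at indices 0 and 2, to the layout of
  the schemes, with arguments at 0 and 1 and all parameters behind them.\<close>

definition ren_params :: "nat \<Rightarrow> nat" where
  "ren_params n = (if n = 0 then 0 else if n = 2 then 1 else if even n then n - 2 else n + 2)"

lemma mix_ren_params:
  "case_nat y (case_nat x (mix e p)) (ren_params n) = mix (case_nat y (case_nat x e)) p n"
proof -
  show ?thesis
  proof (cases "even n")
    case True
    then obtain m where m: "n = 2 * m" by blast
    show ?thesis
    proof (cases m)
      case (Suc k)
      then show ?thesis using m by (cases k) (simp_all add: mix_def ren_params_def)
    qed (simp add: m mix_def ren_params_def)
  next
    case False
    then show ?thesis by (auto simp: mix_def ren_params_def elim: oddE)
  qed
qed

text \<open>Both formulas receive the same environments because \<open>delta01_comprehension\<close>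
  evaluates its \<Sigma>1 and its \<Pi>1 formula under common parameters.\<close>

lemma bdef_syntactic_pair:
  assumes "bdef \<S> (\<lambda>e. P (e 0) (e 1))" "bdef \<S> (\<lambda>e. Q (e 0) (e 1))" "\<S> \<noteq> {}"
  shows "\<exists>\<theta> \<theta>' e' E. delta00 \<theta> \<and> delta00 \<theta>' \<and> range E \<subseteq> \<S> \<and>
    (\<forall>\<X> x y. P y x \<longleftrightarrow> sat \<X> (case_nat y (case_nat x e')) E \<theta>) \<and>
    (\<forall>\<X> x y. Q y x \<longleftrightarrow> sat \<X> (case_nat y (case_nat x e')) E \<theta>')"
proof -
  obtain p E \<theta> \<theta>' where *: "represents \<S> (\<lambda>e. P (e 0) (e 1)) p E \<theta>"
    "represents \<S> (\<lambda>e. Q (e 0) (e 1)) p E \<theta>'"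
    using represents_join[OF bdef_syntactic[OF assms(1,3)] bdef_syntactic[OF assms(2,3)]] by blast
  \<comment> \<open>The predicates read variables 0 and 1 only, so the remaining free variables may
    take any value.\<close>
  let ?e = "mix undefined p"
  have "P y x \<longleftrightarrow> sat \<X> (case_nat y (case_nat x ?e)) E (ren ren_params id \<theta>)"
    "Q y x \<longleftrightarrow> sat \<X> (case_nat y (case_nat x ?e)) E (ren ren_params id \<theta>')" for \<X> x y
  proof -
    let ?e' = "case_nat y (case_nat x undefined)"
    have "P (?e' 0) (?e' 1) \<longleftrightarrow> sat \<X> (mix ?e' p) E \<theta>" "Q (?e' 0) (?e' 1) \<longleftrightarrow> sat \<X> (mix ?e' p) E \<theta>'"
      using * unfolding represents_def by blast+
    then show "P y x \<longleftrightarrow> sat \<X> (case_nat y (case_nat x ?e)) E (ren ren_params id \<theta>)"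
      "Q y x \<longleftrightarrow> sat \<X> (case_nat y (case_nat x ?e)) E (ren ren_params id \<theta>')"
      by (simp_all add: mix_ren_params)
  qed
  moreover have "delta00 (ren ren_params id \<theta>)" "delta00 (ren ren_params id \<theta>')" "range E \<subseteq> \<S>"
    using * by (simp_all add: represents_def)
  ultimately show ?thesis by blast
qed

lemma bdef_syntactic_unary:
  assumes "bdef \<S> (\<lambda>e. P (e 0))" "\<S> \<noteq> {}"
  shows "\<exists>\<theta> e' E. delta00 \<theta> \<and> range E \<subseteq> \<S> \<and> (\<forall>\<X> x. P x \<longleftrightarrow> sat \<X> (case_nat x e') E \<theta>)"
proof -
  have "\<exists>\<theta> \<theta>' e' E. delta00 \<theta> \<and> delta00 \<theta>' \<and> range E \<subseteq> \<S> \<and>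
    (\<forall>\<X> x y. P y \<longleftrightarrow> sat \<X> (case_nat y (case_nat x e')) E \<theta>) \<and>
    (\<forall>\<X> x y. P y \<longleftrightarrow> sat \<X> (case_nat y (case_nat x e')) E \<theta>')"
    by (rule bdef_syntactic_pair[of _ "\<lambda>y x. P y" "\<lambda>y x. P y", OF assms(1,1,2)])
  then obtain \<theta> e' E where *: "delta00 \<theta>" "range E \<subseteq> \<S>"
    "\<forall>\<X> x y. P y \<longleftrightarrow> sat \<X> (case_nat y (case_nat x e')) E \<theta>"
    by (elim exE conjE)
  show ?thesis
    by (intro exI[of _ \<theta>] exI[of _ "case_nat undefined e'"] exI[of _ E]) (simp add: * flip: *(3))
qed

lemma RCA0_star_ind:
  assumes "RCA0_star \<S>" shows "ind \<S>"
  unfolding ind_def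
proof (intro allI impI)
  fix P :: "'a \<Rightarrow> bool" and x
  assume P: "bdef \<S> (\<lambda>e. P (e 0))" "P 0" "\<forall>x. P x \<longrightarrow> P (x + 1)"
  have ne: "\<S> \<noteq> {}" using assms by (simp add: RCA0_star_def)
  obtain \<theta> e' E where *: "delta00 \<theta>" "range E \<subseteq> \<S>"
    "\<forall>\<X> x. P x \<longleftrightarrow> sat \<X> (case_nat x e') E \<theta>"
    using bdef_syntactic_unary[OF P(1) ne] by (elim exE conjE)
  have "delta00_induction \<S>" using assms by (simp add: RCA0_star_def)
  then have "sat \<S> (case_nat 0 e') E \<theta> \<longrightarrow>
      (\<forall>x. sat \<S> (case_nat x e') E \<theta> \<longrightarrow> sat \<S> (case_nat (x + 1) e') E \<theta>) \<longrightarrow>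
      (\<forall>x. sat \<S> (case_nat x e') E \<theta>)"
    unfolding delta00_induction_def using *(1,2) by blast
  then show "P x" using *(3) P(2,3) by blast
qed

lemma RCA0_star_comprehension:
  assumes "RCA0_star \<S>"
    and "bdef \<S> (\<lambda>e. Q (e 0) (e 1))" "bdef \<S> (\<lambda>e. Q' (e 0) (e 1))"
    and Y: "\<And>x. x \<in> Y \<longleftrightarrow> (\<exists>y. Q y x)" "\<And>x. x \<notin> Y \<longleftrightarrow> (\<exists>y. Q' y x)"
  shows "Y \<in> \<S>"
proof -
  have ne: "\<S> \<noteq> {}" using assms(1) by (simp add: RCA0_star_def)
  obtain \<theta> \<theta>' e' E where *: "delta00 \<theta>" "delta00 \<theta>'" "range E \<subseteq> \<S>"
    "\<forall>\<X> x y. Q y x \<longleftrightarrow> sat \<X> (case_nat y (case_nat x e')) E \<theta>"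
    "\<forall>\<X> x y. Q' y x \<longleftrightarrow> sat \<X> (case_nat y (case_nat x e')) E \<theta>'"
    using bdef_syntactic_pair[OF assms(2,3) ne] by (elim exE conjE)
  have 1: "x \<in> Y \<longleftrightarrow> sat \<S> (case_nat x e') E (Exists \<theta>)" for x
    using Y(1) *(4) by simp
  have 2: "x \<notin> Y \<longleftrightarrow> \<not> sat \<S> (case_nat x e') E (Forall (Neg \<theta>'))" for x
    using Y(2) *(5) by simp
  have c: "sigma01 (Exists \<theta>)" "pi01 (Forall (Neg \<theta>'))"
    using *(1,2) by (auto simp: sigma01_def pi01_def)
  have dc: "delta01_comprehension \<S>" using assms(1) by (simp add: RCA0_star_def)
  have eq: "sat \<S> (case_nat x e') E (Exists \<theta>) = sat \<S> (case_nat x e') E (Forall (Neg \<theta>'))" for x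
    using 1[of x] 2[of x] by (rule_tac iffI) metis+
  have "\<exists>S\<in>\<S>. \<forall>x. x \<in> S \<longleftrightarrow> sat \<S> (case_nat x e') E (Exists \<theta>)"
    by (rule dc[unfolded delta01_comprehension_def, rule_format, OF c *(3)]) (rule eq)
  then obtain S where "S \<in> \<S>" "\<forall>x. x \<in> S \<longleftrightarrow> sat \<S> (case_nat x e') E (Exists \<theta>)" by (elim bexE)
  moreover from this have "S = Y" using 1 by blast
  ultimately show "Y \<in> \<S>" by simp
qed

subsection \<open>\<open>\<Delta>\<^sub>1\<close>-definable sets\<close>

text \<open>The semantic form of \<open>delta01_in\<close>, with all of \<S> as set parameters. For
  \<open>insert G \<Z>\<close> it is the recursive closure that turns a path into a new
  model.\<close>

definition Delta1 :: "'m::peano_minus set set \<Rightarrow> 'm set set" where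
  "Delta1 \<S> = {Y. sig \<S> (\<lambda>e. e 0 \<in> Y) \<and> sig \<S> (\<lambda>e. e 0 \<notin> Y)}"

lemma sig_syntactic:
  assumes "sig \<S> (\<lambda>e. P (e 0))"
  shows "\<exists>Q. bdef \<S> (\<lambda>e. Q (e 0) (e 1)) \<and> (\<forall>x. P x \<longleftrightarrow> (\<exists>y. Q y x))"
proof -
  obtain Q where Q: "bdef \<S> Q" "\<And>e. P (e 0) \<longleftrightarrow> (\<exists>y. Q (case_nat y e))"
    using assms unfolding sig_def by blast
  have "P x \<longleftrightarrow> (\<exists>y. Q (case_nat y (case_nat x undefined)))" for x
    using Q(2)[of "case_nat x undefined"] by simp
  moreover have "bdef \<S> (\<lambda>e. Q (case_nat (e 0) (case_nat (e 1) undefined)))"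
    by (intro bdef_subst_env Q trm_var)
  ultimately show ?thesis
    by (intro exI[of _ "\<lambda>y x. Q (case_nat y (case_nat x undefined))"]) auto
qed

lemma Delta1_parts:
  assumes "Y \<in> Delta1 \<S>"
  shows "\<exists>Q Q'. bdef \<S> (\<lambda>e. Q (e 0) (e 1)) \<and> bdef \<S> (\<lambda>e. Q' (e 0) (e 1)) \<and>
    (\<forall>x. x \<in> Y \<longleftrightarrow> (\<exists>y. Q y x)) \<and> (\<forall>x. x \<notin> Y \<longleftrightarrow> (\<exists>y. Q' y x))"
proof -
  have "sig \<S> (\<lambda>e. e 0 \<in> Y)" "sig \<S> (\<lambda>e. e 0 \<notin> Y)" using assms by (simp_all add: Delta1_def)
  then show ?thesis
    using sig_syntactic[of \<S> "\<lambda>x. x \<in> Y"] sig_syntactic[of \<S> "\<lambda>x. x \<notin> Y"] by blast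
qed

lemma subset_Delta1: "\<S> \<subseteq> Delta1 \<S>"
  unfolding Delta1_def by (auto intro!: bdef_sig bdef_not bdef_mem trm_var)

lemma Delta1_so_definable:
  assumes "Y \<in> Delta1 \<S>" "\<S> \<noteq> {}"
  shows "so_definable \<S> Y"
proof -
  obtain Q where Q: "bdef \<S> (\<lambda>e. Q (e 0) (e 1))" "\<And>x. x \<in> Y \<longleftrightarrow> (\<exists>y. Q y x)"
    using Delta1_parts[OF assms(1)] by blast
  obtain \<theta> e' E where "range E \<subseteq> \<S>" "\<forall>\<X> x y. Q y x \<longleftrightarrow> sat \<X> (case_nat y (case_nat x e')) E \<theta>"
    using bdef_syntactic_pair[OF Q(1) Q(1) assms(2)] by (elim exE conjE)
  then have "Y = defset \<S> e' E (Exists \<theta>)" using Q(2) by (auto simp: defset_def)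
  with \<open>range E \<subseteq> \<S>\<close> show ?thesis unfolding so_definable_def by blast
qed

text \<open>A set environment into {A} is constantly A, which is the convention of
  \<open>delta01_in\<close>. Hence the starting model contains no set that is to be avoided.\<close>

lemma Delta1_delta01_in: "Delta1 {A} \<subseteq> delta01_in A"
proof
  fix Y assume Y: "Y \<in> Delta1 {A}"
  obtain Q Q' where Q: "bdef {A} (\<lambda>e. Q (e 0) (e 1))" "bdef {A} (\<lambda>e. Q' (e 0) (e 1))"
    "\<And>x. x \<in> Y \<longleftrightarrow> (\<exists>y. Q y x)" "\<And>x. x \<notin> Y \<longleftrightarrow> (\<exists>y. Q' y x)"
    and ne: "{A} \<noteq> {}"
    using Delta1_parts[OF Y] by blast
  obtain \<theta> \<theta>' e' E where *: "delta00 \<theta>" "delta00 \<theta>'" "range E \<subseteq> {A}"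
    "\<forall>\<X> x y. Q y x \<longleftrightarrow> sat \<X> (case_nat y (case_nat x e')) E \<theta>"
    "\<forall>\<X> x y. Q' y x \<longleftrightarrow> sat \<X> (case_nat y (case_nat x e')) E \<theta>'"
    using bdef_syntactic_pair[OF Q(1,2) ne] by (elim exE conjE)
  have E: "E = (\<lambda>_. A)" using *(3) by auto
  have "Y = defset {A} e' (\<lambda>_. A) (Exists \<theta>)" using *(4) Q(3) E by (auto simp: defset_def)
  moreover have "x \<in> Y \<longleftrightarrow> (\<forall>y. \<not> Q' y x)" for x using Q(4)[of x] by blast
  then have "Y = defset {A} e' (\<lambda>_. A) (Forall (Neg \<theta>'))"
    using *(5) E by (auto simp: defset_def)
  moreover have "sigma01 (Exists \<theta>)" "pi01 (Forall (Neg \<theta>'))"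
    using *(1,2) by (auto simp: sigma01_def pi01_def)
  ultimately show "Y \<in> delta01_in A" unfolding delta01_in_def by blast
qed

subsection \<open>Countability of the definable sets\<close>

definition agree :: "nat \<Rightarrow> (nat \<Rightarrow> 'a) \<Rightarrow> (nat \<Rightarrow> 'a) \<Rightarrow> bool" where
  "agree N e e' \<longleftrightarrow> (\<forall>n<N. e n = e' n)"

lemma agree_mono: "agree N e e' \<Longrightarrow> M \<le> N \<Longrightarrow> agree M e e'"
  by (simp add: agree_def)

text \<open>N is deliberately not changed: a quantified formula then inherits the support of its
  body.\<close>

lemma agree_cons: "agree N e e' \<Longrightarrow> agree N (case_nat x e) (case_nat x e')"
  by (auto simp: agree_def split: nat.split)

definition supported_tm :: "nat \<Rightarrow> tm \<Rightarrow> 'm::peano_minus itself \<Rightarrow> bool" where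
  "supported_tm N t _ \<longleftrightarrow> (\<forall>e e' :: nat \<Rightarrow> 'm. agree N e e' \<longrightarrow> val e t = val e' t)"

lemma supported_tmD:
  "supported_tm N t TYPE('m::peano_minus) \<Longrightarrow> N \<le> M \<Longrightarrow> agree M e (e' :: nat \<Rightarrow> 'm) \<Longrightarrow> val e t = val e' t"
  unfolding supported_tm_def using agree_mono[of M e e' N] by blast

lemma val_support: "\<exists>N. supported_tm N t TYPE('m::peano_minus)"
proof (induction t)
  case (Var n)
  have "supported_tm (Suc n) (Var n) TYPE('m)" by (simp add: supported_tm_def agree_def)
  then show ?case by blast
next
  case (Plus s t)
  then obtain N N' where N: "supported_tm N s TYPE('m)" "supported_tm N' t TYPE('m)" by blast
  have "supported_tm (max N N') (Plus s t) TYPE('m)"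
    unfolding supported_tm_def
  proof (intro allI impI)
    fix e e' :: "nat \<Rightarrow> 'm" assume e: "agree (max N N') e e'"
    have "val e s = val e' s" by (rule supported_tmD[OF N(1) _ e]) simp
    moreover have "val e t = val e' t" by (rule supported_tmD[OF N(2) _ e]) simp
    ultimately show "val e (Plus s t) = val e' (Plus s t)" by simp
  qed
  then show ?case by blast
next
  case (Times s t)
  then obtain N N' where N: "supported_tm N s TYPE('m)" "supported_tm N' t TYPE('m)" by blast
  have "supported_tm (max N N') (Times s t) TYPE('m)"
    unfolding supported_tm_def
  proof (intro allI impI)
    fix e e' :: "nat \<Rightarrow> 'm" assume e: "agree (max N N') e e'"
    have "val e s = val e' s" by (rule supported_tmD[OF N(1) _ e]) simp
    moreover have "val e t = val e' t" by (rule supported_tmD[OF N(2) _ e]) simp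
    ultimately show "val e (Times s t) = val e' (Times s t)" by simp
  qed
  then show ?case by blast
qed (simp_all add: supported_tm_def)

text \<open>Environments are infinite and hence uncountably many; a finite support cuts them down to
  finite lists. One N serves both sorts of variables.\<close>

definition supported :: "nat \<Rightarrow> fm \<Rightarrow> 'm::peano_minus itself \<Rightarrow> bool" where
  "supported N \<phi> _ \<longleftrightarrow> (\<forall>\<X> e e' (E :: nat \<Rightarrow> 'm set) E'. agree N e e' \<longrightarrow> agree N E E' \<longrightarrow>
     sat \<X> e E \<phi> = sat \<X> e' E' \<phi>)"

lemma supportedD:
  "supported N \<phi> TYPE('m::peano_minus) \<Longrightarrow> N \<le> M \<Longrightarrow> agree M e e' \<Longrightarrow> agree M E (E' :: nat \<Rightarrow> 'm set) \<Longrightarrow>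
     sat \<X> e E \<phi> = sat \<X> e' E' \<phi>"
  unfolding supported_def using agree_mono[of M e e' N] agree_mono[of M E E' N] by simp

lemma supported_mono:
  "supported N \<phi> TYPE('m::peano_minus) \<Longrightarrow> N \<le> M \<Longrightarrow> supported M \<phi> TYPE('m)"
  unfolding supported_def[of M] by (intro allI impI) (rule supportedD)

lemma sat_support: "\<exists>N. supported N \<phi> TYPE('m::peano_minus)"
proof (induction \<phi>)
  case (Eq s t)
  obtain N1 where N1: "supported_tm N1 s TYPE('m)"
    using val_support by blast
  obtain N2 where N2: "supported_tm N2 t TYPE('m)"
    using val_support by blast
  have "supported (max N1 N2) (Eq s t) TYPE('m)"
    unfolding supported_def using supported_tmD[OF N1, of "max N1 N2"] supported_tmD[OF N2, of "max N1 N2"] by simp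
  then show ?case by blast
next
  case (Lt s t)
  obtain N1 where N1: "supported_tm N1 s TYPE('m)"
    using val_support by blast
  obtain N2 where N2: "supported_tm N2 t TYPE('m)"
    using val_support by blast
  have "supported (max N1 N2) (Lt s t) TYPE('m)"
    unfolding supported_def using supported_tmD[OF N1, of "max N1 N2"] supported_tmD[OF N2, of "max N1 N2"] by simp
  then show ?case by blast
next
  case (Mem t n)
  obtain N2 where N2: "supported_tm N2 t TYPE('m)"
    using val_support by blast
  have "supported (max (Suc n) N2) (Mem t n) TYPE('m)"
    unfolding supported_def
  proof (intro allI impI)
    fix \<X> and e e' :: "nat \<Rightarrow> 'm" and E E' :: "nat \<Rightarrow> 'm set"
    assume *: "agree (max (Suc n) N2) e e'" "agree (max (Suc n) N2) E E'"
    have "val e t = val e' t" by (rule supported_tmD[OF N2 _ *(1)]) simp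
    moreover have "E n = E' n" using *(2) by (simp add: agree_def)
    ultimately show "sat \<X> e E (Mem t n) = sat \<X> e' E' (Mem t n)" by simp
  qed
  then show ?case by blast
next
  case (Neg \<phi>)
  then show ?case unfolding supported_def by simp
next
  case (Conj \<phi> \<psi>)
  then obtain N N' where "supported N \<phi> TYPE('m)" "supported N' \<psi> TYPE('m)" by blast
  then have "supported (max N N') \<phi> TYPE('m)" "supported (max N N') \<psi> TYPE('m)"
    by (auto elim: supported_mono)
  then have "supported (max N N') (Conj \<phi> \<psi>) TYPE('m)" by (simp add: supported_def)
  then show ?case by blast
next
  case (Disj \<phi> \<psi>)
  then obtain N N' where "supported N \<phi> TYPE('m)" "supported N' \<psi> TYPE('m)" by blast
  then have "supported (max N N') \<phi> TYPE('m)" "supported (max N N') \<psi> TYPE('m)"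
    by (auto elim: supported_mono)
  then have "supported (max N N') (Disj \<phi> \<psi>) TYPE('m)" by (simp add: supported_def)
  then show ?case by blast
next
  case (BForall t \<phi>)
  then obtain N1 where N1: "supported N1 \<phi> TYPE('m)" by blast
  obtain N2 where N2: "supported_tm N2 t TYPE('m)"
    using val_support by blast
  have "supported (max N1 N2) (BForall t \<phi>) TYPE('m)"
    unfolding supported_def
  proof (intro allI impI)
    fix \<X> and e e' :: "nat \<Rightarrow> 'm" and E E' :: "nat \<Rightarrow> 'm set"
    assume *: "agree (max N1 N2) e e'" "agree (max N1 N2) E E'"
    have "sat \<X> (case_nat x e) E \<phi> = sat \<X> (case_nat x e') E' \<phi>" for x
      using supportedD[OF N1 _ agree_cons[OF *(1)] *(2)] by simp
    moreover have "val e t = val e' t" by (rule supported_tmD[OF N2 _ *(1)]) simp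
    ultimately show "sat \<X> e E (BForall t \<phi>) = sat \<X> e' E' (BForall t \<phi>)" by simp
  qed
  then show ?case by blast
next
  case (BExists t \<phi>)
  then obtain N1 where N1: "supported N1 \<phi> TYPE('m)" by blast
  obtain N2 where N2: "supported_tm N2 t TYPE('m)"
    using val_support by blast
  have "supported (max N1 N2) (BExists t \<phi>) TYPE('m)"
    unfolding supported_def
  proof (intro allI impI)
    fix \<X> and e e' :: "nat \<Rightarrow> 'm" and E E' :: "nat \<Rightarrow> 'm set"
    assume *: "agree (max N1 N2) e e'" "agree (max N1 N2) E E'"
    have "sat \<X> (case_nat x e) E \<phi> = sat \<X> (case_nat x e') E' \<phi>" for x
      using supportedD[OF N1 _ agree_cons[OF *(1)] *(2)] by simp
    moreover have "val e t = val e' t" by (rule supported_tmD[OF N2 _ *(1)]) simp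
    ultimately show "sat \<X> e E (BExists t \<phi>) = sat \<X> e' E' (BExists t \<phi>)" by simp
  qed
  then show ?case by blast
next
  case (Forall \<phi>)
  then obtain N where N: "supported N \<phi> TYPE('m)" by blast
  have "supported N (Forall \<phi>) TYPE('m)"
    unfolding supported_def
  proof (intro allI impI)
    fix \<X> and e e' :: "nat \<Rightarrow> 'm" and E E' :: "nat \<Rightarrow> 'm set"
    assume *: "agree N e e'" "agree N E E'"
    have "sat \<X> (case_nat x e) E \<phi> = sat \<X> (case_nat x e') E' \<phi>" for x
      by (rule supportedD[OF N order_refl agree_cons[OF *(1)] *(2)])
    then show "sat \<X> e E (Forall \<phi>) = sat \<X> e' E' (Forall \<phi>)" by simp
  qed
  then show ?case by blast
next
  case (Exists \<phi>)
  then obtain N where N: "supported N \<phi> TYPE('m)" by blast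
  have "supported N (Exists \<phi>) TYPE('m)"
    unfolding supported_def
  proof (intro allI impI)
    fix \<X> and e e' :: "nat \<Rightarrow> 'm" and E E' :: "nat \<Rightarrow> 'm set"
    assume *: "agree N e e'" "agree N E E'"
    have "sat \<X> (case_nat x e) E \<phi> = sat \<X> (case_nat x e') E' \<phi>" for x
      by (rule supportedD[OF N order_refl agree_cons[OF *(1)] *(2)])
    then show "sat \<X> e E (Exists \<phi>) = sat \<X> e' E' (Exists \<phi>)" by simp
  qed
  then show ?case by blast
next
  case (ForallSet \<phi>)
  then obtain N where N: "supported N \<phi> TYPE('m)" by blast
  have "supported N (ForallSet \<phi>) TYPE('m)"
    unfolding supported_def
  proof (intro allI impI)
    fix \<X> and e e' :: "nat \<Rightarrow> 'm" and E E' :: "nat \<Rightarrow> 'm set"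
    assume *: "agree N e e'" "agree N E E'"
    have "sat \<X> e (case_nat x E) \<phi> = sat \<X> e' (case_nat x E') \<phi>" for x
      by (rule supportedD[OF N order_refl *(1) agree_cons[OF *(2)]])
    then show "sat \<X> e E (ForallSet \<phi>) = sat \<X> e' E' (ForallSet \<phi>)" by simp
  qed
  then show ?case by blast
next
  case (ExistsSet \<phi>)
  then obtain N where N: "supported N \<phi> TYPE('m)" by blast
  have "supported N (ExistsSet \<phi>) TYPE('m)"
    unfolding supported_def
  proof (intro allI impI)
    fix \<X> and e e' :: "nat \<Rightarrow> 'm" and E E' :: "nat \<Rightarrow> 'm set"
    assume *: "agree N e e'" "agree N E E'"
    have "sat \<X> e (case_nat x E) \<phi> = sat \<X> e' (case_nat x E') \<phi>" for x
      by (rule supportedD[OF N order_refl *(1) agree_cons[OF *(2)]])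
    then show "sat \<X> e E (ExistsSet \<phi>) = sat \<X> e' E' (ExistsSet \<phi>)" by simp
  qed
  then show ?case by blast
qed

instance tm :: countable by countable_datatype
instance fm :: countable by countable_datatype

definition env_of :: "'a \<Rightarrow> 'a list \<Rightarrow> nat \<Rightarrow> 'a" where
  "env_of d l n = (if n < length l then l ! n else d)"

lemma agree_env_of: "agree N e (env_of d (map e [0..<N]))"
  by (simp add: agree_def env_of_def)

text \<open>A formula with two finite parameter lists determines the value, and there are countably
  many such triples. The abstract F covers the definable sets as well as the queries to a path used
  later.\<close>

lemma countable_definable:
  fixes \<S> :: "'m::peano_minus set set" and F :: "fm \<Rightarrow> (nat \<Rightarrow> 'm) \<Rightarrow> (nat \<Rightarrow> 'm set) \<Rightarrow> 'b"
  assumes "countable (UNIV :: 'm set)" "countable \<S>"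
    and F: "\<And>\<phi> e e' E E' N. supported N \<phi> TYPE('m) \<Longrightarrow> agree N e e' \<Longrightarrow> agree N E E' \<Longrightarrow> F \<phi> e E = F \<phi> e' E'"
  shows "countable {F \<phi> e E | \<phi> e E. range E \<subseteq> \<S>}"
proof -
  \<comment> \<open>Beyond the lists the defaults 0 and {} are read; {} may lie outside \<S>, which
    is harmless since F does not look beyond the support.\<close>
  let ?G = "\<lambda>(\<phi>, l, L). F \<phi> (env_of 0 l) (env_of {} L)"
  have "{F \<phi> e E | \<phi> e E. range E \<subseteq> \<S>} \<subseteq> ?G ` (UNIV \<times> lists UNIV \<times> lists \<S>)"
  proof (clarify)
    fix \<phi> e and E :: "nat \<Rightarrow> 'm set"
    assume E: "range E \<subseteq> \<S>"
    obtain N where "supported N \<phi> TYPE('m)" using sat_support by blast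
    then have eq: "F \<phi> e E = ?G (\<phi>, map e [0..<N], map E [0..<N])"
      by (simp add: F[OF _ agree_env_of agree_env_of])
    have "(\<phi>, map e [0..<N], map E [0..<N]) \<in> UNIV \<times> lists UNIV \<times> lists \<S>"
      using E by (auto simp: image_subset_iff)
    then show "F \<phi> e E \<in> ?G ` (UNIV \<times> lists UNIV \<times> lists \<S>)" unfolding eq by (rule imageI)
  qed
  moreover have "countable (?G ` (UNIV \<times> lists UNIV \<times> lists \<S>))"
    by (intro countable_image countable_SIGMA countable_lists assms(1,2) countableI_type)
  ultimately show ?thesis by (rule countable_subset)
qed

lemma countable_so_definable:
  fixes \<S> :: "'m::peano_minus set set"
  assumes "countable (UNIV :: 'm set)" "countable \<S>"
  shows "countable {Y. so_definable \<S> Y}"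
proof -
  have "countable {defset \<S> e E \<phi> | \<phi> e E. range E \<subseteq> \<S>}"
    by (rule countable_definable[OF assms])
      (auto simp: defset_def dest: supportedD[OF _ order_refl agree_cons])
  moreover have "{Y. so_definable \<S> Y} = {defset \<S> e E \<phi> | \<phi> e E. range E \<subseteq> \<S>}"
    by (auto simp: so_definable_def)
  ultimately show ?thesis by simp
qed

lemma countable_Delta1:
  fixes \<S> :: "'m::peano_minus set set"
  assumes "countable (UNIV :: 'm set)" "countable \<S>" "\<S> \<noteq> {}"
  shows "countable (Delta1 \<S>)"
  using countable_subset[OF _ countable_so_definable[OF assms(1,2)]] Delta1_so_definable assms(3)
  by blast

section \<open>Induction principles and a bounded form of the beta function\<close>

lemma pm_zero_less_two [simp]: "(0::'m::peano_minus) < 2"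
proof -
  have "(0::'m) < 1 + 1" by (rule order_less_le_trans[OF pm_zero_less_one pm_le_add(1)])
  then show ?thesis by (simp only: one_add_one)
qed

lemma ind_rule:
  assumes "ind \<S>" "bdef \<S> (\<lambda>e. P (e 0))" "P 0" "\<And>x. P x \<Longrightarrow> P (x + 1)"
  shows "P a"
  using assms unfolding ind_def by blast

lemma ind_least:
  assumes "ind \<S>" "bdef \<S> (\<lambda>e. P (e 0))" "P a"
  shows "\<exists>x. P x \<and> (\<forall>y<x. \<not> P y)"
proof (rule ccontr)
  assume *: "\<not> ?thesis"
  have "\<forall>y<a + 1. \<not> P y"
  proof (rule ind_rule[OF assms(1), of "\<lambda>x. \<forall>y<x. \<not> P y"])
    show "bdef \<S> (\<lambda>e. \<forall>y<e 0. \<not> P y)"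
      by (intro bdef_ball bdef_not assms(2) trm_var)
    show "\<forall>y<x + 1. \<not> P y" if "\<forall>y<x. \<not> P y" for x
      using * that by (auto simp: order_le_less)
  qed simp
  then show False using assms(3) by simp
qed

lemma ind_less:
  assumes "ind \<S>" "bdef \<S> (\<lambda>e. P (e 0))" "\<And>x. (\<And>y. y < x \<Longrightarrow> P y) \<Longrightarrow> P x"
  shows "P a"
proof (rule ccontr)
  assume "\<not> P a"
  then show False
    using ind_least[OF assms(1) bdef_not[OF assms(2)], of a] assms(3) by blast
qed

lemma trm_shift: "trm f \<Longrightarrow> trm (\<lambda>e. f (\<lambda>n. e (Suc n)))"
  using trm_subst[of f "\<lambda>n e. e (Suc n)"] by (simp add: trm_var)

text \<open>The divisor is positive, so the quotient is at most a and its search is bounded.\<close>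

lemma beta_iff:
  "beta a b i u \<longleftrightarrow> u < 1 + (i + 1) * b \<and> (\<exists>q<a + 1. a = q * (1 + (i + 1) * b) + u)"
proof -
  have "q < a + 1" if "a = q * (1 + (i + 1) * b) + u" for q
  proof -
    have "0 < 1 + (i + 1) * b" by (simp add: zero_less_iff_neq_zero)
    then have "q \<le> q * (1 + (i + 1) * b)" by (rule pm_le_mult)
    also have "\<dots> \<le> a" by (simp add: that)
    finally show ?thesis by simp
  qed
  then show ?thesis unfolding beta_def by blast
qed

lemma bdef_beta:
  assumes "trm f" "trm g" "trm h" "trm k"
  shows "bdef \<S> (\<lambda>e. beta (f e) (g e) (h e) (k e))"
  unfolding beta_iff by (intro bdef_rules trm_shift assms)

lemma beta_unique:
  assumes "beta a b i u" "beta a b i u'" shows "u = u'"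
  using assms unfolding beta_def using pm_division_unique by metis

subsection \<open>Powers of two in a model of \<open>RCA\<^sub>0\<^sup>*\<close>\<close>

locale rca =
  fixes \<Z> :: "'m::peano_minus set set"
  assumes RCA: "RCA0_star \<Z>"
begin

lemma ind: "ind \<Z>"
  using RCA by (rule RCA0_star_ind)

lemmas induct = ind_rule[OF ind] and least = ind_least[OF ind] and induct_less = ind_less[OF ind]

text \<open>
  By comprehension, coding a binary \<open>\<Delta>\<^sub>1\<close> relation as a set of pairs makes it available as an atom of
  bounded predicates. This is how the relation \<open>p = 2\<^sup>k\<close>, whose defining formula has unbounded
  quantifiers, and the initial segment relation enter induction and bounded formulas.
\<close>

lemma delta1_binary:
  assumes Q: "bdef \<Z> (\<lambda>e. Q (e 0) (e 1) (e 2))" and Q': "bdef \<Z> (\<lambda>e. Q' (e 0) (e 1) (e 2))"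
    and R: "\<And>x y. R x y \<longleftrightarrow> (\<exists>w. Q w x y)" "\<And>x y. \<not> R x y \<longleftrightarrow> (\<exists>w. Q' w x y)"
    and f: "trm f" "trm g"
  shows "bdef \<Z> (\<lambda>e. R (f e) (g e))"
proof -
  define Y where "Y = {pair x y |x y. R x y}"
  have Y: "pair x y \<in> Y \<longleftrightarrow> R x y" for x y by (auto simp: Y_def pair_inject)
  have le: "x < pair x y + 1" "y < pair x y + 1" for x y :: 'm by (simp_all add: le_pair)
  have "Y \<in> \<Z>"
  proof (rule RCA0_star_comprehension[OF RCA])
    show "bdef \<Z> (\<lambda>e. \<exists>x<e 1 + 1. \<exists>y<e 1 + 1. e 1 = pair x y \<and> Q (e 0) x y)"
      unfolding pair_def by (intro bdef_rules bdef_subst3[OF Q])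
    \<comment> \<open>The complement of Y has a second kind of member: numbers that are not
      pairs.\<close>
    show "bdef \<Z> (\<lambda>e. (\<exists>x<e 1 + 1. \<exists>y<e 1 + 1. e 1 = pair x y \<and> Q' (e 0) x y) \<or>
        \<not> (\<exists>x<e 1 + 1. \<exists>y<e 1 + 1. e 1 = pair x y))"
      unfolding pair_def by (intro bdef_rules bdef_subst3[OF Q'])
    fix z
    show "z \<in> Y \<longleftrightarrow> (\<exists>w. \<exists>x<z + 1. \<exists>y<z + 1. z = pair x y \<and> Q w x y)"
      using le unfolding Y_def R(1) by blast
    show "z \<notin> Y \<longleftrightarrow> (\<exists>w. (\<exists>x<z + 1. \<exists>y<z + 1. z = pair x y \<and> Q' w x y) \<or>
        \<not> (\<exists>x<z + 1. \<exists>y<z + 1. z = pair x y))"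
    proof (cases "\<exists>x y. z = pair x y")
      case True
      then obtain x y where z: "z = pair x y" by blast
      have "z \<notin> Y \<longleftrightarrow> (\<exists>w. Q' w x y)" using Y by (simp add: z R(2))
      moreover have "(\<exists>x'<z + 1. \<exists>y'<z + 1. z = pair x' y' \<and> Q' w x' y') \<longleftrightarrow> Q' w x y" for w
        using le(1)[of x y] le(2)[of y x] unfolding z pair_inject by blast
      moreover have "\<exists>x'<z + 1. \<exists>y'<z + 1. z = pair x' y'"
        using le(1)[of x y] le(2)[of y x] unfolding z by blast
      ultimately show ?thesis by simp
    next
      case False
      then show ?thesis unfolding Y_def by blast
    qed
  qed
  then have "bdef \<Z> (\<lambda>e. pair (f e) (g e) \<in> Y)"
    unfolding pair_def by (intro bdef_mem trm_plus trm_times f)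
  then show ?thesis by (simp add: Y)
qed

text \<open>The part of \<open>exp_graph 2 k p\<close> without the final value p. Once the codes a
  and b are given it is a bounded predicate, whereas \<open>exp_graph\<close> searches for codes
  without a bound.\<close>

definition chain :: "'m \<Rightarrow> 'm \<Rightarrow> 'm \<Rightarrow> bool" where
  "chain a b k \<longleftrightarrow> beta a b 0 1 \<and> (\<forall>i<k. \<exists>u. beta a b i u \<and> beta a b (i + 1) (2 * u))"

lemma exp_graph_chain: "exp_graph 2 k p \<longleftrightarrow> (\<exists>a b. chain a b k \<and> beta a b k p)"
  by (auto simp: exp_graph_def chain_def)

lemma chain_iff:
  "chain a b k \<longleftrightarrow> beta a b 0 1 \<and> (\<forall>i<k. \<exists>u<1 + (i + 1) * b. beta a b i u \<and> beta a b (i + 1) (2 * u))"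
  unfolding chain_def beta_def by blast

lemma bdef_chain:
  assumes "trm f" "trm g" "trm h"
  shows "bdef \<Z> (\<lambda>e. chain (f e) (g e) (h e))"
  unfolding chain_iff by (intro bdef_beta bdef_rules trm_shift assms)

text \<open>Both codes start with 1 and double at each step, so a bounded induction up to k compares
  them entry by entry. Uniqueness of powers then follows without constructing any code.\<close>

lemma chain_agree:
  assumes "chain a b k" "chain a' b' k" "i \<le> k"
  shows "\<exists>u. beta a b i u \<and> beta a' b' i u"
proof -
  have "i \<le> k \<longrightarrow> (\<exists>u<1 + (i + 1) * b. beta a b i u \<and> beta a' b' i u)"
  proof (rule induct[where a = i])
    show "bdef \<Z> (\<lambda>e. e 0 \<le> k \<longrightarrow> (\<exists>u<1 + (e 0 + 1) * b. beta a b (e 0) u \<and> beta a' b' (e 0) u))"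
      by (intro bdef_beta bdef_rules)
    have "beta a b 0 1" "beta a' b' 0 1" using assms by (auto simp: chain_def)
    then show "0 \<le> k \<longrightarrow> (\<exists>u<1 + (0 + 1) * b. beta a b 0 u \<and> beta a' b' 0 u)"
      unfolding beta_def by blast
    fix i
    assume IH: "i \<le> k \<longrightarrow> (\<exists>u<1 + (i + 1) * b. beta a b i u \<and> beta a' b' i u)"
    show "i + 1 \<le> k \<longrightarrow> (\<exists>u<1 + (i + 1 + 1) * b. beta a b (i + 1) u \<and> beta a' b' (i + 1) u)"
    proof
      assume "i + 1 \<le> k"
      then have i: "i < k" by (simp add: pm_less_iff)
      then obtain u where u: "beta a b i u" "beta a' b' i u" using IH by auto
      obtain v where v: "beta a b i v" "beta a b (i + 1) (2 * v)"
        using assms(1) i unfolding chain_def by blast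
      obtain v' where v': "beta a' b' i v'" "beta a' b' (i + 1) (2 * v')"
        using assms(2) i unfolding chain_def by blast
      have "v = u" "v' = u" using u v v' beta_unique by blast+
      then have "beta a b (i + 1) (2 * u) \<and> beta a' b' (i + 1) (2 * u)" using v v' by simp
      moreover from this have "2 * u < 1 + (i + 1 + 1) * b" by (simp add: beta_def)
      ultimately show "\<exists>u<1 + (i + 1 + 1) * b. beta a b (i + 1) u \<and> beta a' b' (i + 1) u" by blast
    qed
  qed
  then show ?thesis using assms(3) by blast
qed

lemma exp_graph_unique:
  assumes "exp_graph 2 k p" "exp_graph 2 k (q :: 'm)" shows "p = q"
proof -
  obtain a b a' b' where *: "chain a b k" "beta a b k p" "chain a' b' k" "beta a' b' k q"
    using assms unfolding exp_graph_chain by blast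
  obtain u where "beta a b k u" "beta a' b' k u" using chain_agree[OF *(1,3), of k] by auto
  then show ?thesis using * beta_unique by metis
qed

lemma exp_graph_total: "\<exists>p. exp_graph 2 (k :: 'm) p"
  using RCA by (simp add: RCA0_star_def exp_total_def)

lemma exp_graph_0 [simp]: "exp_graph 2 0 p \<longleftrightarrow> p = (1 :: 'm)"
proof -
  have *: "p = 1" if p: "exp_graph 2 0 p" for p :: 'm
  proof -
    obtain a b where "chain a b 0" "beta a b 0 p" using p unfolding exp_graph_chain by blast
    then show "p = 1" unfolding chain_def using beta_unique by blast
  qed
  then show ?thesis using exp_graph_total[of 0] by blast
qed

text \<open>Instead of lengthening a code by the Chinese remainder theorem, totality and uniqueness
  are used: some power at k + 1 exists, it is twice a power at k, and the latter is unique.\<close>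

lemma exp_graph_Suc: "exp_graph 2 (k + 1) p \<longleftrightarrow> (\<exists>q. exp_graph 2 k q \<and> p = 2 * (q :: 'm))"
proof -
  have *: "\<exists>q. exp_graph 2 k q \<and> p = 2 * q" if p: "exp_graph 2 (k + 1) p" for p
  proof -
    obtain a b where ab: "chain a b (k + 1)" "beta a b (k + 1) p"
      using p unfolding exp_graph_chain by blast
    then obtain u where u: "beta a b k u" "beta a b (k + 1) (2 * u)" unfolding chain_def by auto
    have "chain a b k" using ab(1) unfolding chain_def by auto
    then have "exp_graph 2 k u" using u unfolding exp_graph_chain by blast
    moreover have "p = 2 * u" using ab(2) u(2) by (rule beta_unique)
    ultimately show ?thesis by blast
  qed
  show ?thesis
  proof
    assume "\<exists>q. exp_graph 2 k q \<and> p = 2 * q"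
    then obtain q where q: "exp_graph 2 k q" "p = 2 * q" by blast
    obtain p' where p': "exp_graph 2 (k + 1) p'" using exp_graph_total by blast
    then obtain q' where "exp_graph 2 k q'" "p' = 2 * q'" using * by blast
    then have "p' = p" using q exp_graph_unique by blast
    then show "exp_graph 2 (k + 1) p" using p' by simp
  qed (rule *)
qed

text \<open>The complement is \<Sigma>1 as well: by totality and uniqueness, p is not the power iff
  some other number is.\<close>

lemma bdef_exp_graph:
  assumes "trm f" "trm g"
  shows "bdef \<Z> (\<lambda>e. exp_graph 2 (f e) (g e))"
proof (rule delta1_binary[OF _ _ _ _ assms])
  let ?Q = "\<lambda>w k p. \<exists>a<w. \<exists>b<w. chain a b k \<and> beta a b k p"
  let ?Q' = "\<lambda>w k p. \<exists>p'<w. p' \<noteq> p \<and> ?Q w k p'"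
  show "bdef \<Z> (\<lambda>e. ?Q (e 0) (e 1) (e 2))" by (intro bdef_beta bdef_chain bdef_rules)
  show "bdef \<Z> (\<lambda>e. ?Q' (e 0) (e 1) (e 2))" by (intro bdef_beta bdef_chain bdef_rules)
  \<comment> \<open>The search bound is made to exceed c so that a competing value p' can be found
    below it too.\<close>
  have *: "\<exists>w>c. ?Q w k p" if p: "exp_graph 2 k p" for k p c
  proof -
    obtain a b where "chain a b k" "beta a b k p" using p unfolding exp_graph_chain by blast
    moreover have "a \<le> a + b + c" "b \<le> a + b + c" "c \<le> a + b + c"
      by (simp add: add.assoc, simp add: add.assoc add.left_commute[of a b], simp)
    then have "a < a + b + c + 1" "b < a + b + c + 1" "c < a + b + c + 1" by simp_all
    ultimately show ?thesis by blast
  qed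
  show "exp_graph 2 k p \<longleftrightarrow> (\<exists>w. ?Q w k p)" for k p
    using *[of k p] unfolding exp_graph_chain by blast
  show "\<not> exp_graph 2 k p \<longleftrightarrow> (\<exists>w. ?Q' w k p)" for k p
  proof
    assume p: "\<not> exp_graph 2 k p"
    obtain p' where p': "exp_graph 2 k p'" using exp_graph_total by blast
    then obtain w where "w > p'" "?Q w k p'" using *[of k p' p'] by blast
    moreover have "p' \<noteq> p" using p p' by blast
    ultimately show "\<exists>w. ?Q' w k p" by blast
  next
    assume "\<exists>w. ?Q' w k p"
    then obtain p' where "p' \<noteq> p" "exp_graph 2 k p'" unfolding exp_graph_chain by blast
    then show "\<not> exp_graph 2 k p" using exp_graph_unique by blast
  qed
qed

text \<open>Bounds the exponent by the power, so that being a power of two becomes a bounded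
  predicate.\<close>

lemma exp_graph_less:
  assumes "exp_graph 2 k p" shows "k < (p :: 'm)"
proof -
  \<comment> \<open>Restricting q to values up to p keeps the induction predicate bounded; the
    halved power r stays within this range.\<close>
  have "\<forall>q<p + 1. exp_graph 2 k q \<longrightarrow> k < q"
  proof (rule induct[where a = k])
    show "bdef \<Z> (\<lambda>e. \<forall>q<p + 1. exp_graph 2 (e 0) q \<longrightarrow> e 0 < q)"
      by (intro bdef_exp_graph bdef_rules)
    fix k assume IH: "\<forall>q<p + 1. exp_graph 2 k q \<longrightarrow> k < q"
    show "\<forall>q<p + 1. exp_graph 2 (k + 1) q \<longrightarrow> k + 1 < q"
    proof (intro allI impI)
      fix q assume "q < p + 1" "exp_graph 2 (k + 1) q"
      then obtain r where r: "exp_graph 2 k r" "q = r + r" by (auto simp: exp_graph_Suc mult_2)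
      have "r \<le> r + r" by simp
      then have "r < p + 1" using r(2) \<open>q < p + 1\<close> by (meson order_le_less_trans)
      then have "k < r" using IH r(1) by blast
      then have "k + 1 \<le> r" "0 < r"
        using nonneg[of k] by (simp_all add: pm_less_iff[of k] order_le_less_trans[of 0 k r])
      then have "k + 1 + 0 \<le> r + 0" "r + 0 < r + r" unfolding pm_add_less_cancel by simp_all
      then show "k + 1 < q" using r(2) by simp
    qed
  qed auto
  then show ?thesis using assms by simp
qed

definition pow2 :: "'m \<Rightarrow> bool" where
  "pow2 p \<longleftrightarrow> (\<exists>k. exp_graph 2 k p)"

lemma bdef_pow2:
  assumes "trm f" shows "bdef \<Z> (\<lambda>e. pow2 (f e))"
proof -
  have "pow2 p \<longleftrightarrow> (\<exists>k<p. exp_graph 2 k p)" for p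
    unfolding pow2_def using exp_graph_less by blast
  then show ?thesis by simp (intro bdef_exp_graph bdef_rules trm_shift assms)
qed

lemma pow2_one [simp]: "pow2 1"
  unfolding pow2_def using exp_graph_0 by blast

lemma pow2_double: "pow2 p \<Longrightarrow> pow2 (2 * p)"
  unfolding pow2_def using exp_graph_Suc by blast

lemma pow2_cases: "pow2 p \<Longrightarrow> p = 1 \<or> (\<exists>q. pow2 q \<and> p = 2 * q)"
proof -
  assume "pow2 p"
  then obtain k where k: "exp_graph 2 k p" unfolding pow2_def by blast
  show ?thesis
  proof (cases "k = 0")
    case False
    then have "1 \<le> k" by (intro discrete_one) (simp add: zero_less_iff_neq_zero)
    then obtain j where "k = j + 1" using le_iff_add add.commute by metis
    then show ?thesis using k exp_graph_Suc unfolding pow2_def by blast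
  qed (use k in simp)
qed

lemma pow2_pos: "pow2 p \<Longrightarrow> 0 < p"
  unfolding pow2_def using exp_graph_less nonneg order_le_less_trans by blast

lemma less_double: "0 < (p :: 'm) \<Longrightarrow> p < 2 * p"
  using pm_add_less_cancel(2)[of p 0 p] by (simp add: mult_2)

lemma double_le_cancel: "2 * p \<le> 2 * (q :: 'm) \<longleftrightarrow> p \<le> q"
  using pm_mult_le_cancel[of 2 p q] by (simp add: mult.commute)

text \<open>Induction on the value q, which is halved at each step, avoids addition of
  exponents.\<close>

lemma pow2_mult:
  assumes "pow2 p" "pow2 q" shows "pow2 (p * q)"
proof -
  have "pow2 q \<longrightarrow> pow2 (p * q)"
  proof (rule induct_less[where a = q])
    show "bdef \<Z> (\<lambda>e. pow2 (e 0) \<longrightarrow> pow2 (p * e 0))"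
      by (intro bdef_pow2 bdef_rules)
    fix q assume IH: "\<And>r. r < q \<Longrightarrow> pow2 r \<longrightarrow> pow2 (p * r)"
    show "pow2 q \<longrightarrow> pow2 (p * q)"
    proof
      assume "pow2 q"
      then consider "q = 1" | r where "pow2 r" "q = 2 * r" using pow2_cases by blast
      then show "pow2 (p * q)"
      proof cases
        case 2
        then have "pow2 (p * r)" using IH less_double pow2_pos by blast
        then have "pow2 (2 * (p * r))" by (rule pow2_double)
        then show ?thesis using 2 by (simp add: mult.left_commute)
      qed (use assms in simp)
    qed
  qed
  then show ?thesis using assms by blast
qed

text \<open>Both numbers are halved at once; r is quantified within the bounded induction predicate
  because it shrinks along with p.\<close>

lemma pow2_divides:
  assumes "pow2 p" "pow2 q" "p \<le> q" shows "\<exists>s. pow2 s \<and> q = p * s"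
proof -
  let ?P = "\<lambda>p. \<forall>r<q + 1. pow2 p \<longrightarrow> pow2 r \<longrightarrow> p \<le> r \<longrightarrow> (\<exists>s<r + 1. pow2 s \<and> r = p * s)"
  have "?P p"
  proof (rule induct_less[where a = p])
    show "bdef \<Z> (\<lambda>e. ?P (e 0))"
      by (intro bdef_pow2 bdef_rules)
    fix p assume IH: "\<And>x. x < p \<Longrightarrow> ?P x"
    show "?P p"
    proof (intro allI impI)
      fix r assume r: "r < q + 1" "pow2 p" "pow2 r" "p \<le> r"
      consider "p = 1" | p' where "pow2 p'" "p = 2 * p'" using pow2_cases r(2) by blast
      then show "\<exists>s<r + 1. pow2 s \<and> r = p * s"
      proof cases
        case 1
        then show ?thesis using r by (intro exI[of _ r]) simp
      next
        case 2
        then have "p' < p" using less_double pow2_pos by blast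
        moreover have "1 \<le> p'" using discrete_one pow2_pos 2(1) by blast
        ultimately have "r \<noteq> 1" using r(4) by (metis leD order_le_less_trans)
        then obtain r' where r': "pow2 r'" "r = 2 * r'" using pow2_cases r(3) by blast
        have "p' \<le> r'" using r(4) 2 r' by (simp add: double_le_cancel)
        moreover have "r' < r" using r' less_double pow2_pos by blast
        ultimately obtain s where "pow2 s" "r' = p' * s"
          using IH[OF \<open>p' < p\<close>] 2(1) r'(1) r(1) by (metis order_less_trans)
        then have s: "pow2 s" "r = p * s" using 2 r' by (simp_all add: mult.assoc)
        then have "s \<le> r" using pm_le_mult(2)[of p s] pow2_pos r(2) by simp
        then show ?thesis using s by auto
      qed
    qed
  qed
  then show ?thesis using assms by auto
qed

subsection \<open>Binary strings\<close>

text \<open>The extensions of \<sigma> by k bits fill the interval of length p = 2^k that starts at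
  \<sigma> * p. As \<sigma> is positive, p is at most \<tau>, which makes the relation
  bounded.\<close>

lemma initial_segment_iff:
  "initial_segment \<sigma> \<tau> \<longleftrightarrow> 0 < \<sigma> \<and> (\<exists>p<\<tau> + 1. pow2 p \<and> \<sigma> * p \<le> \<tau> \<and> \<tau> < \<sigma> * p + p)"
proof
  assume "initial_segment \<sigma> \<tau>"
  then obtain k p r where *: "0 < \<sigma>" "exp_graph 2 k p" "r < p" "\<tau> = \<sigma> * p + r"
    unfolding initial_segment_def by blast
  then have "p \<le> \<sigma> * p" by (intro pm_le_mult)
  then have "p < \<tau> + 1" using *(4) by (auto intro: order_trans)
  then show "0 < \<sigma> \<and> (\<exists>p<\<tau> + 1. pow2 p \<and> \<sigma> * p \<le> \<tau> \<and> \<tau> < \<sigma> * p + p)"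
    using * pow2_def by auto
next
  assume "0 < \<sigma> \<and> (\<exists>p<\<tau> + 1. pow2 p \<and> \<sigma> * p \<le> \<tau> \<and> \<tau> < \<sigma> * p + p)"
  then obtain p where *: "0 < \<sigma>" "pow2 p" "\<sigma> * p \<le> \<tau>" "\<tau> < \<sigma> * p + p" by blast
  then obtain r where "\<tau> = \<sigma> * p + r" using le_iff_add by blast
  then show "initial_segment \<sigma> \<tau>"
    using * unfolding initial_segment_def pow2_def by auto
qed

lemma bdef_initial_segment:
  assumes "trm f" "trm g"
  shows "bdef \<Z> (\<lambda>e. initial_segment (f e) (g e))"
  unfolding initial_segment_iff by (intro bdef_pow2 bdef_rules trm_shift assms)

lemma initial_segment_pow2:
  assumes "0 < \<sigma>" "pow2 p" "\<sigma> * p \<le> \<tau>" "\<tau> < \<sigma> * p + p"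
  shows "initial_segment \<sigma> \<tau>"
proof -
  have "p \<le> \<sigma> * p" using assms(1) by (rule pm_le_mult)
  then have "p < \<tau> + 1" using assms(3) by simp
  then show ?thesis unfolding initial_segment_iff using assms by blast
qed

lemma initial_segmentE:
  assumes "initial_segment \<sigma> (\<tau> :: 'm)"
  obtains p where "0 < \<sigma>" "pow2 p" "\<sigma> * p \<le> \<tau>" "\<tau> < \<sigma> * p + p"
  using assms unfolding initial_segment_iff by blast

lemma initial_segment_refl: "0 < (\<sigma> :: 'm) \<Longrightarrow> initial_segment \<sigma> \<sigma>"
  using initial_segment_pow2[of \<sigma> 1 \<sigma>] by simp

lemma initial_segment_le: "initial_segment \<sigma> \<tau> \<Longrightarrow> \<sigma> \<le> (\<tau> :: 'm)"
  by (metis initial_segmentE order_trans pm_le_mult(1) pow2_pos)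

text \<open>Intervals of extensions nest: rescaling by q the interval that holds \<tau> puts \<rho>
  into the interval of \<sigma> at scale p * q.\<close>

lemma initial_segment_trans:
  assumes "initial_segment \<sigma> \<tau>" "initial_segment \<tau> \<rho>" shows "initial_segment \<sigma> (\<rho> :: 'm)"
proof -
  obtain p where p: "0 < \<sigma>" "pow2 p" "\<sigma> * p \<le> \<tau>" "\<tau> < \<sigma> * p + p"
    using assms(1) by (rule initial_segmentE)
  obtain q where q: "pow2 q" "\<tau> * q \<le> \<rho>" "\<rho> < \<tau> * q + q"
    using assms(2) by (rule initial_segmentE)
  have "\<sigma> * (p * q) \<le> \<tau> * q"
    using mult_right_mono[OF p(3) nonneg, of q] by (simp add: mult.assoc)
  also note q(2)
  finally have 1: "\<sigma> * (p * q) \<le> \<rho>" .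
  note q(3)
  also have "\<tau> * q + q = (\<tau> + 1) * q" by (simp add: distrib_right)
  also have "\<dots> \<le> (\<sigma> * p + p) * q"
    by (rule mult_right_mono) (use p(4) nonneg in \<open>simp_all add: pm_less_iff\<close>)
  also have "\<dots> = \<sigma> * (p * q) + p * q" by (simp add: distrib_right mult.assoc)
  finally show ?thesis using 1 p(1,2) q(1) pow2_mult initial_segment_pow2 by blast
qed

text \<open>If p' <= p, then p' divides p; cancelling p' from the two interval conditions places
  \<sigma>' among the extensions of \<sigma>, with the quotient as scale.\<close>

lemma initial_segment_comparable:
  assumes "initial_segment \<sigma> \<tau>" "initial_segment \<sigma>' (\<tau> :: 'm)"
  shows "initial_segment \<sigma> \<sigma>' \<or> initial_segment \<sigma>' \<sigma>"
proof -
  have *: "initial_segment \<sigma> \<sigma>'"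
    if p: "0 < \<sigma>" "pow2 p" "\<sigma> * p \<le> \<tau>" "\<tau> < \<sigma> * p + p"
      and p': "0 < \<sigma>'" "pow2 p'" "\<sigma>' * p' \<le> \<tau>" "\<tau> < \<sigma>' * p' + p'" and le: "p' \<le> p"
    for \<sigma> \<sigma>' p p'
  proof -
    obtain s where s: "pow2 s" "p = p' * s" using pow2_divides p(2) p'(2) le by blast
    have "(\<sigma> * s) * p' \<le> \<tau>" using p(3) s(2) by (simp add: ac_simps)
    also note p'(4)
    also have "\<sigma>' * p' + p' = (\<sigma>' + 1) * p'" by (simp add: distrib_right)
    finally have 1: "\<sigma> * s \<le> \<sigma>'" using pm_mult_less_cancel[OF pow2_pos[OF p'(2)]] by simp
    note p'(3)
    also note p(4)
    also have "\<sigma> * p + p = (\<sigma> * s + s) * p'" using s(2) by (simp add: algebra_simps)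
    finally have "\<sigma>' < \<sigma> * s + s" using pm_mult_less_cancel[OF pow2_pos[OF p'(2)]] by simp
    then show ?thesis using 1 s(1) p(1) initial_segment_pow2 by blast
  qed
  obtain p where p: "0 < \<sigma>" "pow2 p" "\<sigma> * p \<le> \<tau>" "\<tau> < \<sigma> * p + p"
    using assms(1) by (rule initial_segmentE)
  obtain p' where p': "0 < \<sigma>'" "pow2 p'" "\<sigma>' * p' \<le> \<tau>" "\<tau> < \<sigma>' * p' + p'"
    using assms(2) by (rule initial_segmentE)
  show ?thesis using *[OF p p'] *[OF p' p] linear by blast
qed

lemma parity: "\<exists>q. \<tau> = 2 * q \<or> \<tau> = 2 * q + (1::'m)"
proof -
  have "\<exists>q<\<tau> + 1. \<tau> = 2 * q \<or> \<tau> = 2 * q + 1"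
  proof (rule induct[where a = \<tau>])
    show "bdef \<Z> (\<lambda>e. \<exists>q<e 0 + 1. e 0 = 2 * q \<or> e 0 = 2 * q + 1)" by (intro bdef_rules)
    show "\<exists>q<0 + 1. 0 = 2 * q \<or> (0::'m) = 2 * q + 1" by (rule exI[of _ 0]) simp
    fix n assume "\<exists>q<n + 1. n = 2 * q \<or> n = 2 * q + (1::'m)"
    then obtain q where q: "q \<le> n" "n = 2 * q \<or> n = 2 * q + 1" by auto
    from q(2) show "\<exists>q<n + 1 + 1. n + 1 = 2 * q \<or> n + 1 = 2 * q + 1"
    proof
      assume "n = 2 * q"
      then show ?thesis using q(1) by (intro exI[of _ q]) (simp add: order_trans[OF _ pm_le_add(1)])
    next
      assume "n = 2 * q + 1"
      then have "n + 1 = 2 * (q + 1)" by (simp add: distrib_left add.assoc one_add_one)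
      moreover have "q + 1 < n + 1 + 1" using q(1) by simp
      ultimately show ?thesis by blast
    qed
  qed
  then show ?thesis by blast
qed

lemma initial_segment_half:
  assumes "0 < q" "\<tau> = 2 * q \<or> \<tau> = 2 * q + (1::'m)" shows "initial_segment q \<tau>"
proof (rule initial_segment_pow2[OF assms(1)])
  show "pow2 2" using pow2_double[OF pow2_one] by simp
  show "q * 2 \<le> \<tau>" using assms(2) by (auto simp: mult.commute)
  have "2 * q + 0 < 2 * q + 2" "2 * q + 1 < 2 * q + 1 + 1" unfolding pm_add_less_cancel by simp_all
  then show "\<tau> < q * 2 + 2" using assms(2) by (auto simp: mult.commute add.assoc one_add_one)
qed

text \<open>Last bits are deleted one by one: the half of a code that is at least 2 * m + 2 is still
  above m. The codes strictly between m and 2 * m + 2 thus serve as a level that every string beyond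
  m crosses.\<close>

lemma initial_segment_level:
  assumes "m < (\<tau> :: 'm)" "0 < m"
  shows "\<exists>\<sigma>. initial_segment \<sigma> \<tau> \<and> m < \<sigma> \<and> \<sigma> < 2 * m + 2"
proof -
  have "m < \<tau> \<longrightarrow> (\<exists>\<sigma><2 * m + 2. initial_segment \<sigma> \<tau> \<and> m < \<sigma>)"
  proof (rule induct_less[where a = \<tau>])
    show "bdef \<Z> (\<lambda>e. m < e 0 \<longrightarrow> (\<exists>\<sigma><2 * m + 2. initial_segment \<sigma> (e 0) \<and> m < \<sigma>))"
      by (intro bdef_initial_segment bdef_rules)
    fix \<tau> assume IH: "\<And>t. t < \<tau> \<Longrightarrow> m < t \<longrightarrow> (\<exists>\<sigma><2 * m + 2. initial_segment \<sigma> t \<and> m < \<sigma>)"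
    show "m < \<tau> \<longrightarrow> (\<exists>\<sigma><2 * m + 2. initial_segment \<sigma> \<tau> \<and> m < \<sigma>)"
    proof
      assume m: "m < \<tau>"
      show "\<exists>\<sigma><2 * m + 2. initial_segment \<sigma> \<tau> \<and> m < \<sigma>"
      proof (cases "\<tau> < 2 * m + 2")
        case True
        have "0 < \<tau>" using m by (meson nonneg order_le_less_trans)
        then show ?thesis using True m initial_segment_refl by blast
      next
        case False
        obtain q where q: "\<tau> = 2 * q \<or> \<tau> = 2 * q + 1" using parity by blast
        have "m < q"
        proof (rule ccontr)
          assume "\<not> m < q"
          then have "2 * q \<le> 2 * m" by (simp add: double_le_cancel)
          then have "2 * q + 1 \<le> 2 * m + 1" "2 * q \<le> 2 * m + 1"
            using order_trans[OF _ pm_le_add(1)] by auto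
          then have "\<tau> \<le> 2 * m + 1" using q by blast
          then have "\<tau> < 2 * m + 1 + 1" by simp
          then show False using False by (simp add: add.assoc one_add_one)
        qed
        then have "0 < q" by (meson nonneg order_le_less_trans)
        then have "q < 2 * q" by (rule less_double)
        moreover have "2 * q \<le> \<tau>" using q by auto
        ultimately have "q < \<tau>" by (rule order_less_le_trans)
        then obtain \<sigma> where "\<sigma><2 * m + 2" "initial_segment \<sigma> q" "m < \<sigma>" using IH \<open>m < q\<close> by blast
        then show ?thesis
          using initial_segment_half[OF \<open>0 < q\<close> q] initial_segment_trans by blast
      qed
    qed
  qed
  then show ?thesis using assms(1) by blast
qed

subsection \<open>Collection from exponentiation\<close>

text \<open>The digit at place i is 1 iff the remainder modulo 2^(i+1) reaches 2^i. The quantifier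
  bounds make this a bounded predicate; \<open>bit_iff\<close> removes them.\<close>

definition bit :: "'m \<Rightarrow> 'm \<Rightarrow> bool" where
  "bit c i \<longleftrightarrow> (\<exists>p<c + 1. \<exists>q<c + 1. \<exists>r<c + 1.
     exp_graph 2 i p \<and> p \<le> r \<and> r < 2 * p \<and> c = q * (2 * p) + r)"

lemma bit_iff:
  assumes "exp_graph 2 i p"
  shows "bit c i \<longleftrightarrow> (\<exists>q r. p \<le> r \<and> r < 2 * p \<and> c = q * (2 * p) + r)"
proof
  assume "bit c i"
  then obtain p' q r where "exp_graph 2 i p'" "p' \<le> r \<and> r < 2 * p' \<and> c = q * (2 * p') + r"
    unfolding bit_def by blast
  then show "\<exists>q r. p \<le> r \<and> r < 2 * p \<and> c = q * (2 * p) + r"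
    using exp_graph_unique assms by blast
next
  assume "\<exists>q r. p \<le> r \<and> r < 2 * p \<and> c = q * (2 * p) + r"
  then obtain q r where *: "p \<le> r" "r < 2 * p" "c = q * (2 * p) + r" by blast
  have "0 < p" using assms pow2_pos unfolding pow2_def by blast
  then have "q \<le> q * (2 * p)" using less_double by (intro pm_le_mult) (meson order_less_trans)
  then have "q \<le> c" using *(3) by (auto intro: order_trans)
  moreover have "r \<le> c" using *(3) by simp
  ultimately have "q < c + 1" "r < c + 1" "p < c + 1" using *(1) by simp_all
  then show "bit c i" unfolding bit_def using * assms by blast
qed

lemma bdef_bit:
  assumes "trm f" "trm g" shows "bdef \<Z> (\<lambda>e. bit (f e) (g e))"
  unfolding bit_def by (intro bdef_exp_graph bdef_rules trm_shift assms)

text \<open>Induction on the difference of the exponents. This is why adding 2^i leaves the digits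
  below i alone.\<close>

lemma exp_graph_less_divides:
  assumes "exp_graph 2 j w" "exp_graph 2 i p" "j < (i :: 'm)"
  shows "\<exists>s. p = s * (2 * w)"
proof -
  obtain k where k: "i = j + 1 + k" using assms(3) unfolding pm_less_iff le_iff_add by blast
  have "\<forall>p'<p + 1. exp_graph 2 (j + 1 + k) p' \<longrightarrow> (\<exists>s<p' + 1. p' = s * (2 * w))"
  proof (rule induct[where a = k])
    show "bdef \<Z> (\<lambda>e. \<forall>p'<p + 1. exp_graph 2 (j + 1 + e 0) p' \<longrightarrow> (\<exists>s<p' + 1. p' = s * (2 * w)))"
      by (intro bdef_exp_graph bdef_rules)
    show "\<forall>p'<p + 1. exp_graph 2 (j + 1 + 0) p' \<longrightarrow> (\<exists>s<p' + 1. p' = s * (2 * w))"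
    proof (intro allI impI)
      fix p' assume "exp_graph 2 (j + 1 + 0) p'"
      then obtain q where q: "exp_graph 2 j q" "p' = 2 * q" by (auto simp: exp_graph_Suc)
      then have "p' = 1 * (2 * w)" using exp_graph_unique[OF q(1) assms(1)] by simp
      moreover have "1 \<le> p'" using q exp_graph_less[of j q] less_double[of q]
        by (intro discrete_one) (metis nonneg order_le_less_trans order_less_trans)
      ultimately show "\<exists>s<p' + 1. p' = s * (2 * w)" by (intro exI[of _ 1]) simp
    qed
    fix k assume IH: "\<forall>p'<p + 1. exp_graph 2 (j + 1 + k) p' \<longrightarrow> (\<exists>s<p' + 1. p' = s * (2 * w))"
    show "\<forall>p'<p + 1. exp_graph 2 (j + 1 + (k + 1)) p' \<longrightarrow> (\<exists>s<p' + 1. p' = s * (2 * w))"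
    proof (intro allI impI)
      fix p' assume p': "p' < p + 1" "exp_graph 2 (j + 1 + (k + 1)) p'"
      then obtain q where q: "exp_graph 2 (j + 1 + k) q" "p' = 2 * q"
        using exp_graph_Suc[of "j + 1 + k"] by (auto simp: add.assoc)
      then have "q \<le> p'" by (simp add: mult_2)
      then have "q < p + 1" using p'(1) by simp
      then obtain s where s: "s \<le> q" "q = s * (2 * w)" using IH q(1) by auto
      have "2 * s \<le> p'" using s(1) q(2) double_le_cancel by simp
      moreover have "p' = 2 * s * (2 * w)" using s(2) q(2) by (simp add: mult.assoc)
      ultimately show "\<exists>s<p' + 1. p' = s * (2 * w)" by (intro exI[of _ "2 * s"]) simp
    qed
  qed
  then show ?thesis using assms(2) k by auto
qed

lemma bit_add_exp:
  assumes "exp_graph 2 i p" "j < (i :: 'm)"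
  shows "bit (c + p) j \<longleftrightarrow> bit c j"
proof -
  obtain w where w: "exp_graph 2 j w" using exp_graph_total by blast
  obtain s where s: "p = s * (2 * w)" using exp_graph_less_divides[OF w assms] by blast
  show ?thesis
    unfolding bit_iff[OF w]
  proof
    assume "\<exists>q r. w \<le> r \<and> r < 2 * w \<and> c + p = q * (2 * w) + r"
    then obtain q r where *: "w \<le> r" "r < 2 * w" "c + p = q * (2 * w) + r" by blast
    \<comment> \<open>Otherwise q * (2 * w) + 2 * w would be at most c + p, against r < 2 * w. So p
      can be cancelled as a multiple of 2 * w.\<close>
    have "s \<le> q"
    proof (rule ccontr)
      assume "\<not> s \<le> q"
      then have "q + 1 \<le> s" by (simp add: not_le pm_less_iff)
      then have "(q + 1) * (2 * w) \<le> s * (2 * w)" by (rule mult_right_mono) (rule nonneg)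
      then have "q * (2 * w) + 2 * w \<le> p" using s by (simp add: distrib_right)
      also have "\<dots> \<le> c + p" by simp
      finally show False using * by simp
    qed
    then obtain q' where "q = s + q'" using le_iff_add by blast
    then have "c + p = (q' * (2 * w) + r) + p" using *(3) s by (simp add: algebra_simps)
    then have "c = q' * (2 * w) + r" by simp
    then show "\<exists>q r. w \<le> r \<and> r < 2 * w \<and> c = q * (2 * w) + r" using * by blast
  next
    assume "\<exists>q r. w \<le> r \<and> r < 2 * w \<and> c = q * (2 * w) + r"
    then obtain q r where *: "w \<le> r" "r < 2 * w" "c = q * (2 * w) + r" by blast
    then have "c + p = (q + s) * (2 * w) + r" using s by (simp add: algebra_simps)
    then show "\<exists>q r. w \<le> r \<and> r < 2 * w \<and> c + p = q * (2 * w) + r" using * by blast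
  qed
qed

lemma bit_top:
  assumes "exp_graph 2 i p" "c < p"
  shows "bit (c + p) i" "\<not> bit c i"
proof -
  have "c + p < 2 * p" using assms(2) by (simp add: mult_2)
  then show "bit (c + p) i" unfolding bit_iff[OF assms(1)]
    by (intro exI[of _ 0] exI[of _ "c + p"]) simp
  show "\<not> bit c i"
  proof
    assume "bit c i"
    then obtain q r where "p \<le> r" "c = q * (2 * p) + r" unfolding bit_iff[OF assms(1)] by blast
    then have "p \<le> c" by (auto intro: order_trans)
    then show False using assms(2) by simp
  qed
qed

lemma less_double_cases:
  assumes "c < 2 * (p :: 'm)"
  shows "c < p \<or> (\<exists>d<p. c = d + p)"
proof (cases "c < p")
  case False
  then obtain d where d: "c = p + d" by (auto simp: not_less le_iff_add)
  then have "d < p" using assms by (simp add: mult_2)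
  moreover have "c = d + p" using d by (simp add: add.commute)
  ultimately show ?thesis by blast
qed simp

text \<open>Induction on b by the leading digit: it cannot drop from c to c', and if the two agree
  there the remaining digits decide. Restricting the powers to q <= p keeps the induction
  bounded.\<close>

lemma bits_mono:
  assumes "exp_graph 2 b p" "c < p" "c' < p" "\<And>i. i < b \<Longrightarrow> bit c i \<Longrightarrow> bit c' i"
  shows "c \<le> c'"
proof -
  let ?P = "\<lambda>b. \<forall>q<p + 1. exp_graph 2 b q \<longrightarrow> (\<forall>c<q. \<forall>c'<q. (\<forall>i<b. bit c i \<longrightarrow> bit c' i) \<longrightarrow> c \<le> c')"
  have "?P b"
  proof (rule induct[where a = b])
    show "bdef \<Z> (\<lambda>e. ?P (e 0))"
      by (intro bdef_exp_graph bdef_bit bdef_rules)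
    show "?P 0" using pm_less_add_one[of _ "0 :: 'm"] by simp
    fix b assume IH: "?P b"
    show "?P (b + 1)"
    proof (intro allI impI)
      fix q c c' assume q: "q < p + 1" "exp_graph 2 (b + 1) q" and c: "c < q" and c': "c' < q"
        and sub: "\<forall>i<b + 1. bit c i \<longrightarrow> bit c' i"
      obtain w where w: "exp_graph 2 b w" "q = 2 * w" using q(2) exp_graph_Suc by blast
      then have "w \<le> q" by (simp add: mult_2)
      then have IH': "\<lbrakk>c < w; c' < w; \<forall>i<b. bit c i \<longrightarrow> bit c' i\<rbrakk> \<Longrightarrow> c \<le> c'" for c c'
        using IH w(1) order_le_less_trans[OF _ q(1)] by blast
      have bit_b: "bit c b \<longrightarrow> bit c' b" using sub by simp
      have sub': "\<forall>i<b. bit c i \<longrightarrow> bit c' i" using sub by (simp add: order_less_imp_le)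
      consider "c < w" "c' < w" | d' where "c < w" "c' = d' + w"
        | d where "d < w" "c = d + w" "c' < w"
        | d d' where "d < w" "c = d + w" "d' < w" "c' = d' + w"
        using less_double_cases c c' w(2) by blast
      then show "c \<le> c'"
      proof cases
        case 1
        then show ?thesis using IH' sub' by blast
      next
        case 2
        then show ?thesis by (metis order_less_imp_le order_trans pm_le_add(2))
      next
        case 3
        then show ?thesis using bit_b bit_top w(1) by blast
      next
        case 4
        then have "\<forall>i<b. bit d i \<longrightarrow> bit d' i" using sub' bit_add_exp[OF w(1)] by blast
        then show ?thesis using 4 IH' by simp
      qed
    qed
  qed
  moreover have "p < p + 1" by simp
  ultimately show ?thesis using assms by blast
qed

text \<open>Digits are settled from below, each adding the current power of two or nothing. This is
  how exponentiation pays off: bounded predicates below b are coded by numbers below 2^b.\<close>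

lemma bits_exist:
  assumes "exp_graph 2 b p" "bdef \<Z> (\<lambda>e. W (e 0))"
  shows "\<exists>c<p. \<forall>i<b. bit c i \<longleftrightarrow> W i"
proof -
  let ?P = "\<lambda>b. \<forall>q<p + 1. exp_graph 2 b q \<longrightarrow> (\<exists>c<q. \<forall>i<b. bit c i \<longleftrightarrow> W i)"
  have "?P b"
  proof (rule induct[where a = b])
    show "bdef \<Z> (\<lambda>e. ?P (e 0))"
      by (intro bdef_exp_graph bdef_bit bdef_rules bdef_subst1[OF assms(2)])
    show "?P 0" by (auto intro: exI[of _ 0])
    fix b assume IH: "?P b"
    show "?P (b + 1)"
    proof (intro allI impI)
      fix q assume q: "q < p + 1" "exp_graph 2 (b + 1) q"
      obtain w where w: "exp_graph 2 b w" "q = 2 * w" using q(2) exp_graph_Suc by blast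
      then have "w \<le> q" by (simp add: mult_2)
      then obtain c where c: "c < w" "\<forall>i<b. bit c i \<longleftrightarrow> W i"
        using IH w(1) order_le_less_trans[OF _ q(1)] by blast
      show "\<exists>c<q. \<forall>i<b + 1. bit c i \<longleftrightarrow> W i"
      proof (cases "W b")
        case True
        have "\<forall>i<b + 1. bit (c + w) i \<longleftrightarrow> W i"
          using True c bit_add_exp[OF w(1)] bit_top[OF w(1)] by (auto simp: order_le_less)
        moreover have "c + w < q" using c w(2) by (simp add: mult_2)
        ultimately show ?thesis by blast
      next
        case False
        have "\<forall>i<b + 1. bit c i \<longleftrightarrow> W i"
          using False c bit_top[OF w(1)] by (auto simp: order_le_less)
        moreover have "c < q" using c \<open>w \<le> q\<close> by simp
        ultimately show ?thesis by blast
      qed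
    qed
  qed
  moreover have "p < p + 1" by simp
  ultimately show ?thesis using assms(1) by blast
qed

text \<open>The least upper bound of the elements below b is attained, since otherwise its
  predecessor would be an upper bound too. Maxima thus reduce to the least number principle.\<close>

lemma greatest_below:
  assumes "bdef \<Z> (\<lambda>e. P (e 0))" "P a" "a < b"
  shows "\<exists>c<b. P c \<and> (\<forall>d<b. c < d \<longrightarrow> \<not> P d)"
proof -
  let ?U = "\<lambda>c. \<forall>d<b. P d \<longrightarrow> d \<le> c"
  have "?U b" by auto
  moreover have "bdef \<Z> (\<lambda>e. ?U (e 0))" by (intro bdef_rules bdef_subst1[OF assms(1)])
  ultimately obtain c where c: "?U c" "\<forall>y<c. \<not> ?U y" using least[of ?U b] by blast
  have "\<exists>d<b. P d \<and> d = c"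
  proof (rule ccontr)
    assume no: "\<not> ?thesis"
    have lt: "d + 1 \<le> c" if "d < b" "P d" for d
    proof -
      have "d \<le> c" "d \<noteq> c" using c(1) no that by auto
      then show ?thesis by (simp flip: pm_less_iff)
    qed
    then have "a + 1 \<le> c" using assms by blast
    then have "1 \<le> c" by (rule order_trans[OF pm_le_add(2)])
    then obtain c' where c': "c = c' + 1" using le_iff_add add.commute by metis
    then have "?U c'" using lt by simp
    then show False using c(2) c' by simp
  qed
  then show ?thesis using c(1) leD by blast
qed

text \<open>
  Let \<open>y\<^sub>x\<close> be the least witness for \<open>x < b\<close>. The sets \<open>{x < b. y\<^sub>x \<le> y}\<close> have codes below \<open>2\<^sup>b\<close>, and
  the code grows with the set. The relation between \<open>x\<close> and the code for \<open>y = y\<^sub>x\<close> is \<open>\<Delta>\<^sub>1\<close>, so there is a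
  greatest such code, and the corresponding \<open>y\<^sub>x\<close> bounds all witnesses.
\<close>

lemma coll: "coll \<Z>"
  unfolding coll_def
proof (intro allI impI)
  fix Q :: "'m \<Rightarrow> 'm \<Rightarrow> bool" and b
  assume Q: "bdef \<Z> (\<lambda>e. Q (e 0) (e 1))" and ex: "\<forall>x<b. \<exists>y. Q y x"
  show "\<exists>c. \<forall>x<b. \<exists>y<c. Q y x"
  proof (cases "b = 0")
    case False
    define F where "F y x \<longleftrightarrow> Q y x \<and> (\<forall>y'<y. \<not> Q y' x)" for y x
    have bdef_Q: "bdef \<Z> (\<lambda>e. Q (f e) (g e))" if "trm f" "trm g" for f g
      using Q that by (rule bdef_subst2)
    have bdef_F: "bdef \<Z> (\<lambda>e. F (f e) (g e))" if "trm f" "trm g" for f g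
      unfolding F_def using that by (intro bdef_rules bdef_Q trm_shift)
    have F_ex: "\<exists>y. F y x" if "x < b" for x
      using least[of "\<lambda>y. Q y x"] ex that bdef_Q[OF trm_var[of 0] trm_const[of x]]
      unfolding F_def by blast
    have F_unique: "F y x \<Longrightarrow> F y' x \<Longrightarrow> y = y'" for y y' x
      unfolding F_def by (meson linorder_neqE)
    obtain p where p: "exp_graph 2 b p" using exp_graph_total by blast
    define C where "C c y \<longleftrightarrow> (\<forall>x<b. bit c x \<longleftrightarrow> (\<exists>y'<y + 1. Q y' x))" for c y
    have bdef_C: "bdef \<Z> (\<lambda>e. C (f e) (g e))" if "trm f" "trm g" for f g
      unfolding C_def using that by (intro bdef_rules bdef_bit bdef_Q trm_shift)
    have C_ex: "\<exists>c<p. C c y" for y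
      unfolding C_def by (rule bits_exist[OF p]) (intro bdef_rules bdef_Q)
    define H where "H x c \<longleftrightarrow> x < b \<and> (\<exists>y. F y x \<and> C c y)" for x c
    have bdef_H: "bdef \<Z> (\<lambda>e. H (f e) (g e))" if "trm f" "trm g" for f g
    proof (rule delta1_binary[OF _ _ _ _ that])
      show "bdef \<Z> (\<lambda>e. e 1 < b \<and> F (e 0) (e 1) \<and> C (e 2) (e 0))"
        by (intro bdef_rules bdef_F bdef_C)
      \<comment> \<open>The complement is \<Sigma>1 because each x < b has exactly one least
        witness, and a wrong code is refuted at that witness.\<close>
      show "bdef \<Z> (\<lambda>e. \<not> e 1 < b \<or> F (e 0) (e 1) \<and> \<not> C (e 2) (e 0))"
        by (intro bdef_rules bdef_F bdef_C)
      show "H x c \<longleftrightarrow> (\<exists>w. x < b \<and> F w x \<and> C c w)" for x c by (auto simp: H_def)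
      show "\<not> H x c \<longleftrightarrow> (\<exists>w. \<not> x < b \<or> F w x \<and> \<not> C c w)" for x c
        unfolding H_def using F_ex F_unique by metis
    qed
    have "0 < b" using False by (simp add: zero_less_iff_neq_zero)
    then obtain y0 where "F y0 0" using F_ex by blast
    moreover obtain c0 where "c0 < p" "C c0 y0" using C_ex by blast
    ultimately have "\<exists>x<b. H x c0" "c0 < p" using \<open>0 < b\<close> unfolding H_def by blast+
    moreover have "bdef \<Z> (\<lambda>e. \<exists>x<b. H x (e 0))" by (intro bdef_rules bdef_H)
    ultimately obtain c where c: "c < p" "\<exists>x<b. H x c" "\<forall>d<p. c < d \<longrightarrow> \<not> (\<exists>x<b. H x d)"
      using greatest_below[of "\<lambda>c. \<exists>x<b. H x c" c0 p] by blast
    then obtain x y where xy: "x < b" "F y x" "C c y" unfolding H_def by blast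
    have "\<exists>y'<y + 1. Q y' x'" if x': "x' < b" for x'
    proof (rule ccontr)
      assume no: "\<not> ?thesis"
      obtain y' where y': "F y' x'" using F_ex x' by blast
      then have "\<not> y' < y + 1" using no unfolding F_def by blast
      then have "y < y'" by (simp add: not_le)
      obtain c' where c': "c' < p" "C c' y'" using C_ex by blast
      have "bit c i \<longrightarrow> bit c' i" if "i < b" for i
        using that xy(3) c'(2) \<open>y < y'\<close> unfolding C_def
        by (meson order_le_less_trans order_less_imp_le pm_less_add_one)
      then have "c \<le> c'" using bits_mono[OF p c(1) c'(1)] by blast
      moreover have "bit c' x'" using c'(2) y' x' unfolding C_def F_def by auto
      moreover have "\<not> bit c x'" using no xy(3) x' unfolding C_def by blast
      \<comment> \<open>The coded sets differ at x', so c' is strictly greater and contradicts the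
        maximality of c.\<close>
      ultimately have "c < c'" by (auto simp: order_le_less)
      then show False using c(3) c' y' x' unfolding H_def by blast
    qed
    then show ?thesis by blast
  qed simp
qed

end

subsection \<open>\<open>\<Delta>\<^sub>1\<close> closure\<close>

text \<open>Both polarities are carried through the induction, so that negation only swaps them.
  Collection enters at bounded universal quantifiers, which also arise from negated existential
  ones.\<close>

lemma sig_sat_Delta1:
  assumes "coll \<S>" "delta00 \<theta>" "range E \<subseteq> Delta1 \<S>"
  shows "sig \<S> (\<lambda>e. sat \<X> e E \<theta>) \<and> sig \<S> (\<lambda>e. \<not> sat \<X> e E \<theta>)"
  using assms(2)
proof (induction \<theta>)
  case (Eq s t)
  then show ?case by (auto intro!: bdef_sig bdef_not bdef_eq trm_val)
next
  case (Lt s t)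
  then show ?case by (auto intro!: bdef_sig bdef_not bdef_less trm_val)
next
  case (Mem t n)
  have "E n \<in> Delta1 \<S>" using assms(3) by blast
  then have "sig \<S> (\<lambda>e. e 0 \<in> E n)" "sig \<S> (\<lambda>e. e 0 \<notin> E n)" by (simp_all add: Delta1_def)
  then show ?case
    using sig_subst[of \<S> _ "\<lambda>_ e. val e t"] trm_val by fastforce
next
  case (Neg \<theta>)
  then show ?case by simp
next
  case (Conj \<theta> \<theta>')
  then have *: "sig \<S> (\<lambda>e. sat \<X> e E \<theta>)" "sig \<S> (\<lambda>e. \<not> sat \<X> e E \<theta>)"
    "sig \<S> (\<lambda>e. sat \<X> e E \<theta>')" "sig \<S> (\<lambda>e. \<not> sat \<X> e E \<theta>')" by simp_all
  show ?case unfolding sat.simps de_Morgan_conj by (intro conjI sig_conj sig_disj *)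
next
  case (Disj \<theta> \<theta>')
  then have *: "sig \<S> (\<lambda>e. sat \<X> e E \<theta>)" "sig \<S> (\<lambda>e. \<not> sat \<X> e E \<theta>)"
    "sig \<S> (\<lambda>e. sat \<X> e E \<theta>')" "sig \<S> (\<lambda>e. \<not> sat \<X> e E \<theta>')" by simp_all
  show ?case unfolding sat.simps de_Morgan_disj by (intro conjI sig_conj sig_disj *)
next
  case (BForall t \<theta>)
  then have *: "sig \<S> (\<lambda>e. sat \<X> (case_nat (e 0) (\<lambda>n. e (Suc n))) E \<theta>)"
    "sig \<S> (\<lambda>e. \<not> sat \<X> (case_nat (e 0) (\<lambda>n. e (Suc n))) E \<theta>)" by simp_all
  have "sig \<S> (\<lambda>e. \<forall>x<val e t. sat \<X> (case_nat x e) E \<theta>)"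
    by (rule sig_ball[OF assms(1) _ trm_val]) (rule *)
  moreover have "sig \<S> (\<lambda>e. \<exists>x<val e t. \<not> sat \<X> (case_nat x e) E \<theta>)"
    by (rule sig_bex[OF _ trm_val]) (rule *)
  ultimately show ?case by simp
next
  case (BExists t \<theta>)
  then have *: "sig \<S> (\<lambda>e. sat \<X> (case_nat (e 0) (\<lambda>n. e (Suc n))) E \<theta>)"
    "sig \<S> (\<lambda>e. \<not> sat \<X> (case_nat (e 0) (\<lambda>n. e (Suc n))) E \<theta>)" by simp_all
  have "sig \<S> (\<lambda>e. \<exists>x<val e t. sat \<X> (case_nat x e) E \<theta>)"
    by (rule sig_bex[OF _ trm_val]) (rule *)
  moreover have "sig \<S> (\<lambda>e. \<forall>x<val e t. \<not> sat \<X> (case_nat x e) E \<theta>)"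
    by (rule sig_ball[OF assms(1) _ trm_val]) (rule *)
  ultimately show ?case by simp
qed simp_all

text \<open>Collection finds one v below which every x up to a has a witness for the statement or
  for its negation. Searching below v therefore decides the statement, and induction is applied to
  this bounded search.\<close>

lemma delta00_induction_Delta1:
  assumes "ind \<S>" "coll \<S>"
  shows "delta00_induction (Delta1 \<S>)"
  unfolding delta00_induction_def
proof (intro allI impI)
  fix \<theta> e E and a :: 'a
  let ?P = "\<lambda>x. sat (Delta1 \<S>) (case_nat x e) E \<theta>"
  assume \<theta>: "delta00 \<theta>" "range E \<subseteq> Delta1 \<S>" and 0: "?P 0" and step: "\<forall>x. ?P x \<longrightarrow> ?P (x + 1)"
  have "sig \<S> (\<lambda>e'. ?P (e' 0))" "sig \<S> (\<lambda>e'. \<not> ?P (e' 0))"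
    using sig_subst_env[OF conjunct1[OF sig_sat_Delta1[OF assms(2) \<theta>]] trm_var]
      sig_subst_env[OF conjunct2[OF sig_sat_Delta1[OF assms(2) \<theta>]] trm_var] by blast+
  then obtain Q Q' where Q: "bdef \<S> (\<lambda>e. Q (e 0) (e 1))" "\<forall>x. ?P x \<longleftrightarrow> (\<exists>y. Q y x)"
    and Q': "bdef \<S> (\<lambda>e. Q' (e 0) (e 1))" "\<forall>x. \<not> ?P x \<longleftrightarrow> (\<exists>y. Q' y x)"
    using sig_syntactic[of \<S> ?P] sig_syntactic[of \<S> "\<lambda>x. \<not> ?P x"] by blast
  have "\<forall>x<a + 1. \<exists>y. Q y x \<or> Q' y x" using Q(2) Q'(2) by blast
  moreover have "bdef \<S> (\<lambda>e. Q (e 0) (e 1) \<or> Q' (e 0) (e 1))"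
    by (intro bdef_disj Q Q')
  ultimately obtain v where v: "\<forall>x<a + 1. \<exists>y<v. Q y x \<or> Q' y x"
    using assms(2)[unfolded coll_def, rule_format, of "\<lambda>y x. Q y x \<or> Q' y x"] by blast
  have iff: "?P x \<longleftrightarrow> (\<exists>y<v. Q y x)" if "x < a + 1" for x
    using v that Q(2) Q'(2) by blast
  have "a < a + 1 \<longrightarrow> (\<exists>y<v. Q y a)"
  proof (rule ind_rule[OF assms(1), of "\<lambda>x. x < a + 1 \<longrightarrow> (\<exists>y<v. Q y x)"])
    show "bdef \<S> (\<lambda>e. e 0 < a + 1 \<longrightarrow> (\<exists>y<v. Q y (e 0)))"
      by (intro bdef_rules bdef_subst2[OF Q(1)])
    show "0 < a + 1 \<longrightarrow> (\<exists>y<v. Q y 0)" using iff 0 by blast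
    fix x assume IH: "x < a + 1 \<longrightarrow> (\<exists>y<v. Q y x)"
    show "x + 1 < a + 1 \<longrightarrow> (\<exists>y<v. Q y (x + 1))"
    proof
      assume less: "x + 1 < a + 1"
      then have "x < a + 1" by (rule order_le_less_trans[OF pm_le_add(1)])
      then have "?P x" using IH iff by blast
      then have "?P (x + 1)" using step by blast
      then show "\<exists>y<v. Q y (x + 1)" using iff less by blast
    qed
  qed
  then show "?P a" using iff by simp
qed

text \<open>A \<Sigma>1 formula over \<open>Delta1 \<S>\<close> is already \<Sigma>1 over \<S>,
  because its matrix is so by \<open>sig_sat_Delta1\<close>.\<close>

lemma delta01_comprehension_Delta1:
  assumes "coll \<S>"
  shows "delta01_comprehension (Delta1 \<S>)"
  unfolding delta01_comprehension_def
proof (intro allI impI)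
  fix \<phi> \<psi> e and E :: "nat \<Rightarrow> 'a set"
  assume "sigma01 \<phi>" "pi01 \<psi>" and E: "range E \<subseteq> Delta1 \<S>"
    and eq: "\<forall>x. sat (Delta1 \<S>) (case_nat x e) E \<phi> \<longleftrightarrow> sat (Delta1 \<S>) (case_nat x e) E \<psi>"
  then obtain \<theta> \<theta>' where \<theta>: "delta00 \<theta>" "\<phi> = Exists \<theta>" "delta00 \<theta>'" "\<psi> = Forall \<theta>'"
    by (auto simp: sigma01_def pi01_def)
  let ?P = "\<lambda>x. sat (Delta1 \<S>) (case_nat x e) E \<phi>"
  have "sig \<S> (\<lambda>e. \<exists>x. sat (Delta1 \<S>) (case_nat x e) E \<theta>)"
    "sig \<S> (\<lambda>e. \<exists>x. \<not> sat (Delta1 \<S>) (case_nat x e) E \<theta>')"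
    using sig_ex'[OF conjunct1[OF sig_sat_Delta1[OF assms \<theta>(1) E]]]
      sig_ex'[OF conjunct2[OF sig_sat_Delta1[OF assms \<theta>(3) E]]] by blast+
  from this[THEN sig_subst_env, OF trm_var, of 0 e]
  have 1: "sig \<S> (\<lambda>e'. \<exists>x. sat (Delta1 \<S>) (case_nat x (case_nat (e' 0) e)) E \<theta>)"
    and 2: "sig \<S> (\<lambda>e'. \<exists>x. \<not> sat (Delta1 \<S>) (case_nat x (case_nat (e' 0) e)) E \<theta>')"
    by simp_all
  have "?P x \<longleftrightarrow> (\<exists>y. sat (Delta1 \<S>) (case_nat y (case_nat x e)) E \<theta>)" for x
    by (simp add: \<theta>)
  moreover have "\<not> ?P x \<longleftrightarrow> (\<exists>y. \<not> sat (Delta1 \<S>) (case_nat y (case_nat x e)) E \<theta>')" for x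
    unfolding eq[rule_format] by (simp add: \<theta>)
  ultimately have "sig \<S> (\<lambda>e'. ?P (e' 0))" "sig \<S> (\<lambda>e'. \<not> ?P (e' 0))"
    using 1 2 by simp_all
  then have "{x. ?P x} \<in> Delta1 \<S>" by (simp add: Delta1_def)
  then show "\<exists>S\<in>Delta1 \<S>. \<forall>x. x \<in> S \<longleftrightarrow> ?P x" by (intro bexI[of _ "{x. ?P x}"]) simp_all
qed

lemma RCA0_star_Delta1:
  fixes \<S> :: "'m::peano_minus set set"
  assumes "\<S> \<noteq> {}" "ind \<S>" "coll \<S>" "exp_total TYPE('m)"
  shows "RCA0_star (Delta1 \<S>)"
  unfolding RCA0_star_def
  using assms subset_Delta1[of \<S>] delta00_induction_Delta1 delta01_comprehension_Delta1 by auto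

lemma ind_mono: "ind \<T> \<Longrightarrow> \<S> \<subseteq> \<T> \<Longrightarrow> ind \<S>"
  unfolding ind_def using bdef_mono by blast

text \<open>Collection is derived for models, but the starting point {A} is only a set of
  parameters; it inherits the principle from \<X>.\<close>

lemma coll_mono:
  assumes "coll \<T>" "\<S> \<subseteq> \<T>" shows "coll \<S>"
  unfolding coll_def
proof (intro allI impI)
  fix Q :: "'a \<Rightarrow> 'a \<Rightarrow> bool" and b
  assume Q: "bdef \<S> (\<lambda>e. Q (e 0) (e 1))" "\<forall>x<b. \<exists>y. Q y x"
  have "bdef \<T> (\<lambda>e. Q (e 0) (e 1))" using Q(1) assms(2) by (rule bdef_mono)
  then show "\<exists>c. \<forall>x<b. \<exists>y<c. Q y x" using assms(1) Q(2) unfolding coll_def by blast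
qed

subsection \<open>Forcing with unbounded trees\<close>

lemma binary_treeD: "binary_tree S \<Longrightarrow> \<tau> \<in> S \<Longrightarrow> initial_segment \<sigma> \<tau> \<Longrightarrow> \<sigma> \<in> S"
  unfolding binary_tree_def by blast

lemma unboundedD: "\<not> bdd_above T \<Longrightarrow> \<exists>\<tau>\<in>T. n < (\<tau>::'m::linorder)"
  unfolding bdd_above_def by (meson not_less)

context rca
begin

lemma Collect_mem:
  assumes "bdef \<Z> (\<lambda>e. P (e 0))"
  shows "{x. P x} \<in> \<Z>"
  by (rule RCA0_star_comprehension[OF RCA, of "\<lambda>y x. P x" "\<lambda>y x. \<not> P x"])
    (use bdef_subst1[OF assms trm_var[of 1]] in \<open>simp_all add: bdef_not\<close>)

lemma level_bound:
  assumes "binary_tree S" "0 < (m :: 'm)" "\<forall>\<sigma><2 * m + 2. m < \<sigma> \<longrightarrow> \<sigma> \<notin> S" "\<tau> \<in> S"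
  shows "\<tau> \<le> m"
proof (rule ccontr)
  assume "\<not> \<tau> \<le> m"
  then obtain \<sigma> where "initial_segment \<sigma> \<tau>" "m < \<sigma>" "\<sigma> < 2 * m + 2"
    using initial_segment_level assms(2) by (meson not_le)
  then show False using assms binary_treeD by blast
qed

text \<open>
  Since every node above \<open>m + 1\<close> has an initial segment in the interval from \<open>m + 2\<close> to \<open>2 (m + 1) + 1\<close>, a tree
  that omits this interval has no node above \<open>m + 1\<close>.
\<close>

definition bound :: "'m set \<Rightarrow> 'm \<Rightarrow> bool" where
  "bound S m \<longleftrightarrow> (\<forall>\<sigma><2 * (m + 1) + 2. m + 1 < \<sigma> \<longrightarrow> \<sigma> \<notin> S)"

lemma boundD:
  assumes "binary_tree S" "bound S m" "\<tau> \<in> S"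
  shows "\<tau> \<le> m + 1"
  \<comment> \<open>Working above m + 1 instead of m provides the positive bound that
    \<open>level_bound\<close> asks for.\<close>
  by (rule level_bound[OF assms(1) _ _ assms(3)])
    (use assms(2) in \<open>simp_all add: bound_def zero_less_iff_neq_zero\<close>)

lemma bdd_above_iff:
  assumes "binary_tree S" shows "bdd_above S \<longleftrightarrow> (\<exists>m. bound S m)"
proof
  assume "bdd_above S"
  then obtain m where m: "\<And>\<sigma>. \<sigma> \<in> S \<Longrightarrow> \<sigma> \<le> m" unfolding bdd_above_def by blast
  have "\<sigma> \<notin> S" if "m + 1 < \<sigma>" for \<sigma>
  proof
    assume "\<sigma> \<in> S"
    then have "\<sigma> \<le> m + 1" by (rule order_trans[OF m pm_le_add(1)])
    then show False using that by simp
  qed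
  then show "\<exists>m. bound S m" unfolding bound_def by blast
next
  assume "\<exists>m. bound S m"
  then obtain m where "bound S m" by blast
  then show "bdd_above S" using boundD[OF assms] by (intro bdd_aboveI[of _ "m + 1"])
qed

lemma bdef_bound:
  assumes "\<And>f g. trm f \<Longrightarrow> trm g \<Longrightarrow> bdef \<Z> (\<lambda>e. f e \<in> S (g e))" "trm f" "trm g"
  shows "bdef \<Z> (\<lambda>e. bound (S (f e)) (g e))"
  unfolding bound_def by (intro bdef_rules assms trm_shift)

text \<open>Collection is applied to the omitted level: \<open>bound\<close> is a bounded predicate,
  whereas boundedness proper quantifies over the whole tree.\<close>

lemma tree_collection:
  assumes S: "\<And>f g. trm f \<Longrightarrow> trm g \<Longrightarrow> bdef \<Z> (\<lambda>e. f e \<in> S (g e))"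
    and "\<And>x. binary_tree (S x)" "\<And>x. x < b \<Longrightarrow> bdd_above (S x)"
  shows "\<exists>m. \<forall>x<b. \<forall>\<sigma>\<in>S x. \<sigma> \<le> m"
proof -
  have "bdef \<Z> (\<lambda>e. bound (S (e 1)) (e 0))" by (intro bdef_bound S trm_var)
  moreover have "\<forall>x<b. \<exists>m. bound (S x) m" using assms(2,3) bdd_above_iff by blast
  ultimately obtain c where c: "\<forall>x<b. \<exists>m<c. bound (S x) m"
    using coll[unfolded coll_def, rule_format, of "\<lambda>m x. bound (S x) m" b] by blast
  have "\<sigma> \<le> c" if x: "x < b" "\<sigma> \<in> S x" for x \<sigma>
  proof -
    obtain m where m: "m < c" "bound (S x) m" using c x by blast
    then have "\<sigma> \<le> m + 1" using boundD assms(2) x by blast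
    then show ?thesis using m(1) by (simp add: pm_less_iff)
  qed
  then show ?thesis by blast
qed

definition condition :: "'m set \<Rightarrow> bool" where
  "condition T \<longleftrightarrow> T \<in> \<Z> \<and> binary_tree T \<and> \<not> bdd_above T"

text \<open>
  \<open>W \<sigma> x\<close> is to be read as: the finite string \<open>\<sigma>\<close> already witnesses a given \<open>\<Sigma>\<^sup>0\<^sub>1\<close> statement about \<open>x\<close> and the
  generic path.
\<close>

definition prefix_monotone :: "('m \<Rightarrow> 'm \<Rightarrow> bool) \<Rightarrow> bool" where
  "prefix_monotone W \<longleftrightarrow> bdef \<Z> (\<lambda>e. W (e 0) (e 1)) \<and>
     (\<forall>\<sigma> \<tau> x. initial_segment \<sigma> \<tau> \<longrightarrow> W \<sigma> x \<longrightarrow> W \<tau> x)"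

definition avoid :: "('m \<Rightarrow> 'm \<Rightarrow> bool) \<Rightarrow> 'm set \<Rightarrow> 'm \<Rightarrow> 'm set" where
  "avoid W T x = {\<sigma> \<in> T. \<not> W \<sigma> x}"

lemma binary_tree_avoid:
  assumes "binary_tree T" "prefix_monotone W" shows "binary_tree (avoid W T x)"
  using assms unfolding binary_tree_def prefix_monotone_def avoid_def by blast

lemma bdef_avoid:
  assumes "T \<in> \<Z>" "prefix_monotone W" "trm f" "trm g"
  shows "bdef \<Z> (\<lambda>e. f e \<in> avoid W T (g e))"
proof -
  have "bdef \<Z> (\<lambda>e. W (f e) (g e))"
    using bdef_subst2[of \<Z> W f g] assms by (simp add: prefix_monotone_def)
  then show ?thesis
    unfolding avoid_def mem_Collect_eq by (intro bdef_conj bdef_not bdef_mem assms)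
qed

lemma condition_avoid:
  assumes "condition T" "prefix_monotone W" "\<not> bdd_above (avoid W T x)"
  shows "condition (avoid W T x)"
proof -
  have "bdef \<Z> (\<lambda>e. e 0 \<in> avoid W T x)"
    using assms by (intro bdef_avoid trm_var trm_const) (simp_all add: condition_def)
  then have "avoid W T x \<in> \<Z>" using Collect_mem[of "\<lambda>\<sigma>. \<sigma> \<in> avoid W T x"] by simp
  then show ?thesis using assms binary_tree_avoid by (simp add: condition_def)
qed

lemma avoid_subset: "avoid W T x \<subseteq> T"
  by (auto simp: avoid_def)

text \<open>The nodes comparable with \<sigma> form a subtree. If these subtrees were bounded for
  all \<sigma> of one level, they would have a common bound by collection, contradicting a node of T
  beyond it.\<close>

lemma extend_decide:
  assumes T: "condition T"
  shows "\<exists>T'\<subseteq>T. condition T' \<and>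
    (\<exists>\<sigma>>n. \<forall>\<tau>\<in>T'. initial_segment \<sigma> \<tau> \<or> initial_segment \<tau> \<sigma>)"
proof -
  \<comment> \<open>Positive, as \<open>initial_segment_level\<close> demands, and not below
    n.\<close>
  define k where "k = n + 1"
  \<comment> \<open>With k < \<sigma> inside the definition the tree is empty for small \<sigma>, so
    an unbounded one must belong to a \<sigma> beyond k.\<close>
  define S where "S \<sigma> = {\<tau> \<in> T. k < \<sigma> \<and> (initial_segment \<sigma> \<tau> \<or> initial_segment \<tau> \<sigma>)}" for \<sigma>
  have T': "T \<in> \<Z>" "binary_tree T" "\<not> bdd_above T" using T by (auto simp: condition_def)
  have bdef_S: "bdef \<Z> (\<lambda>e. f e \<in> S (g e))" if "trm f" "trm g" for f g
    unfolding S_def mem_Collect_eq by (intro bdef_mem bdef_initial_segment bdef_rules T' that)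
  have tree: "binary_tree (S \<sigma>)" for \<sigma>
    unfolding binary_tree_def
  proof (intro conjI ballI allI impI)
    show "0 < \<tau>" if "\<tau> \<in> S \<sigma>" for \<tau>
      using that T'(2) by (auto simp: S_def binary_tree_def)
    fix \<tau> \<rho> assume *: "\<tau> \<in> S \<sigma>" "initial_segment \<rho> \<tau>"
    then have "\<rho> \<in> T" using T'(2) binary_treeD by (auto simp: S_def)
    moreover have "initial_segment \<sigma> \<rho> \<or> initial_segment \<rho> \<sigma>"
      using * initial_segment_comparable[of \<rho> \<tau> \<sigma>] initial_segment_trans[of \<rho> \<tau> \<sigma>]
      by (auto simp: S_def)
    ultimately show "\<rho> \<in> S \<sigma>" using * by (simp add: S_def)
  qed
  have "\<exists>\<sigma><2 * k + 2. \<not> bdd_above (S \<sigma>)"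
  proof (rule ccontr)
    assume "\<not> ?thesis"
    then have "bdd_above (S \<sigma>)" if "\<sigma> < 2 * k + 2" for \<sigma> using that by auto
    with bdef_S tree have "\<exists>m. \<forall>\<sigma><2 * k + 2. \<forall>\<tau>\<in>S \<sigma>. \<tau> \<le> m"
      by (rule tree_collection)
    then obtain m where m: "\<forall>\<sigma><2 * k + 2. \<forall>\<tau>\<in>S \<sigma>. \<tau> \<le> m" by blast
    obtain \<tau> where \<tau>: "\<tau> \<in> T" "m + k < \<tau>" using unboundedD[OF T'(3)] by blast
    have "k < \<tau>" using \<tau>(2) by (rule order_le_less_trans[OF pm_le_add(2)])
    moreover have "0 < k" by (simp add: k_def zero_less_iff_neq_zero)
    ultimately obtain \<sigma> where "initial_segment \<sigma> \<tau>" "k < \<sigma>" "\<sigma> < 2 * k + 2"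
      using initial_segment_level by blast
    then have "\<tau> \<le> m" using m \<tau>(1) by (simp add: S_def)
    then have "\<tau> \<le> m + k" by (rule order_trans) simp
    then show False using \<tau>(2) by simp
  qed
  then obtain \<sigma> where \<sigma>: "\<not> bdd_above (S \<sigma>)" by auto
  then obtain \<tau> where "\<tau> \<in> S \<sigma>" using unboundedD by fast
  then have "k < \<sigma>" by (simp add: S_def)
  then have "n < \<sigma>" unfolding k_def by (rule order_le_less_trans[OF pm_le_add(1)])
  moreover have "S \<sigma> \<in> \<Z>"
    using Collect_mem[of "\<lambda>\<tau>. \<tau> \<in> S \<sigma>", OF bdef_S[OF trm_var trm_const]] by simp
  then have "condition (S \<sigma>)" using tree \<sigma> by (simp add: condition_def)
  moreover have "S \<sigma> \<subseteq> T" "\<forall>\<tau>\<in>S \<sigma>. initial_segment \<sigma> \<tau> \<or> initial_segment \<tau> \<sigma>"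
    by (auto simp: S_def)
  ultimately show ?thesis by blast
qed

lemma extend_collect:
  assumes T: "condition T" and W: "prefix_monotone W"
  shows "\<exists>T'\<subseteq>T. condition T' \<and>
    ((\<exists>x<b. \<forall>\<sigma>\<in>T'. \<not> W \<sigma> x) \<or> (\<exists>m. \<forall>\<sigma>\<in>T'. m < \<sigma> \<longrightarrow> (\<forall>x<b. W \<sigma> x)))"
proof (cases "\<exists>x<b. \<not> bdd_above (avoid W T x)")
  case True
  then obtain x where "x < b" "\<not> bdd_above (avoid W T x)" by auto
  then show ?thesis
    using condition_avoid[OF T W] avoid_subset
    by (intro exI[of _ "avoid W T x"]) (auto simp: avoid_def)
next
  case False
  have T': "T \<in> \<Z>" "binary_tree T" using T by (auto simp: condition_def)
  have "bdd_above (avoid W T x)" if "x < b" for x using False that by auto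
  with bdef_avoid[OF T'(1) W] binary_tree_avoid[OF T'(2) W]
  have "\<exists>m. \<forall>x<b. \<forall>\<sigma>\<in>avoid W T x. \<sigma> \<le> m"
    by (rule tree_collection)
  then obtain m where "\<forall>x<b. \<forall>\<sigma>\<in>avoid W T x. \<sigma> \<le> m" by blast
  then have "\<forall>\<sigma>\<in>T. m < \<sigma> \<longrightarrow> (\<forall>x<b. W \<sigma> x)" by (auto simp: avoid_def not_less[symmetric])
  then show ?thesis using T by blast
qed

lemma extend_differ:
  assumes T: "condition T" and W: "prefix_monotone W" "prefix_monotone W'" and C: "C \<notin> \<Z>"
  shows "\<exists>T'\<subseteq>T. condition T' \<and>
    ((\<exists>x\<in>C. \<forall>\<sigma>\<in>T'. \<not> W \<sigma> x) \<or> (\<exists>x. x \<notin> C \<and> (\<forall>\<sigma>\<in>T'. \<not> W' \<sigma> x)) \<or>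
     (\<exists>x m. \<forall>\<sigma>\<in>T'. m < \<sigma> \<longrightarrow> W \<sigma> x \<and> W' \<sigma> x))"
proof -
  have T': "T \<in> \<Z>" "binary_tree T" using T by (auto simp: condition_def)
  \<comment> \<open>If no x falls under the first three cases, exactly one of the two subtrees is
    bounded for each x, and it is the one prescribed by C. In the third case all large nodes witness
    both membership and non-membership.\<close>
  consider x where "x \<in> C" "\<not> bdd_above (avoid W T x)"
    | x where "x \<notin> C" "\<not> bdd_above (avoid W' T x)"
    | x where "bdd_above (avoid W T x)" "bdd_above (avoid W' T x)"
    | "\<And>x. x \<in> C \<longleftrightarrow> bdd_above (avoid W T x)" "\<And>x. x \<notin> C \<longleftrightarrow> bdd_above (avoid W' T x)"
    by metis
  then show ?thesis
  proof cases
    case 1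
    then show ?thesis
      using condition_avoid[OF T W(1)] avoid_subset
      by (intro exI[of _ "avoid W T x"]) (auto simp: avoid_def)
  next
    case 2
    then show ?thesis
      using condition_avoid[OF T W(2)] avoid_subset
      by (intro exI[of _ "avoid W' T x"]) (auto simp: avoid_def)
  next
    case 3
    then obtain m m' where "\<forall>\<sigma>\<in>avoid W T x. \<sigma> \<le> m" "\<forall>\<sigma>\<in>avoid W' T x. \<sigma> \<le> m'"
      unfolding bdd_above_def by blast
    then have "\<forall>\<sigma>\<in>T. max m m' < \<sigma> \<longrightarrow> W \<sigma> x \<and> W' \<sigma> x"
      by (auto simp: avoid_def not_less[symmetric])
    then show ?thesis using T by blast
  next
    case 4
    have "C \<in> \<Z>"
    proof (rule RCA0_star_comprehension[OF RCA])
      show "bdef \<Z> (\<lambda>e. bound (avoid W T (e 1)) (e 0))" "bdef \<Z> (\<lambda>e. bound (avoid W' T (e 1)) (e 0))"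
        by (intro bdef_bound bdef_avoid T' W trm_var; assumption)+
      show "x \<in> C \<longleftrightarrow> (\<exists>m. bound (avoid W T x) m)" "x \<notin> C \<longleftrightarrow> (\<exists>m. bound (avoid W' T x) m)" for x
        using 4 bdd_above_iff binary_tree_avoid[OF T'(2)] W by simp_all
    qed
    then show ?thesis using C by blast
  qed
qed

text \<open>The Rasiowa-Sikorski construction: dependent choice along an enumeration of the
  requirements. The empty R is exempted because \<open>from_nat_into\<close> then enumerates
  nothing.\<close>

lemma generic_sequence:
  assumes T: "condition T" and R: "countable R"
    and dense: "\<And>r T. r \<in> R \<Longrightarrow> condition T \<Longrightarrow> \<exists>T'\<subseteq>T. condition T' \<and> r T'"
  shows "\<exists>F. F 0 = T \<and> (\<forall>k. condition (F k)) \<and> (\<forall>j k. j \<le> k \<longrightarrow> F k \<subseteq> F j) \<and>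
    (\<forall>r\<in>R. \<exists>k. r (F (k::nat)))"
proof -
  let ?r = "from_nat_into R"
  have "\<exists>F. \<forall>n. (condition (F n) \<and> (n = 0 \<longrightarrow> F n = T)) \<and>
      (F (Suc n) \<subseteq> F n \<and> (R \<noteq> {} \<longrightarrow> ?r n (F (Suc n))))"
  proof (rule dependent_nat_choice)
    show "\<exists>X. condition X \<and> (0 = (0::nat) \<longrightarrow> X = T)" using T by blast
    fix X and n :: nat assume X: "condition X \<and> (n = 0 \<longrightarrow> X = T)"
    show "\<exists>X'. (condition X' \<and> (Suc n = 0 \<longrightarrow> X' = T)) \<and> X' \<subseteq> X \<and> (R \<noteq> {} \<longrightarrow> ?r n X')"
      using X dense[of "?r n" X] from_nat_into[of R n] by (cases "R = {}") auto
  qed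
  then obtain F where *: "\<forall>n. (condition (F n) \<and> (n = 0 \<longrightarrow> F n = T)) \<and>
      (F (Suc n) \<subseteq> F n \<and> (R \<noteq> {} \<longrightarrow> ?r n (F (Suc n))))" by (elim exE)
  then have F: "condition (F n)" "F 0 = T" "F (Suc n) \<subseteq> F n" "R \<noteq> {} \<Longrightarrow> ?r n (F (Suc n))" for n
    by simp_all
  have "\<exists>k. r (F k)" if "r \<in> R" for r
    using F(4)[of "to_nat_on R r"] that R from_nat_into_to_nat_on[OF R that] by auto
  moreover have "F k \<subseteq> F j" if "j \<le> k" for j k using lift_Suc_antimono_le[of F, OF F(3) that] .
  ultimately show ?thesis using F(1,2) by (intro exI[of _ F]) simp
qed

definition unbounded_path :: "'m set \<Rightarrow> bool" where
  "unbounded_path G \<longleftrightarrow> binary_tree G \<and> \<not> bdd_above G \<and>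
     (\<forall>\<sigma>\<in>G. \<forall>\<tau>\<in>G. initial_segment \<sigma> \<tau> \<or> initial_segment \<tau> \<sigma>)"

lemma sequence_path:
  assumes F: "\<And>k. condition (F k)" "\<And>j k. j \<le> k \<Longrightarrow> F k \<subseteq> F (j::nat)"
    and decide: "\<And>n. \<exists>k. \<exists>\<sigma>>n. \<forall>\<tau>\<in>F k. initial_segment \<sigma> \<tau> \<or> initial_segment \<tau> \<sigma>"
  shows "\<exists>G. unbounded_path G \<and> (\<forall>k. G \<subseteq> F k)"
proof -
  \<comment> \<open>A string enters G once all large nodes of some F k extend it. Any two members of
    G then have a common extension in every F l, which puts G inside each F k and makes its members
    comparable.\<close>
  define G where "G = {\<tau>. \<exists>k m. \<forall>\<sigma>\<in>F k. m < \<sigma> \<longrightarrow> initial_segment \<tau> \<sigma>}"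
  have F': "binary_tree (F k)" "\<not> bdd_above (F k)" for k using F(1) by (auto simp: condition_def)
  have common: "\<exists>\<rho>\<in>F l. initial_segment \<sigma> \<rho> \<and> initial_segment \<tau> \<rho>"
    if G: "\<sigma> \<in> G" "\<tau> \<in> G" for \<sigma> \<tau> l
  proof -
    obtain j m where j: "\<forall>\<rho>\<in>F j. m < \<rho> \<longrightarrow> initial_segment \<sigma> \<rho>"
      using G(1) unfolding G_def by blast
    obtain k n where k: "\<forall>\<rho>\<in>F k. n < \<rho> \<longrightarrow> initial_segment \<tau> \<rho>"
      using G(2) unfolding G_def by blast
    obtain \<rho> where \<rho>: "\<rho> \<in> F (l + j + k)" "max m n < \<rho>" using unboundedD[OF F'(2)] by blast
    have "\<rho> \<in> F l" "\<rho> \<in> F j" "\<rho> \<in> F k"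
      using \<rho>(1) F(2)[of l "l + j + k"] F(2)[of j "l + j + k"] F(2)[of k "l + j + k"]
      by auto
    then show ?thesis using j k \<rho>(2) by auto
  qed
  have sub: "G \<subseteq> F k" for k
  proof
    fix \<tau> assume "\<tau> \<in> G"
    then obtain \<rho> where "\<rho> \<in> F k" "initial_segment \<tau> \<rho>" using common by blast
    then show "\<tau> \<in> F k" using F'(1) binary_treeD by blast
  qed
  have "\<exists>\<sigma>\<in>G. n < \<sigma>" for n
  proof -
    obtain k \<sigma> where \<sigma>: "n < \<sigma>" "\<forall>\<tau>\<in>F k. initial_segment \<sigma> \<tau> \<or> initial_segment \<tau> \<sigma>"
      using decide by blast
    \<comment> \<open>A node beyond \<sigma> cannot be an initial segment of \<sigma>, so
      comparability leaves only one direction.\<close>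
    have "initial_segment \<sigma> \<tau>" if "\<tau> \<in> F k" "\<sigma> < \<tau>" for \<tau>
      using that \<sigma>(2) initial_segment_le leD by blast
    then show ?thesis using \<sigma>(1) unfolding G_def by blast
  qed
  then have "\<not> bdd_above G" unfolding bdd_above_def using leD by blast
  moreover have "binary_tree G"
    unfolding binary_tree_def
  proof (intro conjI ballI allI impI)
    show "0 < \<tau>" if "\<tau> \<in> G" for \<tau> using that sub[of 0] F'(1)[of 0] by (auto simp: binary_tree_def)
    show "\<rho> \<in> G" if "\<tau> \<in> G" "initial_segment \<rho> \<tau>" for \<rho> \<tau>
      using that initial_segment_trans unfolding G_def by blast
  qed
  moreover have "initial_segment \<sigma> \<tau> \<or> initial_segment \<tau> \<sigma>" if "\<sigma> \<in> G" "\<tau> \<in> G" for \<sigma> \<tau>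
    using common[OF that, of 0] initial_segment_comparable by blast
  ultimately have "unbounded_path G" by (simp add: unbounded_path_def)
  then show ?thesis using sub by blast
qed

text \<open>Beyond unboundedness, the requirements speak of all nodes or of all large nodes of a
  tree; being unbounded and inside each F k, G inherits them. In the collection clause a single node
  \<sigma> witnesses all x < b, so \<sigma> can later bound the witnesses.\<close>

lemma generic_path:
  assumes M: "countable (UNIV :: 'm set)" and T: "condition T"
    and \<W>: "countable \<W>" "\<And>W. W \<in> \<W> \<Longrightarrow> prefix_monotone W"
    and \<C>: "countable \<C>" "\<C> \<inter> \<Z> = {}"
  shows "\<exists>G. unbounded_path G \<and> G \<subseteq> T \<and>
    (\<forall>W\<in>\<W>. \<forall>b. (\<forall>x<b. \<exists>\<sigma>\<in>G. W \<sigma> x) \<longrightarrow> (\<exists>\<sigma>\<in>G. \<forall>x<b. W \<sigma> x)) \<and>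
    (\<forall>W\<in>\<W>. \<forall>W'\<in>\<W>. \<forall>C\<in>\<C>.
       \<not> (\<forall>x. (x \<in> C \<longleftrightarrow> (\<exists>\<sigma>\<in>G. W \<sigma> x)) \<and> (x \<notin> C \<longleftrightarrow> (\<exists>\<sigma>\<in>G. W' \<sigma> x))))"
proof -
  let ?A = "\<lambda>n T. \<exists>\<sigma>>n. \<forall>\<tau>\<in>T. initial_segment \<sigma> \<tau> \<or> initial_segment \<tau> \<sigma>"
  let ?B = "\<lambda>(W, b) T. (\<exists>x<b. \<forall>\<sigma>\<in>T. \<not> W \<sigma> x) \<or> (\<exists>m. \<forall>\<sigma>\<in>T. m < \<sigma> \<longrightarrow> (\<forall>x<b. W \<sigma> x))"
  let ?D = "\<lambda>(W, W', C) T. (\<exists>x\<in>C. \<forall>\<sigma>\<in>T. \<not> W \<sigma> x) \<or> (\<exists>x. x \<notin> C \<and> (\<forall>\<sigma>\<in>T. \<not> W' \<sigma> x)) \<or>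
     (\<exists>x m. \<forall>\<sigma>\<in>T. m < \<sigma> \<longrightarrow> W \<sigma> x \<and> W' \<sigma> x)"
  define R where "R = ?A ` UNIV \<union> ?B ` (\<W> \<times> UNIV) \<union> ?D ` (\<W> \<times> \<W> \<times> \<C>)"
  have cR: "countable R"
    unfolding R_def by (intro countable_Un countable_image countable_SIGMA M \<W>(1) \<C>(1))
  have dense: "\<exists>T'\<subseteq>S. condition T' \<and> r T'" if r: "r \<in> R" and S: "condition S" for r S
  proof -
    from r[unfolded R_def] consider n where "r = ?A n" | W b where "W \<in> \<W>" "r = ?B (W, b)"
      | W W' C where "W \<in> \<W>" "W' \<in> \<W>" "C \<in> \<C>" "r = ?D (W, W', C)"
      by (elim UnE imageE SigmaE) simp_all
    then show ?thesis
    proof cases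
      case 1
      then show ?thesis using extend_decide[OF S] by simp
    next
      case 2
      then show ?thesis using extend_collect[OF S \<W>(2)] by simp
    next
      case 3
      then have "C \<notin> \<Z>" using \<C>(2) by blast
      with 3 show ?thesis using extend_differ[OF S \<W>(2) \<W>(2), of W W' C] by simp
    qed
  qed
  have "\<exists>F. F 0 = T \<and> (\<forall>k. condition (F k)) \<and> (\<forall>j k. j \<le> k \<longrightarrow> F k \<subseteq> F j) \<and>
      (\<forall>r\<in>R. \<exists>k. r (F (k::nat)))"
    by (rule generic_sequence[OF T cR]) (rule dense)
  then obtain F where "F 0 = T \<and> (\<forall>k. condition (F k)) \<and> (\<forall>j k. j \<le> k \<longrightarrow> F k \<subseteq> F j) \<and>
      (\<forall>r\<in>R. \<exists>k. r (F (k::nat)))" by (elim exE)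
  then have F: "F 0 = T" "\<And>k. condition (F k)" "\<And>j k. j \<le> k \<Longrightarrow> F k \<subseteq> F j"
    and R: "\<And>r. r \<in> R \<Longrightarrow> \<exists>k. r (F k)" by simp_all
  have "\<exists>k. ?A n (F k)" for n by (rule R) (simp add: R_def)
  with F(2,3) have "\<exists>G. unbounded_path G \<and> (\<forall>k. G \<subseteq> F k)" by (rule sequence_path)
  then obtain G where G: "unbounded_path G" "\<And>k. G \<subseteq> F k" by blast
  have large: "\<exists>\<sigma>\<in>G. m < \<sigma>" for m using G(1) by (intro unboundedD) (simp add: unbounded_path_def)
  have collect: "\<exists>\<sigma>\<in>G. \<forall>x<b. W \<sigma> x" if W: "W \<in> \<W>" and ex: "\<forall>x<b. \<exists>\<sigma>\<in>G. W \<sigma> x" for W b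
  proof -
    have "?B (W, b) \<in> R" using W unfolding R_def by (intro UnI1 UnI2 imageI) simp
    from R[OF this] obtain k where "?B (W, b) (F k)" by (elim exE)
    then have "\<exists>m. \<forall>\<sigma>\<in>F k. m < \<sigma> \<longrightarrow> (\<forall>x<b. W \<sigma> x)" using ex G(2)[of k] by auto
    then show ?thesis using large G(2)[of k] by blast
  qed
  have differ: False if W: "W \<in> \<W>" "W' \<in> \<W>" "C \<in> \<C>"
    and eq: "\<forall>x. (x \<in> C \<longleftrightarrow> (\<exists>\<sigma>\<in>G. W \<sigma> x)) \<and> (x \<notin> C \<longleftrightarrow> (\<exists>\<sigma>\<in>G. W' \<sigma> x))" for W W' C
  proof -
    have "?D (W, W', C) \<in> R" using W unfolding R_def by (intro UnI2 imageI) simp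
    from R[OF this] obtain k where "?D (W, W', C) (F k)" by (elim exE)
    then consider x where "x \<in> C" "\<forall>\<sigma>\<in>F k. \<not> W \<sigma> x" | x where "x \<notin> C" "\<forall>\<sigma>\<in>F k. \<not> W' \<sigma> x"
      | x m where "\<forall>\<sigma>\<in>F k. m < \<sigma> \<longrightarrow> W \<sigma> x \<and> W' \<sigma> x"
      unfolding prod.case by blast
    then show False
    proof cases
      case 1
      then obtain \<sigma> where "\<sigma> \<in> G" "W \<sigma> x" using eq by blast
      then show False using 1 G(2)[of k] by blast
    next
      case 2
      then obtain \<sigma> where "\<sigma> \<in> G" "W' \<sigma> x" using eq by blast
      then show False using 2 G(2)[of k] by blast
    next
      case 3
      obtain \<sigma> where "\<sigma> \<in> G" "m < \<sigma>" using large by blast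
      then have "W \<sigma> x" "W' \<sigma> x" using 3 G(2)[of k] by blast+
      then have "x \<in> C" "x \<notin> C" using eq \<open>\<sigma> \<in> G\<close> by blast+
      then show False by blast
    qed
  qed
  have "G \<subseteq> T" using G(2)[of 0] F(1) by simp
  then show ?thesis
    using G(1) collect differ by (intro exI[of _ G] conjI ballI allI impI notI) simp_all
qed

end

subsection \<open>The finite use of an oracle\<close>

text \<open>The use function of recursion theory, for the oracle in set variable 0.\<close>

definition use_bound :: "((nat \<Rightarrow> 'm::peano_minus) \<Rightarrow> 'm) \<Rightarrow> fm \<Rightarrow> bool" where
  "use_bound u \<theta> \<longleftrightarrow> (\<forall>\<X> e E G G'. (\<forall>z\<le>u e. z \<in> G \<longleftrightarrow> z \<in> G') \<longrightarrow>
     sat \<X> e (case_nat G E) \<theta> = sat \<X> e (case_nat G' E) \<theta>)"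

lemma use_boundI:
  assumes "\<And>\<X> e E G G'. (\<And>z. z \<le> u e \<Longrightarrow> z \<in> G \<longleftrightarrow> z \<in> G') \<Longrightarrow>
     sat \<X> e (case_nat G E) \<theta> = sat \<X> e (case_nat G' E) \<theta>"
  shows "use_bound u \<theta>"
  unfolding use_bound_def by (intro allI impI assms) simp

lemma use_boundD:
  assumes "use_bound u \<theta>" "\<And>z. z \<le> u e \<Longrightarrow> z \<in> G \<longleftrightarrow> z \<in> G'"
  shows "sat \<X> e (case_nat G E) \<theta> = sat \<X> e (case_nat G' E) \<theta>"
proof -
  have "\<forall>z\<le>u e. z \<in> G \<longleftrightarrow> z \<in> G'" using assms(2) by simp
  then show ?thesis
    by (rule assms(1)[unfolded use_bound_def, THEN spec, THEN spec, THEN spec, THEN spec, THEN spec, THEN mp])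
qed

text \<open>The bound variable is replaced by the value of the bounding term; by monotonicity of
  terms this dominates the use at every smaller value.\<close>

lemma use_bound_bounded:
  assumes u: "trm u" "use_bound u \<theta>"
  shows "trm (\<lambda>e. u (case_nat (val e t) e))"
    and "use_bound (\<lambda>e. u (case_nat (val e t) e)) (BForall t \<theta>)"
    and "use_bound (\<lambda>e. u (case_nat (val e t) e)) (BExists t \<theta>)"
proof -
  let ?s = "\<lambda>n e. case n of 0 \<Rightarrow> val e t | Suc m \<Rightarrow> e m"
  have "trm (?s n)" for n by (cases n) (simp_all add: trm_val trm_var)
  then have "trm (\<lambda>e. u (\<lambda>n. ?s n e))" by (rule trm_subst[OF u(1)])
  then show "trm (\<lambda>e. u (case_nat (val e t) e))" .
  have *: "sat \<X> (case_nat x e) (case_nat G E) \<theta> = sat \<X> (case_nat x e) (case_nat G' E) \<theta>"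
    if G: "\<And>z. z \<le> u (case_nat (val e t) e) \<Longrightarrow> z \<in> G \<longleftrightarrow> z \<in> G'" and x: "x < val e t"
    for \<X> x e E G G'
  proof (rule use_boundD[OF u(2)], rule G)
    fix z assume "z \<le> u (case_nat x e)"
    also have "\<dots> \<le> u (case_nat (val e t) e)"
      using x by (intro trm_mono[OF u(1)]) (auto split: nat.split)
    finally show "z \<le> u (case_nat (val e t) e)" .
  qed
  show "use_bound (\<lambda>e. u (case_nat (val e t) e)) (BForall t \<theta>)"
    "use_bound (\<lambda>e. u (case_nat (val e t) e)) (BExists t \<theta>)"
  proof (rule_tac [!] use_boundI)
    fix \<X> e E G G'
    assume G: "\<And>z. z \<le> u (case_nat (val e t) e) \<Longrightarrow> z \<in> G \<longleftrightarrow> z \<in> G'"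
    have "sat \<X> (case_nat x e) (case_nat G E) \<theta> = sat \<X> (case_nat x e) (case_nat G' E) \<theta>"
      if "x < val e t" for x
      by (rule *[OF _ that]) (rule G)
    then show "sat \<X> e (case_nat G E) (BForall t \<theta>) = sat \<X> e (case_nat G' E) (BForall t \<theta>)"
      "sat \<X> e (case_nat G E) (BExists t \<theta>) = sat \<X> e (case_nat G' E) (BExists t \<theta>)"
      by auto
  qed
qed

text \<open>Membership atoms ask about the value of their term. Connectives take sums instead of
  maxima, since a maximum is not a term.\<close>

lemma use_bound_exists: "delta00 \<theta> \<Longrightarrow> \<exists>u :: (nat \<Rightarrow> 'm::peano_minus) \<Rightarrow> 'm. trm u \<and> use_bound u \<theta>"
proof (induction \<theta>)
  case (Mem t n)
  have "use_bound (\<lambda>e :: nat \<Rightarrow> 'm. val e t) (Mem t n)"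
    by (rule use_boundI) (auto split: nat.split)
  then show ?case by (intro exI[of _ "\<lambda>e. val e t"] conjI trm_val)
next
  case (Neg \<theta>)
  then have "\<exists>u :: (nat \<Rightarrow> 'm) \<Rightarrow> 'm. trm u \<and> use_bound u \<theta>" by simp
  then obtain u :: "(nat \<Rightarrow> 'm) \<Rightarrow> 'm" where u: "trm u" "use_bound u \<theta>" by (elim exE conjE)
  have "use_bound u (Neg \<theta>)" 
  proof (rule use_boundI)
    fix \<X> e E G G' assume G: "\<And>z. z \<le> u e \<Longrightarrow> z \<in> G \<longleftrightarrow> z \<in> G'"
    have "sat \<X> e (case_nat G E) \<theta> = sat \<X> e (case_nat G' E) \<theta>"
      by (rule use_boundD[OF u(2)], rule G)
    then show "sat \<X> e (case_nat G E) (Neg \<theta>) = sat \<X> e (case_nat G' E) (Neg \<theta>)" by simp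
  qed
  then show ?case using u(1) by (intro exI[of _ u] conjI)
next
  case (Conj \<theta> \<theta>')
  then have "\<exists>u :: (nat \<Rightarrow> 'm) \<Rightarrow> 'm. trm u \<and> use_bound u \<theta>" "\<exists>v :: (nat \<Rightarrow> 'm) \<Rightarrow> 'm. trm v \<and> use_bound v \<theta>'" by simp_all
  then obtain u v :: "(nat \<Rightarrow> 'm) \<Rightarrow> 'm" where uv: "trm u" "trm v" "use_bound u \<theta>" "use_bound v \<theta>'" by (elim exE conjE)
  have "use_bound (\<lambda>e. u e + v e) (Conj \<theta> \<theta>')"
  proof (rule use_boundI)
    fix \<X> e E G G' assume G: "\<And>z. z \<le> u e + v e \<Longrightarrow> z \<in> G \<longleftrightarrow> z \<in> G'"
    have "sat \<X> e (case_nat G E) \<theta> = sat \<X> e (case_nat G' E) \<theta>"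
      by (rule use_boundD[OF uv(3)], rule G) (erule order_trans, simp)
    moreover have "sat \<X> e (case_nat G E) \<theta>' = sat \<X> e (case_nat G' E) \<theta>'"
      by (rule use_boundD[OF uv(4)], rule G) (erule order_trans, simp)
    ultimately show "sat \<X> e (case_nat G E) (Conj \<theta> \<theta>') = sat \<X> e (case_nat G' E) (Conj \<theta> \<theta>')" by simp
  qed
  then show ?case using trm_plus[OF uv(1,2)] by (intro exI[of _ "\<lambda>e. u e + v e"] conjI)
next
  case (Disj \<theta> \<theta>')
  then have "\<exists>u :: (nat \<Rightarrow> 'm) \<Rightarrow> 'm. trm u \<and> use_bound u \<theta>" "\<exists>v :: (nat \<Rightarrow> 'm) \<Rightarrow> 'm. trm v \<and> use_bound v \<theta>'" by simp_all
  then obtain u v :: "(nat \<Rightarrow> 'm) \<Rightarrow> 'm" where uv: "trm u" "trm v" "use_bound u \<theta>" "use_bound v \<theta>'" by (elim exE conjE)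
  have "use_bound (\<lambda>e. u e + v e) (Disj \<theta> \<theta>')"
  proof (rule use_boundI)
    fix \<X> e E G G' assume G: "\<And>z. z \<le> u e + v e \<Longrightarrow> z \<in> G \<longleftrightarrow> z \<in> G'"
    have "sat \<X> e (case_nat G E) \<theta> = sat \<X> e (case_nat G' E) \<theta>"
      by (rule use_boundD[OF uv(3)], rule G) (erule order_trans, simp)
    moreover have "sat \<X> e (case_nat G E) \<theta>' = sat \<X> e (case_nat G' E) \<theta>'"
      by (rule use_boundD[OF uv(4)], rule G) (erule order_trans, simp)
    ultimately show "sat \<X> e (case_nat G E) (Disj \<theta> \<theta>') = sat \<X> e (case_nat G' E) (Disj \<theta> \<theta>')" by simp
  qed
  then show ?case using trm_plus[OF uv(1,2)] by (intro exI[of _ "\<lambda>e. u e + v e"] conjI)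
next
  case (BForall t \<theta>)
  then have "\<exists>u :: (nat \<Rightarrow> 'm) \<Rightarrow> 'm. trm u \<and> use_bound u \<theta>" by simp
  then obtain u :: "(nat \<Rightarrow> 'm) \<Rightarrow> 'm" where u: "trm u" "use_bound u \<theta>" by (elim exE conjE)
  then show ?case
    using use_bound_bounded[OF u, of t] by (intro exI[of _ "\<lambda>e. u (case_nat (val e t) e)"] conjI)
next
  case (BExists t \<theta>)
  then have "\<exists>u :: (nat \<Rightarrow> 'm) \<Rightarrow> 'm. trm u \<and> use_bound u \<theta>" by simp
  then obtain u :: "(nat \<Rightarrow> 'm) \<Rightarrow> 'm" where u: "trm u" "use_bound u \<theta>" by (elim exE conjE)
  then show ?case
    using use_bound_bounded[OF u, of t] by (intro exI[of _ "\<lambda>e. u (case_nat (val e t) e)"] conjI)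
qed (auto intro!: exI[of _ "\<lambda>e. 0"] trm_const use_boundI)

text \<open>Here y is the candidate witness and x the argument. The second-order part is {} because
  the intended formulas have no set quantifiers. Keeping the oracle G as an argument lets the
  queries be listed before any path is chosen.\<close>

definition query :: "fm \<Rightarrow> (nat \<Rightarrow> 'm) \<Rightarrow> (nat \<Rightarrow> 'm set) \<Rightarrow> 'm::peano_minus set \<Rightarrow> 'm \<Rightarrow> 'm \<Rightarrow> bool" where
  "query \<theta> e E G y x \<longleftrightarrow> sat {} (case_nat y (case_nat x e)) (case_nat G E) \<theta>"

lemma bdef_insert_query:
  assumes Q: "bdef (insert G \<Z>) (\<lambda>e. Q (e 0) (e 1))" and "\<Z> \<noteq> {}"
  shows "\<exists>\<theta> e E. delta00 \<theta> \<and> range E \<subseteq> \<Z> \<and> (\<forall>y x. Q y x \<longleftrightarrow> query \<theta> e E G y x)"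
proof -
  have ne: "insert G \<Z> \<noteq> {}" by simp
  obtain \<theta> \<theta>' e E where *: "delta00 \<theta>" "range E \<subseteq> insert G \<Z>"
    "\<forall>\<X> x y. Q y x \<longleftrightarrow> sat \<X> (case_nat y (case_nat x e)) E \<theta>"
    using bdef_syntactic_pair[OF Q Q ne] by (elim exE conjE)
  obtain Z where Z: "Z \<in> \<Z>" using assms(2) by blast
  \<comment> \<open>Every set variable with value G is redirected to the oracle variable 0 and the
    others move up by one; Z fills the vacated places so that the environment stays in \<Z>.\<close>
  define E' where "E' n = (if E n = G then Z else E n)" for n
  define s where "s n = (if E n = G then 0 else Suc n)" for n
  have E': "range E' \<subseteq> \<Z>" using *(2) Z by (auto simp: E'_def)
  have "(\<lambda>n. case_nat G E' (s n)) = E" by (rule ext) (auto simp: s_def E'_def)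
  then have "Q y x \<longleftrightarrow> query (ren id s \<theta>) e E' G y x" for y x
    using *(3) by (simp add: query_def)
  then show ?thesis using *(1) E' by (intro exI[of _ "ren id s \<theta>"] exI[of _ e] exI[of _ E']) simp
qed

lemma countable_queries:
  fixes \<Z> :: "'m::peano_minus set set"
  assumes "countable (UNIV :: 'm set)" "countable \<Z>"
  shows "countable {query \<theta> e E | \<theta> e E. range E \<subseteq> \<Z>}"
proof (rule countable_definable[OF assms])
  fix \<phi> and e e' :: "nat \<Rightarrow> 'm" and E E' :: "nat \<Rightarrow> 'm set" and N
  assume *: "supported N \<phi> TYPE('m)" "agree N e e'" "agree N E E'"
  show "query \<phi> e E = query \<phi> e' E'"
  proof (intro ext)
    fix G y x
    show "query \<phi> e E G y x = query \<phi> e' E' G y x"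
      unfolding query_def
      by (rule supportedD[OF *(1) order_refl]) (intro agree_cons *)+
  qed
qed

context rca
begin

lemma nonempty: "\<Z> \<noteq> {}"
  using RCA by (simp add: RCA0_star_def)

text \<open>A member of G that is at most \<sigma> is comparable with \<sigma> and cannot properly
  extend it. So the number \<sigma> codes the path up to \<sigma>.\<close>

lemma path_below:
  assumes "unbounded_path G" "\<sigma> \<in> G" "z \<le> \<sigma>"
  shows "z \<in> G \<longleftrightarrow> z \<in> {z. initial_segment z \<sigma>}"
proof
  assume z: "z \<in> G"
  then have "initial_segment z \<sigma> \<or> initial_segment \<sigma> z"
    using assms(1,2) by (simp add: unbounded_path_def)
  then consider "initial_segment z \<sigma>" | "initial_segment \<sigma> z" by blast
  then show "z \<in> {z. initial_segment z \<sigma>}"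
  proof cases
    case 2
    then have "z = \<sigma>" using initial_segment_le assms(3) by (intro order_antisym)
    then show ?thesis using 2 by simp
  qed simp
next
  assume "z \<in> {z. initial_segment z \<sigma>}"
  then show "z \<in> G" using assms binary_treeD unfolding unbounded_path_def by auto
qed

lemma segment_below:
  assumes "initial_segment \<sigma> \<tau>" "z \<le> (\<sigma> :: 'm)"
  shows "z \<in> {z. initial_segment z \<tau>} \<longleftrightarrow> z \<in> {z. initial_segment z \<sigma>}"
proof
  assume z: "z \<in> {z. initial_segment z \<tau>}"
  then consider "initial_segment z \<sigma>" | "initial_segment \<sigma> z"
    using assms(1) initial_segment_comparable by auto
  then show "z \<in> {z. initial_segment z \<sigma>}"
  proof cases
    case 2
    then have "z = \<sigma>" using initial_segment_le assms(2) by (intro order_antisym)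
    then show ?thesis using 2 by simp
  qed simp
next
  assume "z \<in> {z. initial_segment z \<sigma>}"
  then show "z \<in> {z. initial_segment z \<tau>}" using assms(1) initial_segment_trans by auto
qed

text \<open>With the oracle replaced by the initial segments of a node, asking it is a bounded
  predicate of that node. The general substitution s lets the induction pass binders.\<close>

lemma bdef_sat_segment:
  assumes "delta00 \<theta>" "range E \<subseteq> \<Z>" "\<And>n. trm (s n)" "trm f"
  shows "bdef \<Z> (\<lambda>e. sat \<X> (\<lambda>n. s n e) (case_nat {z. initial_segment z (f e)} E) \<theta>)"
  using assms(1,3,4)
proof (induction \<theta> arbitrary: s f)
  case (Eq t u)
  show ?case using trm_subst[OF trm_val Eq(2)] by (simp add: bdef_eq)
next
  case (Lt t u)
  show ?case using trm_subst[OF trm_val Lt(2)] by (simp add: bdef_less)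
next
  case (Mem t n)
  have t: "trm (\<lambda>e. val (\<lambda>n. s n e) t)" by (rule trm_subst[OF trm_val Mem(2)])
  show ?case
  proof (cases n)
    case 0
    then show ?thesis using bdef_initial_segment[OF t Mem(3)] by simp
  next
    case (Suc m)
    then show ?thesis using assms(2) by (auto intro!: bdef_mem t)
  qed
next
  case (Neg \<theta>)
  then show ?case by (auto intro!: bdef_not)
next
  case (Conj \<theta> \<theta>')
  then show ?case by (auto intro!: bdef_conj)
next
  case (Disj \<theta> \<theta>')
  then show ?case by (auto intro!: bdef_disj)
next
  case (BForall t \<theta>)
  define s' where "s' n = (\<lambda>e. case n of 0 \<Rightarrow> e 0 | Suc m \<Rightarrow> s m (\<lambda>k. e (Suc k)))" for n
  have "trm (s' n)" for n
    using trm_shift[OF BForall.prems(2)] by (cases n) (simp_all add: s'_def trm_var)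
  then have "bdef \<Z> (\<lambda>e. sat \<X> (\<lambda>n. s' n e) (case_nat {z. initial_segment z (f (\<lambda>n. e (Suc n)))} E) \<theta>)"
    using BForall.prems by (intro BForall.IH trm_shift) simp_all
  moreover have "(\<lambda>n. s' n e) = case_nat (e 0) (\<lambda>n. s n (\<lambda>k. e (Suc k)))" for e
    by (auto simp: s'_def split: nat.split)
  ultimately have "bdef \<Z> (\<lambda>e. sat \<X> (case_nat (e 0) (\<lambda>n. s n (\<lambda>k. e (Suc k))))
      (case_nat {z. initial_segment z (f (\<lambda>n. e (Suc n)))} E) \<theta>)" by simp
  then show ?case
    unfolding sat.simps by (rule bdef_ball) (rule trm_subst[OF trm_val BForall.prems(2)])
next
  case (BExists t \<theta>)
  define s' where "s' n = (\<lambda>e. case n of 0 \<Rightarrow> e 0 | Suc m \<Rightarrow> s m (\<lambda>k. e (Suc k)))" for n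
  have "trm (s' n)" for n
    using trm_shift[OF BExists.prems(2)] by (cases n) (simp_all add: s'_def trm_var)
  then have "bdef \<Z> (\<lambda>e. sat \<X> (\<lambda>n. s' n e) (case_nat {z. initial_segment z (f (\<lambda>n. e (Suc n)))} E) \<theta>)"
    using BExists.prems by (intro BExists.IH trm_shift) simp_all
  moreover have "(\<lambda>n. s' n e) = case_nat (e 0) (\<lambda>n. s n (\<lambda>k. e (Suc k)))" for e
    by (auto simp: s'_def split: nat.split)
  ultimately have "bdef \<Z> (\<lambda>e. sat \<X> (case_nat (e 0) (\<lambda>n. s n (\<lambda>k. e (Suc k))))
      (case_nat {z. initial_segment z (f (\<lambda>n. e (Suc n)))} E) \<theta>)" by simp
  then show ?case
    unfolding sat.simps by (rule bdef_bex) (rule trm_subst[OF trm_val BExists.prems(2)])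
qed simp_all

lemma trm_env:
  assumes "trm f" "trm g"
  shows "trm (\<lambda>e. case_nat (f e) (case_nat (g e) e0) n)"
  using assms by (cases n rule: nat.exhaust; cases "n - 1") (simp_all add: trm_const)

lemma bdef_query:
  assumes "delta00 \<theta>" "range E \<subseteq> \<Z>" "trm f" "trm g" "trm h"
  shows "bdef \<Z> (\<lambda>e. query \<theta> e0 E {z. initial_segment z (f e)} (g e) (h e))"
  unfolding query_def
  using bdef_sat_segment[OF assms(1,2), of "\<lambda>n e. case_nat (g e) (case_nat (h e) e0) n" f "{}"]
    trm_env[OF assms(4,5)] assms(3) by simp

text \<open>Turns a statement about an unbounded path into one about its nodes, in the form that the
  forcing lemmas handle. The limit y <= \<sigma> lets the node double as a bound on
  witnesses.\<close>

lemma query_witness: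
  assumes "delta00 \<theta>" "range E \<subseteq> \<Z>"
  shows "\<exists>W. prefix_monotone W \<and> (\<forall>G. unbounded_path G \<longrightarrow>
    (\<forall>x y. query \<theta> e0 E G y x \<longrightarrow> (\<exists>\<sigma>\<in>G. W \<sigma> x)) \<and>
    (\<forall>\<sigma>\<in>G. \<forall>x. W \<sigma> x \<longrightarrow> (\<exists>y<\<sigma> + 1. query \<theta> e0 E G y x)))"
proof -
  obtain u :: "(nat \<Rightarrow> 'm) \<Rightarrow> 'm" where u: "trm u" "use_bound u \<theta>"
    using use_bound_exists assms(1) by blast
  define v where "v y x = u (case_nat y (case_nat x e0))" for y x
  \<comment> \<open>The use v y x has to fit below \<sigma>; longer nodes then give the same answer,
    whence monotonicity.\<close>
  define W where "W \<sigma> x \<longleftrightarrow> (\<exists>y<\<sigma> + 1. v y x \<le> \<sigma> \<and> query \<theta> e0 E {z. initial_segment z \<sigma>} y x)" for \<sigma> x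
  have trm_v: "trm (\<lambda>e. v (f e) (g e))" if "trm f" "trm g" for f g
    unfolding v_def using trm_subst[OF u(1) trm_env[OF that]] .
  have query: "query \<theta> e0 E G y x = query \<theta> e0 E G' y x"
    if "\<And>z. z \<le> \<sigma> \<Longrightarrow> z \<in> G \<longleftrightarrow> z \<in> G'" "v y x \<le> \<sigma>" for G G' \<sigma> x y
    unfolding query_def
    by (rule use_boundD[OF u(2)], rule that(1)) (use that(2) in \<open>simp add: v_def\<close>)
  have "bdef \<Z> (\<lambda>e. W (e 0) (e 1))"
    unfolding W_def
    by (intro bdef_bex bdef_conj bdef_le bdef_query assms trm_v trm_plus trm_var trm_const)
  moreover have "W \<tau> x" if \<sigma>: "initial_segment \<sigma> \<tau>" "W \<sigma> x" for \<sigma> \<tau> x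
  proof -
    obtain y where y: "y < \<sigma> + 1" "v y x \<le> \<sigma>" "query \<theta> e0 E {z. initial_segment z \<sigma>} y x"
      using \<sigma>(2) unfolding W_def by blast
    have "query \<theta> e0 E {z. initial_segment z \<tau>} y x"
      using y(3) query[OF segment_below[OF \<sigma>(1)] y(2)] by simp
    moreover have "\<sigma> \<le> \<tau>" by (rule initial_segment_le[OF \<sigma>(1)])
    ultimately show ?thesis unfolding W_def using y(1,2)
      by (intro exI[of _ y]) (auto intro: order_trans)
  qed
  ultimately have "prefix_monotone W" by (simp add: prefix_monotone_def)
  moreover have "\<exists>\<sigma>\<in>G. W \<sigma> x" if G: "unbounded_path G" "query \<theta> e0 E G y x" for G x y
  proof -
    have "\<not> bdd_above G" using G(1) by (simp add: unbounded_path_def)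
    \<comment> \<open>The sum forces \<sigma> above both the use and the witness.\<close>
    then obtain \<sigma> where \<sigma>: "\<sigma> \<in> G" "v y x + y < \<sigma>" by (elim unboundedD[elim_format] bexE)
    have "v y x \<le> \<sigma>" "y \<le> \<sigma>"
      using \<sigma>(2) by (auto intro: order_trans[OF pm_le_add(1)] order_trans[OF pm_le_add(2)] order_less_imp_le)
    moreover have "query \<theta> e0 E {z. initial_segment z \<sigma>} y x"
      using G(2) query[OF path_below[OF G(1) \<sigma>(1)] \<open>v y x \<le> \<sigma>\<close>] by simp
    ultimately show ?thesis using \<sigma>(1) unfolding W_def by auto
  qed
  moreover have "\<exists>y<\<sigma> + 1. query \<theta> e0 E G y x" if G: "unbounded_path G" "\<sigma> \<in> G" "W \<sigma> x" for G \<sigma> x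
  proof -
    obtain y where y: "y < \<sigma> + 1" "v y x \<le> \<sigma>" "query \<theta> e0 E {z. initial_segment z \<sigma>} y x"
      using G(3) unfolding W_def by blast
    then show ?thesis using query[OF path_below[OF G(1,2)] y(2)] by blast
  qed
  ultimately show ?thesis by (intro exI[of _ W]) simp
qed

text \<open>Uses are monotone in x, so one node beyond the use at a answers all queries for x <= a,
  and the induction takes place in \<Z>.\<close>

lemma ind_insert_path:
  assumes G: "unbounded_path G"
  shows "ind (insert G \<Z>)"
  unfolding ind_def
proof (intro allI impI)
  fix P :: "'m \<Rightarrow> bool" and a
  assume P: "bdef (insert G \<Z>) (\<lambda>e. P (e 0))" "P 0" "\<forall>x. P x \<longrightarrow> P (x + 1)"
  have "bdef (insert G \<Z>) (\<lambda>e. P (e 1))" by (rule bdef_subst1[OF P(1) trm_var])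
  then have "\<exists>\<theta> e E. delta00 \<theta> \<and> range E \<subseteq> \<Z> \<and> (\<forall>y x. P x \<longleftrightarrow> query \<theta> e E G y x)"
    using bdef_insert_query[of G \<Z> "\<lambda>y x. P x"] nonempty by simp
  then obtain \<theta> e E where q: "delta00 \<theta>" "range E \<subseteq> \<Z>" "\<forall>y x. P x \<longleftrightarrow> query \<theta> e E G y x"
    by (elim exE conjE)
  obtain u :: "(nat \<Rightarrow> 'm) \<Rightarrow> 'm" where u: "trm u" "use_bound u \<theta>"
    using use_bound_exists q(1) by blast
  define v where "v x = u (case_nat 0 (case_nat x e))" for x
  have "\<not> bdd_above G" using G by (simp add: unbounded_path_def)
  then obtain \<sigma> where \<sigma>: "\<sigma> \<in> G" "v a < \<sigma>" by (elim unboundedD[elim_format] bexE)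
  let ?q = "\<lambda>x. query \<theta> e E {z. initial_segment z \<sigma>} 0 x"
  have iff: "P x \<longleftrightarrow> ?q x" if "x \<le> a" for x
  proof -
    have "v x \<le> v a" unfolding v_def
      using that by (intro trm_mono[OF u(1)]) (auto split: nat.split)
    then have "v x \<le> \<sigma>" using \<sigma>(2) by simp
    have "query \<theta> e E G 0 x = ?q x"
      unfolding query_def
      by (rule use_boundD[OF u(2)], rule path_below[OF G \<sigma>(1)])
        (use \<open>v x \<le> \<sigma>\<close> in \<open>simp add: v_def\<close>)
    then show ?thesis using q(3) by simp
  qed
  have "a \<le> a \<longrightarrow> ?q a"
  proof (rule induct[of "\<lambda>x. x \<le> a \<longrightarrow> ?q x"])
    show "bdef \<Z> (\<lambda>e'. e' 0 \<le> a \<longrightarrow> query \<theta> e E {z. initial_segment z \<sigma>} 0 (e' 0))"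
      by (intro bdef_imp bdef_le bdef_query q trm_var trm_const)
    show "0 \<le> a \<longrightarrow> ?q 0" using iff P(2) by simp
    fix x assume IH: "x \<le> a \<longrightarrow> ?q x"
    show "x + 1 \<le> a \<longrightarrow> ?q (x + 1)"
    proof
      assume le: "x + 1 \<le> a"
      then have "x \<le> a" by (rule order_trans[OF pm_le_add(1)])
      then have "P x" using IH iff by simp
      then have "P (x + 1)" using P(3) by simp
      then show "?q (x + 1)" using iff le by simp
    qed
  qed
  then show "P a" using iff by simp
qed

subsection \<open>Adding paths\<close>

text \<open>Predicates bounded over \<open>insert G \<Z>\<close> depend on G, yet the forcing
  requirements have to be fixed beforehand. Queries resolve this: they have parameters from \<Z>
  only, are countably many, and receive their witness predicates before G is chosen.\<close>

lemma generic_extension: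
  assumes M: "countable (UNIV :: 'm set)" and Z: "countable \<Z>" and T: "condition T"
    and \<C>: "countable \<C>" "\<C> \<inter> \<Z> = {}"
  shows "\<exists>\<Z>'. RCA0_star \<Z>' \<and> countable \<Z>' \<and> \<C> \<inter> \<Z>' = {} \<and> \<Z> \<subseteq> \<Z>' \<and>
    (\<exists>G\<in>\<Z>'. unbounded_path G \<and> G \<subseteq> T)"
proof -
  let ?\<Q> = "{q. \<exists>\<theta> e E. q = query \<theta> e E \<and> delta00 \<theta> \<and> range E \<subseteq> \<Z>}"
  let ?wit = "\<lambda>q W. prefix_monotone W \<and> (\<forall>G. unbounded_path G \<longrightarrow>
    (\<forall>x y. q G y x \<longrightarrow> (\<exists>\<sigma>\<in>G. W \<sigma> x)) \<and> (\<forall>\<sigma>\<in>G. \<forall>x. W \<sigma> x \<longrightarrow> (\<exists>y<\<sigma> + 1. q G y x)))"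
  have cQ: "countable ?\<Q>"
    by (rule countable_subset[OF _ countable_queries[OF M Z]]) auto
  have "\<forall>q\<in>?\<Q>. \<exists>W. ?wit q W" using query_witness by auto
  then obtain w where w: "\<forall>q\<in>?\<Q>. ?wit q (w q)" by (rule bchoice[elim_format]) (elim exE)
  have "prefix_monotone W" if "W \<in> w ` ?\<Q>" for W using that w by auto
  then have "\<exists>G. unbounded_path G \<and> G \<subseteq> T \<and>
    (\<forall>W\<in>w ` ?\<Q>. \<forall>b. (\<forall>x<b. \<exists>\<sigma>\<in>G. W \<sigma> x) \<longrightarrow> (\<exists>\<sigma>\<in>G. \<forall>x<b. W \<sigma> x)) \<and>
    (\<forall>W\<in>w ` ?\<Q>. \<forall>W'\<in>w ` ?\<Q>. \<forall>C\<in>\<C>.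
       \<not> (\<forall>x. (x \<in> C \<longleftrightarrow> (\<exists>\<sigma>\<in>G. W \<sigma> x)) \<and> (x \<notin> C \<longleftrightarrow> (\<exists>\<sigma>\<in>G. W' \<sigma> x))))"
    by (intro generic_path M T \<C> countable_image cQ)
  then obtain G where G: "unbounded_path G" "G \<subseteq> T"
    and collect: "\<forall>W\<in>w ` ?\<Q>. \<forall>b. (\<forall>x<b. \<exists>\<sigma>\<in>G. W \<sigma> x) \<longrightarrow> (\<exists>\<sigma>\<in>G. \<forall>x<b. W \<sigma> x)"
    and differ: "\<forall>W\<in>w ` ?\<Q>. \<forall>W'\<in>w ` ?\<Q>. \<forall>C\<in>\<C>.
       \<not> (\<forall>x. (x \<in> C \<longleftrightarrow> (\<exists>\<sigma>\<in>G. W \<sigma> x)) \<and> (x \<notin> C \<longleftrightarrow> (\<exists>\<sigma>\<in>G. W' \<sigma> x)))"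
    by (elim exE conjE)
  have wit: "\<exists>W\<in>w ` ?\<Q>. (\<forall>x. (\<exists>y. Q y x) \<longleftrightarrow> (\<exists>\<sigma>\<in>G. W \<sigma> x)) \<and>
      (\<forall>\<sigma>\<in>G. \<forall>x. W \<sigma> x \<longrightarrow> (\<exists>y<\<sigma> + 1. Q y x))"
    if Q: "bdef (insert G \<Z>) (\<lambda>e. Q (e 0) (e 1))" for Q
  proof -
    obtain \<theta> e E where q: "delta00 \<theta>" "range E \<subseteq> \<Z>" "\<forall>y x. Q y x \<longleftrightarrow> query \<theta> e E G y x"
      using bdef_insert_query[OF Q nonempty] by (elim exE conjE)
    have mem: "query \<theta> e E \<in> ?\<Q>" using q by blast
    have "?wit (query \<theta> e E) (w (query \<theta> e E))" using w mem by (rule bspec)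
    then have "(\<forall>x y. Q y x \<longrightarrow> (\<exists>\<sigma>\<in>G. w (query \<theta> e E) \<sigma> x)) \<and>
        (\<forall>\<sigma>\<in>G. \<forall>x. w (query \<theta> e E) \<sigma> x \<longrightarrow> (\<exists>y<\<sigma> + 1. Q y x))"
      using G(1) q(3) by simp
    then show ?thesis using imageI[OF mem, of w] by (intro bexI[of _ "w (query \<theta> e E)"]) blast+
  qed
  have coll: "coll (insert G \<Z>)"
    unfolding coll_def
  proof (intro allI impI)
    fix Q :: "'m \<Rightarrow> 'm \<Rightarrow> bool" and b
    assume Q: "bdef (insert G \<Z>) (\<lambda>e. Q (e 0) (e 1))" "\<forall>x<b. \<exists>y. Q y x"
    obtain W where W: "W \<in> w ` ?\<Q>" "\<forall>x. (\<exists>y. Q y x) \<longleftrightarrow> (\<exists>\<sigma>\<in>G. W \<sigma> x)"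
      "\<forall>\<sigma>\<in>G. \<forall>x. W \<sigma> x \<longrightarrow> (\<exists>y<\<sigma> + 1. Q y x)" using wit[OF Q(1)] by (elim bexE conjE)
    have "\<forall>x<b. \<exists>\<sigma>\<in>G. W \<sigma> x" using Q(2) W(2) by simp
    then obtain \<sigma> where "\<sigma> \<in> G" "\<forall>x<b. W \<sigma> x" using bspec[OF collect W(1)] by auto
    then show "\<exists>c. \<forall>x<b. \<exists>y<c. Q y x" using W(3) by (intro exI[of _ "\<sigma> + 1"]) blast
  qed
  have "C \<notin> Delta1 (insert G \<Z>)" if C: "C \<in> \<C>" for C
  proof
    assume *: "C \<in> Delta1 (insert G \<Z>)"
    obtain Q Q' where Q: "bdef (insert G \<Z>) (\<lambda>e. Q (e 0) (e 1))" "\<forall>x. x \<in> C \<longleftrightarrow> (\<exists>y. Q y x)"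
      and Q': "bdef (insert G \<Z>) (\<lambda>e. Q' (e 0) (e 1))" "\<forall>x. x \<notin> C \<longleftrightarrow> (\<exists>y. Q' y x)"
      using Delta1_parts[OF *] by (elim exE conjE)
    obtain W where W: "W \<in> w ` ?\<Q>" "\<forall>x. (\<exists>y. Q y x) \<longleftrightarrow> (\<exists>\<sigma>\<in>G. W \<sigma> x)"
      using wit[OF Q(1)] by (elim bexE conjE)
    obtain W' where W': "W' \<in> w ` ?\<Q>" "\<forall>x. (\<exists>y. Q' y x) \<longleftrightarrow> (\<exists>\<sigma>\<in>G. W' \<sigma> x)"
      using wit[OF Q'(1)] by (elim bexE conjE)
    have "\<forall>x. (x \<in> C \<longleftrightarrow> (\<exists>\<sigma>\<in>G. W \<sigma> x)) \<and> (x \<notin> C \<longleftrightarrow> (\<exists>\<sigma>\<in>G. W' \<sigma> x))"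
      unfolding W(2)[rule_format, symmetric] W'(2)[rule_format, symmetric] using Q(2) Q'(2) by blast
    then show False using bspec[OF bspec[OF bspec[OF differ W(1)] W'(1)] C] by blast
  qed
  moreover have "RCA0_star (Delta1 (insert G \<Z>))"
    using ind_insert_path[OF G(1)] coll RCA
    by (intro RCA0_star_Delta1) (simp_all add: RCA0_star_def)
  moreover have "countable (Delta1 (insert G \<Z>))"
    using Z by (intro countable_Delta1 M) simp_all
  moreover have "insert G \<Z> \<subseteq> Delta1 (insert G \<Z>)" by (rule subset_Delta1)
  ultimately show ?thesis using G by (intro exI[of _ "Delta1 (insert G \<Z>)"]) blast
qed

end

section \<open>Unions of chains of models and the iteration\<close>

text \<open>The first N sets of the environment lie in one common stage; the others are replaced by
  a set of \<open>F 0\<close>, which a formula of support N does not notice.\<close>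

lemma chain_env:
  fixes F :: "nat \<Rightarrow> 'a set"
  assumes F: "\<And>j k. j \<le> k \<Longrightarrow> F j \<subseteq> F k" and ne: "F 0 \<noteq> {}" and E: "range E \<subseteq> (\<Union>n. F n)"
  shows "\<exists>n E'. range E' \<subseteq> F n \<and> agree N E E'"
proof (induction N)
  case 0
  obtain Z where "Z \<in> F 0" using ne by blast
  then have "range (\<lambda>_::nat. Z) \<subseteq> F 0 \<and> agree 0 E (\<lambda>_. Z)" by (auto simp: agree_def)
  then show ?case by blast
next
  case (Suc N)
  then obtain n E' where *: "range E' \<subseteq> F n" "agree N E E'" by blast
  obtain m where m: "E N \<in> F m" using E by blast
  have "range (E'(N := E N)) \<subseteq> F (n + m)"
    using *(1) m F[of n "n + m"] F[of m "n + m"] by (auto simp: image_subset_iff)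
  moreover have "agree (Suc N) E (E'(N := E N))"
    using *(2) by (auto simp: agree_def less_Suc_eq)
  ultimately show ?case by blast
qed

lemma sat_sigma01_indep: "sigma01 \<phi> \<Longrightarrow> sat \<X> e E \<phi> = sat \<Y> e E \<phi>"
  by (auto simp: sigma01_def sat_delta00_indep[of _ \<X> _ _ \<Y>])

lemma sat_pi01_indep: "pi01 \<phi> \<Longrightarrow> sat \<X> e E \<phi> = sat \<Y> e E \<phi>"
  by (auto simp: pi01_def sat_delta00_indep[of _ \<X> _ _ \<Y>])

text \<open>Each instance of a scheme has finite support and so lives in one stage. Its formulas
  have no set quantifiers, so their truth is the same there and in the union.\<close>

lemma RCA0_star_chain:
  fixes F :: "nat \<Rightarrow> 'm::peano_minus set set"
  assumes F: "\<And>j k. j \<le> k \<Longrightarrow> F j \<subseteq> F k" and R: "\<And>n. RCA0_star (F n)"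
  shows "RCA0_star (\<Union>n. F n)"
proof -
  let ?U = "\<Union>n. F n"
  have ne: "F 0 \<noteq> {}" using R by (simp add: RCA0_star_def)
  have "delta00_induction ?U"
    unfolding delta00_induction_def
  proof (intro allI impI)
    fix \<phi> e E and x :: 'm
    assume \<phi>: "delta00 \<phi>" and E: "range E \<subseteq> ?U" and 0: "sat ?U (case_nat 0 e) E \<phi>"
      and step: "\<forall>x. sat ?U (case_nat x e) E \<phi> \<longrightarrow> sat ?U (case_nat (x + 1) e) E \<phi>"
    obtain N where N: "supported N \<phi> TYPE('m)" using sat_support by blast
    obtain n E' where E': "range E' \<subseteq> F n" "agree N E E'" using chain_env[OF F ne E] by blast
    have eq: "sat ?U (case_nat x e) E \<phi> = sat (F n) (case_nat x e) E' \<phi>" for x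
    proof -
      have "sat ?U (case_nat x e) E \<phi> = sat ?U (case_nat x e) E' \<phi>"
        by (rule supportedD[OF N order_refl _ E'(2)]) (simp add: agree_def)
      then show ?thesis using sat_delta00_indep[OF \<phi>] by simp
    qed
    have ind: "delta00_induction (F n)" using R by (simp add: RCA0_star_def)
    have "sat (F n) (case_nat x e) E' \<phi>"
      by (rule ind[unfolded delta00_induction_def, rule_format, OF \<phi> E'(1)])
        (use 0 step in \<open>simp_all add: eq\<close>)
    then show "sat ?U (case_nat x e) E \<phi>" using eq by simp
  qed
  moreover have "delta01_comprehension ?U"
    unfolding delta01_comprehension_def
  proof (intro allI impI)
    fix \<phi> \<psi> e and E :: "nat \<Rightarrow> 'm set"
    assume \<phi>: "sigma01 \<phi>" "pi01 \<psi>" and E: "range E \<subseteq> ?U"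
      and iff: "\<forall>x. sat ?U (case_nat x e) E \<phi> \<longleftrightarrow> sat ?U (case_nat x e) E \<psi>"
    obtain N1 N2 where N12: "supported N1 \<phi> TYPE('m)" "supported N2 \<psi> TYPE('m)"
      using sat_support by blast
    define N where "N = N1 + N2"
    have N: "supported N \<phi> TYPE('m)" "supported N \<psi> TYPE('m)"
      by (rule supported_mono[OF N12(1)], simp add: N_def, rule supported_mono[OF N12(2)], simp add: N_def)
    obtain n E' where E': "range E' \<subseteq> F n" "agree N E E'" using chain_env[OF F ne E] by blast
    have eq: "sat ?U (case_nat x e) E \<phi> = sat (F n) (case_nat x e) E' \<phi>"
      "sat ?U (case_nat x e) E \<psi> = sat (F n) (case_nat x e) E' \<psi>" for x
    proof -
      have "sat ?U (case_nat x e) E \<phi> = sat ?U (case_nat x e) E' \<phi>"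
        by (rule supportedD[OF N(1) order_refl _ E'(2)]) (simp add: agree_def)
      then show "sat ?U (case_nat x e) E \<phi> = sat (F n) (case_nat x e) E' \<phi>"
        using sat_sigma01_indep[OF \<phi>(1)] by simp
      have "sat ?U (case_nat x e) E \<psi> = sat ?U (case_nat x e) E' \<psi>"
        by (rule supportedD[OF N(2) order_refl _ E'(2)]) (simp add: agree_def)
      then show "sat ?U (case_nat x e) E \<psi> = sat (F n) (case_nat x e) E' \<psi>"
        using sat_pi01_indep[OF \<phi>(2)] by simp
    qed
    have comp: "delta01_comprehension (F n)" using R by (simp add: RCA0_star_def)
    have "\<exists>S\<in>F n. \<forall>x. x \<in> S \<longleftrightarrow> sat (F n) (case_nat x e) E' \<phi>"
      by (rule comp[unfolded delta01_comprehension_def, rule_format, OF \<phi> E'(1)])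
        (use iff in \<open>simp add: eq\<close>)
    then obtain S where "S \<in> F n" "\<forall>x. x \<in> S \<longleftrightarrow> sat (F n) (case_nat x e) E' \<phi>" by (elim bexE)
    then show "\<exists>S\<in>?U. \<forall>x. x \<in> S \<longleftrightarrow> sat ?U (case_nat x e) E \<phi>"
      by (intro bexI[of _ S]) (auto simp: eq)
  qed
  ultimately show ?thesis using R[of 0] ne by (auto simp: RCA0_star_def)
qed

definition admissible :: "'m::peano_minus set set \<Rightarrow> 'm set set \<Rightarrow> bool" where
  "admissible \<C> \<Z> \<longleftrightarrow> RCA0_star \<Z> \<and> countable \<Z> \<and> \<C> \<inter> \<Z> = {}"

lemma admissible_chain:
  assumes "\<And>n. admissible \<C> (F n)" "\<And>n. F n \<subseteq> F (Suc n)"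
  shows "admissible \<C> (\<Union>n. F n)"
proof -
  have "F j \<subseteq> F k" if "j \<le> k" for j k using lift_Suc_mono_le[of F, OF assms(2) that] .
  moreover have "RCA0_star (F n)" for n using assms(1)[of n] by (simp add: admissible_def)
  ultimately have "RCA0_star (\<Union>n. F n)" by (rule RCA0_star_chain)
  then show ?thesis using assms(1) by (auto simp: admissible_def)
qed

definition has_path :: "'m::peano_minus set set \<Rightarrow> 'm set \<Rightarrow> bool" where
  "has_path \<Z> T \<longleftrightarrow> (binary_tree T \<longrightarrow> \<not> bdd_above T \<longrightarrow> (\<exists>P\<in>\<Z>. path_of T P \<and> \<not> bdd_above P))"

lemma has_path_mono: "has_path \<Z> T \<Longrightarrow> \<Z> \<subseteq> \<Z>' \<Longrightarrow> has_path \<Z>' T"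
  unfolding has_path_def by auto

lemma admissible_add_path:
  fixes \<Z> :: "'m::peano_minus set set"
  assumes "countable (UNIV :: 'm set)" "countable \<C>" "admissible \<C> \<Z>" "T \<in> \<Z>"
  shows "\<exists>\<Z>'. admissible \<C> \<Z>' \<and> \<Z> \<subseteq> \<Z>' \<and> has_path \<Z>' T"
proof (cases "binary_tree T \<and> \<not> bdd_above T")
  case True
  interpret rca \<Z> using assms(3) by unfold_locales (simp add: admissible_def)
  have "condition T" using True assms(4) by (simp add: condition_def)
  then obtain \<Z>' G where *: "RCA0_star \<Z>'" "countable \<Z>'" "\<C> \<inter> \<Z>' = {}" "\<Z> \<subseteq> \<Z>'"
    "G \<in> \<Z>'" "unbounded_path G" "G \<subseteq> T"
    using generic_extension[of T \<C>] assms by (auto simp: admissible_def)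
  then have "has_path \<Z>' T"
    unfolding has_path_def by (intro impI bexI[of _ G]) (simp_all add: unbounded_path_def path_of_def)
  then show ?thesis using * by (intro exI[of _ \<Z>']) (simp add: admissible_def)
next
  case False
  then show ?thesis using assms(3) by (intro exI[of _ \<Z>]) (auto simp: has_path_def)
qed

text \<open>One \<omega>-chain serves the countably many trees of \<Z>. Trees created on the way are
  left to the next round.\<close>

lemma admissible_add_paths:
  fixes \<Z> :: "'m::peano_minus set set"
  assumes M: "countable (UNIV :: 'm set)" "countable \<C>" and Z: "admissible \<C> \<Z>"
  shows "\<exists>\<Z>'. admissible \<C> \<Z>' \<and> \<Z> \<subseteq> \<Z>' \<and> (\<forall>T\<in>\<Z>. has_path \<Z>' T)"
proof -
  have Z': "countable \<Z>" "\<Z> \<noteq> {}" using Z by (simp_all add: admissible_def RCA0_star_def)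
  let ?T = "from_nat_into \<Z>"
  have "\<exists>F. \<forall>n. (admissible \<C> (F n) \<and> \<Z> \<subseteq> F n) \<and> (F n \<subseteq> F (Suc n) \<and> has_path (F (Suc n)) (?T n))"
  proof (rule dependent_nat_choice)
    show "\<exists>X. admissible \<C> X \<and> \<Z> \<subseteq> X" using Z by blast
    fix X and n :: nat assume X: "admissible \<C> X \<and> \<Z> \<subseteq> X"
    then have "?T n \<in> X" using from_nat_into[OF Z'(2)] by blast
    then obtain X' where "admissible \<C> X'" "X \<subseteq> X'" "has_path X' (?T n)"
      using admissible_add_path[OF M, of X "?T n"] X by blast
    then show "\<exists>X'. (admissible \<C> X' \<and> \<Z> \<subseteq> X') \<and> X \<subseteq> X' \<and> has_path X' (?T n)"
      using X by blast
  qed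
  then obtain F where *: "\<forall>n. (admissible \<C> (F n) \<and> \<Z> \<subseteq> F n) \<and>
      (F n \<subseteq> F (Suc n) \<and> has_path (F (Suc n)) (?T n))" by (elim exE)
  have "admissible \<C> (\<Union>n. F n)" by (rule admissible_chain) (use * in simp_all)
  moreover have "\<Z> \<subseteq> (\<Union>n. F n)" using * by blast
  moreover have "has_path (\<Union>n. F n) T" if T: "T \<in> \<Z>" for T
  proof -
    obtain n where "?T n = T" using from_nat_into_to_nat_on[OF Z'(1) T] by blast
    then have "has_path (F (Suc n)) T" using * by auto
    then show ?thesis by (rule has_path_mono) blast
  qed
  ultimately show ?thesis by blast
qed

text \<open>A second \<omega>-chain closes off: a tree of the union appears at some stage and has
  its path at the next.\<close>

lemma admissible_WKL0_star:
  fixes \<Z> :: "'m::peano_minus set set"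
  assumes M: "countable (UNIV :: 'm set)" "countable \<C>" and Z: "admissible \<C> \<Z>"
  shows "\<exists>\<Y>. WKL0_star \<Y> \<and> \<C> \<inter> \<Y> = {}"
proof -
  have "\<exists>F. \<forall>n. admissible \<C> (F n) \<and> (F n \<subseteq> F (Suc n) \<and> (\<forall>T\<in>F n. has_path (F (Suc n)) T))"
  proof (rule dependent_nat_choice)
    show "\<exists>X. admissible \<C> X" using Z by blast
    show "\<exists>X'. admissible \<C> X' \<and> X \<subseteq> X' \<and> (\<forall>T\<in>X. has_path X' T)" if "admissible \<C> X" for X
      using admissible_add_paths[OF M that] .
  qed
  then obtain F where *: "\<forall>n. admissible \<C> (F n) \<and>
      (F n \<subseteq> F (Suc n) \<and> (\<forall>T\<in>F n. has_path (F (Suc n)) T))" by (elim exE)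
  have adm: "admissible \<C> (\<Union>n. F n)" by (rule admissible_chain) (use * in simp_all)
  have "has_path (\<Union>n. F n) T" if T: "T \<in> (\<Union>n. F n)" for T
  proof -
    obtain n where "T \<in> F n" using T by blast
    then have "has_path (F (Suc n)) T" using * by blast
    then show ?thesis by (rule has_path_mono) blast
  qed
  then have "weak_Koenig (\<Union>n. F n)" unfolding weak_Koenig_def has_path_def by simp
  then show ?thesis using adm by (intro exI[of _ "\<Union>n. F n"]) (simp add: WKL0_star_def admissible_def)
qed

theorem theorem4p1:
  fixes \<X> :: "'m::peano_minus set set" and A :: "'m set"
  assumes "countable (UNIV :: 'm set)" and "countable \<X>"
    and "RCA0_star \<X>"
    and "A \<in> \<X>"
  shows "\<exists>\<Y> :: 'm set set. WKL0_star \<Y> \<and>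
           (\<forall>Y\<in>\<Y>. so_definable \<X> Y \<longleftrightarrow> Y \<in> delta01_in A)"
proof -
  let ?C = "{Y. so_definable \<X> Y} - delta01_in A"
  interpret rca \<X> using assms(3) by unfold_locales
  have "RCA0_star (Delta1 {A})"
    using ind_mono[OF ind] coll_mono[OF coll] assms(3,4)
    by (intro RCA0_star_Delta1) (simp_all add: RCA0_star_def)
  moreover have "countable (Delta1 {A})" by (intro countable_Delta1 assms(1)) simp_all
  ultimately have "admissible ?C (Delta1 {A})"
    using Delta1_delta01_in[of A] by (auto simp: admissible_def)
  moreover have "countable ?C" using countable_so_definable[OF assms(1,2)] by (rule countable_Diff)
  ultimately obtain \<Y> where \<Y>: "WKL0_star \<Y>" "?C \<inter> \<Y> = {}"
    using admissible_WKL0_star[OF assms(1)] by blast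
  \<comment> \<open>This direction holds for every Y, since A may serve as a parameter over (M,
    \<X>); the forcing concerns the other one.\<close>
  have "so_definable \<X> Y" if Y: "Y \<in> delta01_in A" for Y
  proof -
    obtain \<phi> e where \<phi>: "sigma01 \<phi>" "Y = defset {A} e (\<lambda>_. A) \<phi>"
      using Y unfolding delta01_in_def by blast
    then have "Y = defset \<X> e (\<lambda>_. A) \<phi>" unfolding defset_def using sat_sigma01_indep[OF \<phi>(1)] by auto
    moreover have "range (\<lambda>_::nat. A) \<subseteq> \<X>" using assms(4) by auto
    ultimately show ?thesis unfolding so_definable_def by (intro exI conjI)
  qed
  then show ?thesis using \<Y> by blast
qed

end
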